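(* Let $V_n$ be the real vector space of homogeneous quadratic polynomial maps $\Gamma:\mathbb{C}^n\to\mathbb{C}^n$ with real coefficients satisfying $(x,\Gamma(x))=0$ and $(\Gamma(x),\Gamma(x))=0$ for all $x\in C$, and let $W_n\subset V_n$ be the subspace of maps $x\mapsto\lambda(x)x$ with $\lambda$ a real linear functional. Then: every complete rectifiable bundle of circles $\mathcal S$ in $\mathbb{R}^n$ admits a normalized rectifier; the class of $\Phi_2$ in $V_n/W_n$ (for $\Phi$ a normalized rectifier of $\mathcal S$) is well defined, i.e. $\Phi_2\in V_n$ and its class does not depend on the choice of $\Phi$; and the resulting map $\mathcal S\mapsto[\Phi_2]$ is a bijection from the set of complete rectifiable bundles of circles in $\mathbb{R}^n$ onto $V_n/W_n$.
   Context: A *circle* in $\mathbb{R}^n$ means either a round Euclidean circle or a straight line; $\mathbb{R}^n$ carries the standard Euclidean inner product $(\cdot,\cdot)$, extended to $\mathbb{C}^n$ complex-bilinearly; the *asymptotic cone* is $C=\{x\in\mathbb{C}^n:(x,x)=0\}$. A *simple bundle of circles* in $\mathbb{R}^n$ is a collection of circles all passing through $0$, no two tangent at $0$; it is *rectifiable* if some germ at $0$ of a smooth diffeomorphism $(\mathbb{R}^n,0)\to(\mathbb{R}^n,0)$ maps the germ at $0$ of every circle of the collection into a straight line. It is *complete* if for every line $\ell$ through $0$ there is exactly one circle of the bundle tangent to $\ell$ at $0$. A *normalized rectifier* of a bundle $\mathcal S$ is a germ of smooth diffeomorphism $\Phi:(\mathbb{R}^n,0)\to(\mathbb{R}^n,0)$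 with $d_0\Phi=\mathrm{id}$ such that $\Phi^{-1}$ maps the germ at $0$ of each circle of $\mathcal S$ into a straight line. $\Phi_2$ denotes the homogeneous quadratic part of the Taylor expansion $\Phi(x)=x+\Phi_2(x)+\cdots$, extended to $\mathbb{C}^n$.
   Formalization: V_n need not be a vector space (for n=4, in quaternions, x₁ix and x₁xi lie in V_4 but their sum does not); here V_n is taken only as a set, and V_n/W_n is the set of classes of maps in V_n that differ by an element of W_n. *)

theory Defs
  imports "HOL-Analysis.Analysis"
begin

definition is_line :: "(real^'n) set \<Rightarrow> bool" where
  "is_line L \<longleftrightarrow> (\<exists>a w. w \<noteq> 0 \<and> L = range (\<lambda>t. a + t *\<^sub>R w))"

definition is_round_circle :: "(real^'n) set \<Rightarrow> bool" where
  "is_round_circle S \<longleftrightarrow> (\<exists>c r u w. r > 0 \<and> norm u = 1 \<and> norm w = 1 \<and> u \<bullet> w = 0 \<and>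
       S = range (\<lambda>t. c + (r * cos t) *\<^sub>R u + (r * sin t) *\<^sub>R w))"

definition is_circle :: "(real^'n) set \<Rightarrow> bool" where
  "is_circle S \<longleftrightarrow> is_line S \<or> is_round_circle S"

definition tangent0 :: "(real^'n) set \<Rightarrow> real^'n \<Rightarrow> bool" where
  "tangent0 S v \<longleftrightarrow>
     (\<exists>a w t0. w \<noteq> 0 \<and> S = range (\<lambda>t. a + t *\<^sub>R w) \<and> a + t0 *\<^sub>R w = 0 \<and>
        (\<exists>k. k \<noteq> 0 \<and> v = k *\<^sub>R w))
   \<or> (\<exists>c r u w t0. r > 0 \<and> norm u = 1 \<and> norm w = 1 \<and> u \<bullet> w = 0 \<and>
        S = range (\<lambda>t. c + (r * cos t) *\<^sub>R u + (r * sin t) *\<^sub>R w) \<and>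
        c + (r * cos t0) *\<^sub>R u + (r * sin t0) *\<^sub>R w = 0 \<and>
        (\<exists>k. k \<noteq> 0 \<and> v = k *\<^sub>R ((- sin t0) *\<^sub>R u + (cos t0) *\<^sub>R w)))"

definition simple_bundle :: "(real^'n) set set \<Rightarrow> bool" where
  "simple_bundle \<S> \<longleftrightarrow>
     (\<forall>S\<in>\<S>. is_circle S \<and> 0 \<in> S) \<and>
     (\<forall>S\<in>\<S>. \<forall>T\<in>\<S>. S \<noteq> T \<longrightarrow> \<not> (\<exists>v. v \<noteq> 0 \<and> tangent0 S v \<and> tangent0 T v))"

definition complete_bundle :: "(real^'n) set set \<Rightarrow> bool" where
  "complete_bundle \<S> \<longleftrightarrow> (\<forall>v::real^'n. v \<noteq> 0 \<longrightarrow> (\<exists>!S. S \<in> \<S> \<and> tangent0 S v))"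

fun Ck_on :: "nat \<Rightarrow> (real^'n) set \<Rightarrow> (real^'n \<Rightarrow> real^'n) \<Rightarrow> bool" where
  "Ck_on 0 U f \<longleftrightarrow> continuous_on U f"
| "Ck_on (Suc k) U f \<longleftrightarrow> (\<forall>x\<in>U. f differentiable (at x)) \<and>
      (\<forall>i\<in>Basis. Ck_on k U (\<lambda>x. frechet_derivative f (at x) i))"

definition smooth_on :: "(real^'n) set \<Rightarrow> (real^'n \<Rightarrow> real^'n) \<Rightarrow> bool" where
  "smooth_on U f \<longleftrightarrow> (\<forall>k. Ck_on k U f)"

definition diffeo_germ ::
  "(real^'n \<Rightarrow> real^'n) \<Rightarrow> (real^'n \<Rightarrow> real^'n) \<Rightarrow> (real^'n) set \<Rightarrow> (real^'n) set \<Rightarrow> bool" where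
  "diffeo_germ f g U V \<longleftrightarrow> open U \<and> open V \<and> 0 \<in> U \<and> f 0 = 0 \<and> f ` U = V \<and> g ` V = U \<and>
     smooth_on U f \<and> smooth_on V g \<and> (\<forall>x\<in>U. g (f x) = x) \<and> (\<forall>y\<in>V. f (g y) = y)"

definition rectifiable :: "(real^'n) set set \<Rightarrow> bool" where
  "rectifiable \<S> \<longleftrightarrow> (\<exists>f g U V. diffeo_germ f g U V \<and>
     (\<forall>S\<in>\<S>. \<exists>W L. open W \<and> 0 \<in> W \<and> is_line L \<and> f ` (S \<inter> W \<inter> U) \<subseteq> L))"

definition normalized_rectifier :: "(real^'n) set set \<Rightarrow> (real^'n \<Rightarrow> real^'n) \<Rightarrow> bool" where
  "normalized_rectifier \<S> \<Phi> \<longleftrightarrow> (\<exists>\<Psi> U V. diffeo_germ \<Phi> \<Psi> U V \<and> (\<Phi> has_derivative id) (at 0) \<and>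
     (\<forall>S\<in>\<S>. \<exists>W L. open W \<and> 0 \<in> W \<and> is_line L \<and> \<Psi> ` (S \<inter> W \<inter> V) \<subseteq> L))"

definition sym_coeffs :: "('n \<Rightarrow> 'n \<Rightarrow> 'n \<Rightarrow> real) \<Rightarrow> bool" where
  "sym_coeffs a \<longleftrightarrow> (\<forall>k i j. a k i j = a k j i)"

definition quadR :: "('n::finite \<Rightarrow> 'n \<Rightarrow> 'n \<Rightarrow> real) \<Rightarrow> real^'n \<Rightarrow> real^'n" where
  "quadR a x = (\<chi> k. \<Sum>i\<in>UNIV. \<Sum>j\<in>UNIV. a k i j * x$i * x$j)"

definition quadC :: "('n::finite \<Rightarrow> 'n \<Rightarrow> 'n \<Rightarrow> real) \<Rightarrow> complex^'n \<Rightarrow> complex^'n" where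
  "quadC a z = (\<chi> k. \<Sum>i\<in>UNIV. \<Sum>j\<in>UNIV. complex_of_real (a k i j) * z$i * z$j)"

text \<open>a gives the quadratic Taylor part of f at 0 (given that d_0 f = id)\<close>
definition quad_taylor :: "(real^'n::finite \<Rightarrow> real^'n) \<Rightarrow> ('n \<Rightarrow> 'n \<Rightarrow> 'n \<Rightarrow> real) \<Rightarrow> bool" where
  "quad_taylor f a \<longleftrightarrow> sym_coeffs a \<and>
     ((\<lambda>x. (f x - x - quadR a x) /\<^sub>R (norm x)^2) \<longlongrightarrow> 0) (at 0)"

definition Phi2 :: "(real^'n::finite \<Rightarrow> real^'n) \<Rightarrow> complex^'n \<Rightarrow> complex^'n" where
  "Phi2 f = quadC (THE a. quad_taylor f a)"

definition cdot :: "complex^'n::finite \<Rightarrow> complex^'n \<Rightarrow> complex" where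
  "cdot x y = (\<Sum>i\<in>UNIV. x$i * y$i)"

definition asym_cone :: "(complex^'n::finite) set" where
  "asym_cone = {x. cdot x x = 0}"

definition Vn :: "(complex^'n::finite \<Rightarrow> complex^'n) set" where
  "Vn = {\<Gamma>. (\<exists>a. sym_coeffs a \<and> \<Gamma> = quadC a) \<and>
           (\<forall>x\<in>asym_cone. cdot x (\<Gamma> x) = 0 \<and> cdot (\<Gamma> x) (\<Gamma> x) = 0)}"

definition Wn :: "(complex^'n::finite \<Rightarrow> complex^'n) set" where
  "Wn = {\<Gamma>. \<exists>l::real^'n. \<Gamma> = (\<lambda>x. \<chi> k. (\<Sum>i\<in>UNIV. complex_of_real (l$i) * x$i) * x$k)}"

definition Vrel :: "((complex^'n::finite \<Rightarrow> complex^'n) \<times> (complex^'n \<Rightarrow> complex^'n)) set" where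
  "Vrel = {(\<Gamma>, \<Delta>). \<Gamma> \<in> Vn \<and> \<Delta> \<in> Vn \<and> \<Gamma> - \<Delta> \<in> Wn}"

definition VmodW :: "(complex^'n::finite \<Rightarrow> complex^'n) set set" where
  "VmodW = Vn // Vrel"

definition complete_rectifiable_bundles :: "(real^'n) set set set" where
  "complete_rectifiable_bundles = {\<S>. simple_bundle \<S> \<and> complete_bundle \<S> \<and> rectifiable \<S>}"

definition bundle_class :: "(real^'n::finite) set set \<Rightarrow> (complex^'n \<Rightarrow> complex^'n) set" where
  "bundle_class \<S> = Vrel `` {Phi2 (SOME \<Phi>. normalized_rectifier \<S> \<Phi>)}"

end

theory Submission
  imports Defs "HOL-Computational_Algebra.Polynomial"
begin

text \<open>Inversion \<open>y \<mapsto> y / |y|\<^sup>2\<close> turns a circle through \<open>0\<close> tangent to \<open>v\<close> into a line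
  \<open>b + \<real> v\<close>, and \<open>|v|\<^sup>2 b\<close> is, modulo \<open>v\<close>, the second order coefficient of any curve on the circle with
  velocity \<open>v\<close>. Hence \<open>\<Phi>\<^sub>2\<close> determines the bundle, and the bundle determines \<open>\<Phi>\<^sub>2(v)\<close> modulo \<open>v\<close>,
  that is \<open>\<Phi>\<^sub>2\<close> modulo \<open>W\<^sub>n\<close>.

  Comparing the terms of order three and four in \<open>s\<close> of the condition that \<open>\<Phi>(s v)\<close> lies on the circle gives
  \<open>|v|\<^sup>2 (v \<and> \<Phi>\<^sub>3) = 2 (v, \<Phi>\<^sub>2) (v \<and> \<Phi>\<^sub>2)\<close> and
  \<open>|v|\<^sup>2 (v \<and> \<Phi>\<^sub>4) = (2 (v, \<Phi>\<^sub>3) + (\<Phi>\<^sub>2, \<Phi>\<^sub>2)) (v \<and> \<Phi>\<^sub>2)\<close>. These polynomial identities extend to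
  complex \<open>v\<close>, and on the cone they yield \<open>(v, \<Phi>\<^sub>2) = 0\<close>, then \<open>(v, \<Phi>\<^sub>3) = 0\<close>, then
  \<open>(\<Phi>\<^sub>2, \<Phi>\<^sub>2) = 0\<close>.

  Conversely, if \<open>\<Gamma>\<close> satisfies the cone conditions, then \<open>(x, \<Gamma>) = |x|\<^sup>2 l\<close> and
  \<open>(\<Gamma>, \<Gamma>) = |x|\<^sup>2 q\<close> with polynomials \<open>l\<close> and \<open>q\<close>, and the rectifier
  \<open>(x + \<Gamma>(x)) / (1 + 2 l(x) + q(x))\<close> maps \<open>\<real> v\<close> into the circle with \<open>|v|\<^sup>2 b = \<Gamma>(v)\<close>.\<close>

section \<open>Calculus of k times differentiable maps\<close>

text \<open>The unknown \<open>b\<close> has to disappear from the expansion: the term of order two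
  expresses it, modulo \<open>v\<close>, through \<Phi>2, and the factor \<open>|v|^2\<close> in the
  identities of orders three and four is the price of this substitution. What remains is polynomial
  in \<open>v\<close> alone, and completeness of the bundle provides it for every real
  \<open>v\<close>; a polynomial that vanishes at all real points vanishes at all complex ones.

  The converse turns vanishing on the cone into divisibility by \<open>(x,x)\<close>. This form
  factors over the complex numbers in dimension two, and in dimension one the cone is a single point
  that does not see multiplicities. Divisibility is therefore proved by division with remainder in
  one coordinate and evaluation at imaginary values of that coordinate; homogeneity settles the
  coordinate axis, where the two roots collapse.

  A rectifier and its inverse both have to be smooth, which is why the calculus of \<open>ck\<close>
  maps extends to inverse functions.\<close>

fun ck :: "nat \<Rightarrow> 'a::euclidean_space set \<Rightarrow> ('a \<Rightarrow> 'b::real_normed_vector) \<Rightarrow> bool" where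
  "ck 0 U f \<longleftrightarrow> continuous_on U f"
| "ck (Suc k) U f \<longleftrightarrow> (\<forall>x\<in>U. f differentiable (at x)) \<and>
      (\<forall>i\<in>Basis. ck k U (\<lambda>x. frechet_derivative f (at x) i))"

text \<open>Source and target are left free in \<open>ck\<close> because coefficients, denominators
  and determinants of the maps below are real valued; on \<open>real^'n\<close> it is the given
  notion.\<close>

lemma Ck_on_eq_ck: "Ck_on k U f = ck k U f"
  by (induction k arbitrary: f) (auto simp: ck.simps(2))

declare ck.simps(2)[simp del]

text \<open>On an open set the derivative is determined by the values there, so \<open>f\<close> and
  \<open>g\<close> share the iterated derivatives on which the recursion runs.\<close>

lemma ck_cong:
  assumes "open U" "\<And>x. x \<in> U \<Longrightarrow> f x = g x" "ck k U f"
  shows "ck k U g"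
  using assms(2,3)
proof (induction k arbitrary: f g)
  case 0
  from 0(2) have "continuous_on U f" by simp
  from continuous_on_eq[OF this 0(1)] show ?case by simp
next
  case (Suc k)
  have D: "(g has_derivative frechet_derivative f (at x)) (at x)" if "x \<in> U" for x
  proof (rule has_derivative_transform_within_open[OF _ \<open>open U\<close> that Suc.prems(1)])
    show "(f has_derivative frechet_derivative f (at x)) (at x)"
      using Suc.prems(2) that unfolding ck.simps frechet_derivative_works by blast
  qed
  then have E: "frechet_derivative g (at x) = frechet_derivative f (at x)" if "x \<in> U" for x
    using frechet_derivative_at that by metis
  show ?case
  proof (unfold ck.simps, intro conjI ballI)
    show "g differentiable at x" if "x \<in> U" for x
      using D[OF that] by (rule differentiableI)
    show "ck k U (\<lambda>x. frechet_derivative g (at x) i)" if "i \<in> Basis" for i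
    proof (rule Suc.IH)
      show "ck k U (\<lambda>x. frechet_derivative f (at x) i)"
        using Suc.prems(2) that unfolding ck.simps by blast
    qed (simp add: E)
  qed
qed

text \<open>Any explicit derivative may stand for \<open>frechet_derivative\<close>; most closure
  properties below are inductions through this rule.\<close>

lemma ck_SucI:
  assumes "open U" and D: "\<And>x. x \<in> U \<Longrightarrow> (f has_derivative f' x) (at x)"
    and "\<And>i. i \<in> Basis \<Longrightarrow> ck k U (\<lambda>x. f' x i)"
  shows "ck (Suc k) U f"
proof (unfold ck.simps, intro conjI ballI)
  show "f differentiable at x" if "x \<in> U" for x
    using D[OF that] by (rule differentiableI)
  have E: "frechet_derivative f (at x) = f' x" if "x \<in> U" for x
    using D[OF that] frechet_derivative_at by metis
  show "ck k U (\<lambda>x. frechet_derivative f (at x) i)" if "i \<in> Basis" for i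
    using E by (intro ck_cong[OF \<open>open U\<close> _ assms(3)[OF that]]) auto
qed

lemma ck_SucD:
  assumes "ck (Suc k) U f"
  shows "x \<in> U \<Longrightarrow> (f has_derivative frechet_derivative f (at x)) (at x)"
    and "i \<in> Basis \<Longrightarrow> ck k U (\<lambda>x. frechet_derivative f (at x) i)"
  using assms unfolding ck.simps frechet_derivative_works by blast+

lemma ck_Suc_continuous_on: "ck (Suc k) U f \<Longrightarrow> continuous_on U f"
  by (meson continuous_at_imp_continuous_on differentiable_imp_continuous_within ck.simps(2))

lemma ck_continuous_on: "ck k U f \<Longrightarrow> continuous_on U f"
  by (cases k) (auto intro: ck_Suc_continuous_on)

lemma ck_Suc_imp_ck: "ck (Suc k) U f \<Longrightarrow> ck k U f"
proof (induction k arbitrary: f)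
  case 0
  then show ?case using ck_Suc_continuous_on by auto
next
  case (Suc k)
  then show ?case by (metis ck.simps(2))
qed

lemma ck_subset: "ck k U f \<Longrightarrow> V \<subseteq> U \<Longrightarrow> ck k V f"
proof (induction k arbitrary: f)
  case 0
  then show ?case unfolding ck.simps by (rule continuous_on_subset)
next
  case (Suc k)
  then show ?case unfolding ck.simps by blast
qed

lemma ck_const: "ck k U (\<lambda>x. c)"
  by (induction k arbitrary: c) (simp_all add: ck.simps(2))

lemma ck_bounded_linear:
  assumes "open U" "bounded_linear f"
  shows "ck k U f"
proof (cases k)
  case 0
  then show ?thesis using assms by (simp add: linear_continuous_on)
next
  case (Suc k')
  then show ?thesis unfolding Suc
    by (intro ck_SucI[OF assms(1), where f'="\<lambda>_. f"] ck_const bounded_linear_imp_has_derivative assms)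
qed

lemma ck_linear_compose:
  assumes "open U" "bounded_linear h" "ck k U f"
  shows "ck k U (\<lambda>x. h (f x))"
  using assms(3)
proof (induction k arbitrary: f)
  case 0
  then show ?case unfolding ck.simps by (rule bounded_linear.continuous_on[OF assms(2)])
next
  case (Suc k)
  show ?case
    by (rule ck_SucI[OF \<open>open U\<close>, where f'="\<lambda>x i. h (frechet_derivative f (at x) i)"])
      (intro bounded_linear.has_derivative[OF assms(2)] Suc.IH ck_SucD[OF Suc.prems] | assumption)+
qed

lemma ck_add:
  assumes "open U" "ck k U f" "ck k U g"
  shows "ck k U (\<lambda>x. f x + g x)"
  using assms(2,3)
proof (induction k arbitrary: f g)
  case 0
  then show ?case unfolding ck.simps by (rule continuous_on_add)
next
  case (Suc k)
  show ?case
    by (rule ck_SucI[OF \<open>open U\<close>, where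
          f'="\<lambda>x i. frechet_derivative f (at x) i + frechet_derivative g (at x) i"])
      (intro has_derivative_add Suc.IH ck_SucD[OF Suc.prems(1)] ck_SucD[OF Suc.prems(2)] | assumption)+
qed

lemma ck_sum:
  assumes "open U" "\<And>i. i \<in> I \<Longrightarrow> ck k U (f i)"
  shows "ck k U (\<lambda>x. \<Sum>i\<in>I. f i x)"
  using assms(2) proof (induction I rule: infinite_finite_induct)
  case (insert i I)
  then have "ck k U (\<lambda>x. f i x + (\<Sum>i\<in>I. f i x))"
    by (intro ck_add assms(1)) auto
  then show ?case using insert.hyps by simp
qed (simp_all add: ck_const)

lemma ck_bilinear:
  assumes "open U" and B: "bounded_bilinear pr" and "ck k U f" "ck k U g"
  shows "ck k U (\<lambda>x. pr (f x) (g x))"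
  using assms(3,4)
proof (induction k arbitrary: f g)
  case 0
  then show ?case unfolding ck.simps by (rule bounded_bilinear.continuous_on[OF B])
next
  case (Suc k)
  have f: "ck k U f" and g: "ck k U g"
    using Suc.prems by (auto dest: ck_Suc_imp_ck)
  show ?case
  proof (rule ck_SucI[OF \<open>open U\<close>])
    show "((\<lambda>x. pr (f x) (g x)) has_derivative
      (\<lambda>i. pr (f x) (frechet_derivative g (at x) i) + pr (frechet_derivative f (at x) i) (g x))) (at x)"
      if "x \<in> U" for x
      using that Suc.prems by (intro bounded_bilinear.FDERIV[OF B] ck_SucD)
    show "ck k U (\<lambda>x. pr (f x) (frechet_derivative g (at x) i) + pr (frechet_derivative f (at x) i) (g x))"
      if "i \<in> Basis" for i
      using ck_SucD(2)[OF Suc.prems(1) that] ck_SucD(2)[OF Suc.prems(2) that] f g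
      by (intro ck_add[OF assms(1)] Suc.IH)
  qed
qed

lemmas ck_mult = ck_bilinear[OF _ bounded_bilinear_mult]
  and ck_scaleR = ck_bilinear[OF _ bounded_bilinear_scaleR]

lemma ck_prod:
  fixes f :: "'i \<Rightarrow> 'a::euclidean_space \<Rightarrow> real"
  assumes "open U" "\<And>i. i \<in> I \<Longrightarrow> ck k U (f i)"
  shows "ck k U (\<lambda>x. \<Prod>i\<in>I. f i x)"
  using assms(2) proof (induction I rule: infinite_finite_induct)
  case (insert i I)
  then have "ck k U (\<lambda>x. f i x * (\<Prod>i\<in>I. f i x))"
    by (intro ck_mult assms(1)) auto
  then show ?case using insert.hyps by simp
qed (simp_all add: ck_const)

text \<open>The derivative of \<open>1/f\<close> is built from \<open>1/f\<close> and a derivative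
  of \<open>f\<close>, so the regularity already reached for \<open>1/f\<close> is fed back in the
  induction.\<close>

lemma ck_inverse:
  fixes f :: "'a::euclidean_space \<Rightarrow> real"
  assumes "open U" "\<And>x. x \<in> U \<Longrightarrow> f x \<noteq> 0" "ck k U f"
  shows "ck k U (\<lambda>x. inverse (f x))"
  using assms(3)
proof (induction k)
  case 0
  then show ?case using assms(2) by (simp add: continuous_on_inverse)
next
  case (Suc k)
  have I: "ck k U (\<lambda>x. inverse (f x))"
    using Suc.IH ck_Suc_imp_ck[OF Suc.prems] by blast
  show ?case
  proof (rule ck_SucI[OF \<open>open U\<close>])
    show "((\<lambda>x. inverse (f x)) has_derivative
      (\<lambda>i. - (inverse (f x) * frechet_derivative f (at x) i * inverse (f x)))) (at x)" if "x \<in> U" for x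
      using that Suc.prems assms(2) by (intro Deriv.has_derivative_inverse ck_SucD)
    show "ck k U (\<lambda>x. - (inverse (f x) * frechet_derivative f (at x) i * inverse (f x)))"
      if "i \<in> Basis" for i
    proof -
      have "ck k U (\<lambda>x. (- 1) * (inverse (f x) * frechet_derivative f (at x) i * inverse (f x)))"
        by (rule ck_mult[OF \<open>open U\<close> ck_const ck_mult[OF \<open>open U\<close>
              ck_mult[OF \<open>open U\<close> I ck_SucD(2)[OF Suc.prems that]] I]])
      then show ?thesis unfolding mult_minus1 .
    qed
  qed
qed

lemma ck_compose:
  fixes f :: "'a::euclidean_space \<Rightarrow> 'b::euclidean_space" and g :: "'b \<Rightarrow> 'c::real_normed_vector"
  assumes "open U" "open V" "f ` U \<subseteq> V" "ck k U f" "ck k V g"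
  shows "ck k U (\<lambda>x. g (f x))"
  using assms(4,5)
proof (induction k arbitrary: g)
  case 0
  then show ?case unfolding ck.simps using continuous_on_compose2[of V g U f] assms(3) by blast
next
  case (Suc k)
  define f' g' where "f' x = frechet_derivative f (at x)" and "g' y = frechet_derivative g (at y)" for x y
  have f: "(f has_derivative f' x) (at x)" if "x \<in> U" for x
    using ck_SucD(1)[OF Suc.prems(1) that] by (simp add: f'_def)
  have g: "(g has_derivative g' y) (at y)" if "y \<in> V" for y
    using ck_SucD(1)[OF Suc.prems(2) that] by (simp add: g'_def)
  \<comment> \<open>\<open>ck\<close> controls derivatives in fixed basis directions, whereas
    \<open>f' x i\<close> moves with \<open>x\<close>; expanding it in a basis leaves fixed
    directions with scalar coefficients.\<close>
  have eq: "g' (f x) (f' x i) = (\<Sum>b\<in>Basis. (f' x i \<bullet> b) *\<^sub>R g' (f x) b)" if "x \<in> U" for x i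
  proof -
    have "linear (g' (f x))"
      using g that assms(3) by (intro has_derivative_linear[of g _ "at (f x)"]) auto
    then have "g' (f x) (\<Sum>b\<in>Basis. (f' x i \<bullet> b) *\<^sub>R b) = (\<Sum>b\<in>Basis. (f' x i \<bullet> b) *\<^sub>R g' (f x) b)"
      by (simp add: linear_sum linear_scale)
    then show ?thesis by (simp add: euclidean_representation)
  qed
  have "ck k U (\<lambda>x. g' (f x) (f' x i))" if i: "i \<in> Basis" for i
  proof (rule ck_cong[OF \<open>open U\<close> eq[symmetric]])
    show "ck k U (\<lambda>x. \<Sum>b\<in>Basis. (f' x i \<bullet> b) *\<^sub>R g' (f x) b)"
    proof (intro ck_sum ck_scaleR assms)
      fix b :: 'b assume b: "b \<in> Basis"
      show "ck k U (\<lambda>x. f' x i \<bullet> b)"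
        using ck_SucD(2)[OF Suc.prems(1) i]
        by (intro ck_linear_compose[OF \<open>open U\<close> bounded_linear_inner_left]) (simp add: f'_def)
      show "ck k U (\<lambda>x. g' (f x) b)"
        using Suc.IH[OF ck_Suc_imp_ck[OF Suc.prems(1)] ck_SucD(2)[OF Suc.prems(2) b]]
        by (simp add: g'_def)
    qed
  qed
  moreover have "((\<lambda>x. g (f x)) has_derivative (\<lambda>i. g' (f x) (f' x i))) (at x)" if "x \<in> U" for x
    using that assms(3) by (intro has_derivative_compose[OF f g]) auto
  ultimately show ?case by (intro ck_SucI[OF \<open>open U\<close>])
qed

lemma ck_componentwise:
  fixes f :: "'a::euclidean_space \<Rightarrow> real^'n"
  assumes "open U" "\<And>j. ck k U (\<lambda>x. f x $ j)"
  shows "ck k U f"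
proof -
  have "ck k U (\<lambda>x. \<Sum>j\<in>UNIV. (f x $ j) *\<^sub>R axis j (1::real))"
    by (intro ck_sum ck_scaleR ck_const assms)
  moreover have "(\<Sum>j\<in>UNIV. (f x $ j) *\<^sub>R axis j (1::real)) = f x" for x
    using basis_expansion[of "f x"] by (simp add: scalar_mult_eq_scaleR)
  ultimately show ?thesis by simp
qed

lemma ck_nth:
  fixes f :: "'a::euclidean_space \<Rightarrow> real^'n"
  assumes "open U" "ck k U f"
  shows "ck k U (\<lambda>x. f x $ j)"
  by (rule ck_linear_compose[OF assms(1) bounded_linear_vec_nth assms(2)])

lemma ck_det:
  fixes M :: "'a::euclidean_space \<Rightarrow> real^'n^'n"
  assumes "open U" "\<And>i j. ck k U (\<lambda>x. M x $ i $ j)"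
  shows "ck k U (\<lambda>x. det (M x))"
  unfolding det_def by (intro ck_sum ck_mult ck_prod ck_const assms)

text \<open>By Cramer's rule the inverse of the Jacobian is a rational function of its entries, so
  \<^term>\<open>g\<close> is one degree smoother than the Jacobian composed with \<^term>\<open>g\<close>.\<close>
lemma ck_inverse_function:
  fixes f g :: "real^'n \<Rightarrow> real^'n"
  assumes "open U" "open V" "g ` V \<subseteq> U" "\<And>k. ck k U f"
    and fD: "\<And>x. x \<in> U \<Longrightarrow> (f has_derivative f' x) (at x)"
    and gD: "\<And>y. y \<in> V \<Longrightarrow> (g has_derivative g' y) (at y)"
    and inv: "\<And>y h. y \<in> V \<Longrightarrow> f' (g y) (g' y h) = h" "\<And>y. y \<in> V \<Longrightarrow> inj (f' (g y))"
  shows "ck k V g"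
proof (induction k)
  case 0
  have "continuous_on V g"
    by (rule continuous_at_imp_continuous_on) (use gD has_derivative_continuous in blast)
  then show ?case by simp
next
  case (Suc k)
  define M where "M y = matrix (f' (g y))" for y
  have lin: "linear (f' (g y))" if "y \<in> V" for y
    using fD that assms(3) has_derivative_linear by blast
  have M: "ck k V (\<lambda>y. M y $ i $ j)" for i j
  proof -
    have "ck k V (\<lambda>y. frechet_derivative f (at (g y)) (axis j 1))"
      by (rule ck_compose[OF \<open>open V\<close> \<open>open U\<close> assms(3) Suc ck_SucD(2)[OF assms(4)]])
        (auto simp: axis_in_Basis_iff)
    then have "ck k V (\<lambda>y. frechet_derivative f (at (g y)) (axis j 1) $ i)"
      by (rule ck_nth[OF \<open>open V\<close>])
    moreover have "frechet_derivative f (at (g y)) = f' (g y)" if "y \<in> V" for y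
      using fD that assms(3) frechet_derivative_at by (metis image_subset_iff)
    ultimately show ?thesis
      by (elim ck_cong[OF \<open>open V\<close>, rotated]) (simp add: M_def matrix_def)
  qed
  have Mv: "M y *v h = f' (g y) h" if "y \<in> V" for y h
    using lin[OF that] by (simp add: M_def matrix_works)
  have d: "det (M y) \<noteq> 0" if "y \<in> V" for y
    using lin[OF that] inv(2)[OF that]
    by (metis M_def det_nz_iff_inj)
  have cr: "g' y h = (\<chi> k. det (\<chi> i j. if j = k then h $ i else M y $ i $ j) * inverse (det (M y)))"
    if "y \<in> V" for y h
    using cramer[OF d[OF that], of "g' y h" h] inv(1)[OF that] Mv[OF that]
    by (simp add: divide_inverse)
  have "ck k V (\<lambda>y. g' y h)" for h
  proof (rule ck_cong[OF \<open>open V\<close> cr[symmetric]])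
    show "ck k V (\<lambda>y. \<chi> k. det (\<chi> i j. if j = k then h $ i else M y $ i $ j) * inverse (det (M y)))"
    proof (rule ck_componentwise[OF \<open>open V\<close>], simp, intro ck_mult ck_inverse ck_det M d \<open>open V\<close>)
      fix l i j
      show "ck k V (\<lambda>y. (\<chi> i j. if j = l then h $ i else M y $ i $ j) $ i $ j)"
        by (cases "j = l") (auto intro: ck_const M)
    qed
  qed
  then show ?case using gD by (intro ck_SucI[OF \<open>open V\<close>]) auto
qed

section \<open>Circles through the origin\<close>

text \<open>For \<open>v \<noteq> 0\<close>, the circle or line whose inversion \<open>y \<mapsto> y / |y|\<^sup>2\<close> is the line through
  \<open>b\<close> in direction \<open>v\<close>. It is tangent to \<open>v\<close> at \<open>0\<close>, and only \<open>b\<close> modulo \<open>v\<close> matters.\<close>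
definition circ :: "real^'n \<Rightarrow> real^'n \<Rightarrow> (real^'n) set" where
  "circ v b = {y. y - (y \<bullet> y) *\<^sub>R b \<in> span {v}}"

lemma circ_cong:
  assumes "b - b' \<in> span {v}"
  shows "circ v b = circ v b'"
proof -
  have "(y - (y \<bullet> y) *\<^sub>R b \<in> span {v}) = (y - (y \<bullet> y) *\<^sub>R b' \<in> span {v})" for y
  proof -
    have "(y - (y \<bullet> y) *\<^sub>R b') - (y - (y \<bullet> y) *\<^sub>R b) = (y \<bullet> y) *\<^sub>R (b - b')"
      by (simp add: algebra_simps)
    then have "(y - (y \<bullet> y) *\<^sub>R b') - (y - (y \<bullet> y) *\<^sub>R b) \<in> span {v}"
      using assms by (simp add: span_scale)
    then show ?thesis using span_add_eq span_diff by (metis diff_add_cancel)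
  qed
  then show ?thesis by (simp add: circ_def)
qed

lemma span_singleton_scale:
  fixes v :: "'a::real_vector"
  assumes "k \<noteq> 0" shows "span {k *\<^sub>R v} = span {v}"
  using span_image_scale[of "{v}" "\<lambda>_. k"] assms by simp

lemma span_singleton_eq:
  fixes v :: "'a::real_vector"
  assumes "w \<in> span {v}" "w \<noteq> 0" shows "span {w} = span {v}"
proof -
  obtain k where "w = k *\<^sub>R v" using assms(1) by (auto simp: span_singleton)
  then show ?thesis using assms(2) span_singleton_scale by auto
qed

lemma span_scaleD:
  fixes x :: "'a::real_vector"
  assumes "k *\<^sub>R x \<in> span S" "k \<noteq> 0" shows "x \<in> span S"
  using span_scale[OF assms(1), of "inverse k"] assms(2) by simp

lemma circ_scale: "k \<noteq> 0 \<Longrightarrow> circ (k *\<^sub>R v) b = circ v b"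
  by (simp add: circ_def span_singleton_scale)

lemma zero_in_circ: "0 \<in> circ v b"
  by (simp add: circ_def span_zero)

lemma circ_line: "circ v 0 = range (\<lambda>t. t *\<^sub>R v)"
  by (auto simp: circ_def span_singleton)

text \<open>The point opposite to \<open>0\<close> on this circle is \<open>-2 r p\<close>, and its
  inversion \<open>-p / (2 r)\<close> is the point of the inverted line nearest to
  \<open>0\<close>.\<close>

lemma circ_round:
  fixes p q :: "real^'n"
  assumes pq: "norm p = 1" "norm q = 1" "p \<bullet> q = 0" and "r > 0" "k \<noteq> 0"
  shows "circ (k *\<^sub>R q) ((- 1 / (2 * r)) *\<^sub>R p) =
    range (\<lambda>t. (- r) *\<^sub>R p + (r * cos t) *\<^sub>R p + (r * sin t) *\<^sub>R q)"
proof -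
  have 1: "p \<bullet> p = 1" "q \<bullet> q = 1" "q \<bullet> p = 0"
    using pq by (simp_all add: norm_eq_sqrt_inner inner_commute)
  have sq: "span {k *\<^sub>R q} = range (\<lambda>s. s *\<^sub>R q)"
    unfolding span_singleton_scale[OF \<open>k \<noteq> 0\<close>] by (auto simp: span_singleton)
  have n: "(x *\<^sub>R p + y *\<^sub>R q) \<bullet> (x *\<^sub>R p + y *\<^sub>R q) = x\<^sup>2 + y\<^sup>2" for x y
    using 1 pq(3) by (simp add: inner_add_left inner_add_right power2_eq_square)
  show ?thesis
  proof (intro equalityI subsetI)
    fix y assume "y \<in> circ (k *\<^sub>R q) ((- 1 / (2 * r)) *\<^sub>R p)"
    then obtain s where s: "y - (y \<bullet> y) *\<^sub>R ((- 1 / (2 * r)) *\<^sub>R p) = s *\<^sub>R q"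
      unfolding circ_def sq by auto
    define N where "N = y \<bullet> y"
    have y: "y = (- N / (2 * r)) *\<^sub>R p + s *\<^sub>R q"
      using s by (simp add: N_def algebra_simps)
    have N: "N = (N / (2 * r))\<^sup>2 + s\<^sup>2"
      using n[of "- N / (2 * r)" s] unfolding y[symmetric] N_def[symmetric] by simp
    \<comment> \<open>The two squared numbers are the coordinates of \<open>(y + r p) / r\<close>,
      the position of \<open>y\<close> relative to the centre in units of the radius.\<close>
    have "(1 - N / (2 * r\<^sup>2))\<^sup>2 + (s / r)\<^sup>2 = 1 + ((N / (2 * r))\<^sup>2 + s\<^sup>2 - N) / r\<^sup>2"
      using \<open>r > 0\<close> by (simp add: field_simps power2_eq_square)
    also have "\<dots> = 1" using N by simp
    finally obtain t where t: "1 - N / (2 * r\<^sup>2) = cos t" "s / r = sin t"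
      using sincos_total_2pi by metis
    have "r * cos t - r = - N / (2 * r)" "r * sin t = s"
      using \<open>r > 0\<close> t by (simp_all flip: t add: field_simps power2_eq_square)
    moreover have "(- r) *\<^sub>R p + (r * cos t) *\<^sub>R p + (r * sin t) *\<^sub>R q = (r * cos t - r) *\<^sub>R p + (r * sin t) *\<^sub>R q"
      by (simp add: algebra_simps)
    ultimately have "y = (- r) *\<^sub>R p + (r * cos t) *\<^sub>R p + (r * sin t) *\<^sub>R q"
      using y by simp
    then show "y \<in> range (\<lambda>t. (- r) *\<^sub>R p + (r * cos t) *\<^sub>R p + (r * sin t) *\<^sub>R q)" by blast
  next
    fix y assume "y \<in> range (\<lambda>t. (- r) *\<^sub>R p + (r * cos t) *\<^sub>R p + (r * sin t) *\<^sub>R q)"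
    then obtain t where "y = (- r) *\<^sub>R p + (r * cos t) *\<^sub>R p + (r * sin t) *\<^sub>R q" by blast
    then have y: "y = (r * cos t - r) *\<^sub>R p + (r * sin t) *\<^sub>R q"
      by (simp add: algebra_simps)
    have "y \<bullet> y = (r * cos t - r)\<^sup>2 + (r * sin t)\<^sup>2" unfolding y by (rule n)
    also have "\<dots> = r\<^sup>2 * ((sin t)\<^sup>2 + (cos t)\<^sup>2) + r\<^sup>2 - 2 * r\<^sup>2 * cos t"
      by algebra
    also have "\<dots> = 2 * r * (r - r * cos t)"
      by (simp add: power2_eq_square algebra_simps)
    finally have yy: "(y \<bullet> y) * (- 1 / (2 * r)) = r * cos t - r"
      using \<open>r > 0\<close> by (simp add: field_simps)
    have "y - (y \<bullet> y) *\<^sub>R ((- 1 / (2 * r)) *\<^sub>R p) = (r * sin t) *\<^sub>R q"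
      unfolding scaleR_scaleR yy using y by simp
    then show "y \<in> circ (k *\<^sub>R q) ((- 1 / (2 * r)) *\<^sub>R p)"
      unfolding circ_def sq by (metis (mono_tags, lifting) mem_Collect_eq rangeI)
  qed
qed

lemma tangent0_imp_circ:
  assumes "tangent0 S v"
  obtains b where "S = circ v b"
  using assms unfolding tangent0_def
proof (elim disjE exE conjE)
  fix a w t0 k
  assume S: "S = range (\<lambda>t. a + t *\<^sub>R w)" and a: "a + t0 *\<^sub>R w = 0" and "k \<noteq> (0::real)" "v = k *\<^sub>R w"
  have a: "a = - t0 *\<^sub>R w" using a by (simp add: add_eq_0_iff)
  have "S = range (\<lambda>t. (t - t0) *\<^sub>R w)" unfolding S a by (simp add: algebra_simps)
  also have "\<dots> = (\<lambda>t. t *\<^sub>R w) ` range (\<lambda>t. t - t0)" by (simp only: image_image)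
  also have "range (\<lambda>t. t - t0) = UNIV" by (rule surj_diff_right)
  finally have "S = circ w 0" by (simp add: circ_line)
  then show thesis using that circ_scale[OF \<open>k \<noteq> 0\<close>] \<open>v = k *\<^sub>R w\<close> by metis
next
  fix c r u w t0 k
  assume r: "r > 0" and uw: "norm u = 1" "norm w = 1" "u \<bullet> w = 0"
    and S: "S = range (\<lambda>t. c + (r * cos t) *\<^sub>R u + (r * sin t) *\<^sub>R w)"
    and c: "c + (r * cos t0) *\<^sub>R u + (r * sin t0) *\<^sub>R w = 0"
    and "k \<noteq> (0::real)" and v: "v = k *\<^sub>R ((- sin t0) *\<^sub>R u + (cos t0) *\<^sub>R w)"
  \<comment> \<open>\<open>p\<close> is the unit vector from the centre to \<open>0\<close> and
    \<open>q\<close> the unit tangent there; with the parameter shifted by \<open>t0\<close> the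
    circle takes the form of \<open>circ_round\<close>.\<close>
  define p q where "p = cos t0 *\<^sub>R u + sin t0 *\<^sub>R w" and "q = (- sin t0) *\<^sub>R u + cos t0 *\<^sub>R w"
  have 1: "u \<bullet> u = 1" "w \<bullet> w = 1" "w \<bullet> u = 0"
    using uw by (simp_all add: norm_eq_sqrt_inner inner_commute)
  have cs: "cos t0 * cos t0 + sin t0 * sin t0 = 1"
    using sin_cos_squared_add2[of t0] by (simp add: power2_eq_square)
  have pq: "norm p = 1" "norm q = 1" "p \<bullet> q = 0"
    using 1 uw(3) cs unfolding norm_eq_sqrt_inner p_def q_def
    by (simp_all add: inner_add_left inner_add_right algebra_simps)
  have cp: "c = (- r) *\<^sub>R p"
  proof -
    have "c + r *\<^sub>R p = 0" using c by (simp add: p_def scaleR_add_right add.assoc)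
    then show ?thesis by (simp add: eq_neg_iff_add_eq_0)
  qed
  have "(- r) *\<^sub>R p + (r * cos (t - t0)) *\<^sub>R p + (r * sin (t - t0)) *\<^sub>R q =
      c + (r * cos t) *\<^sub>R u + (r * sin t) *\<^sub>R w" for t
  proof -
    have "cos (t - t0) * cos t0 - sin (t - t0) * sin t0 = cos t"
      "cos (t - t0) * sin t0 + sin (t - t0) * cos t0 = sin t"
      using cos_add[of "t - t0" t0] sin_add[of "t - t0" t0] by simp_all
    moreover have "(r * cos (t - t0)) *\<^sub>R p + (r * sin (t - t0)) *\<^sub>R q =
      (r * (cos (t - t0) * cos t0 - sin (t - t0) * sin t0)) *\<^sub>R u +
      (r * (cos (t - t0) * sin t0 + sin (t - t0) * cos t0)) *\<^sub>R w"
      by (simp add: p_def q_def algebra_simps)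
    ultimately show ?thesis using cp by (simp add: add.assoc)
  qed
  then have "S = range (\<lambda>t. (- r) *\<^sub>R p + (r * cos (t - t0)) *\<^sub>R p + (r * sin (t - t0)) *\<^sub>R q)"
    unfolding S by simp
  also have "\<dots> = (\<lambda>t. (- r) *\<^sub>R p + (r * cos t) *\<^sub>R p + (r * sin t) *\<^sub>R q) ` range (\<lambda>t. t - t0)"
    by (simp only: image_image)
  also have "range (\<lambda>t. t - t0) = UNIV" by (rule surj_diff_right)
  also have "(\<lambda>t. (- r) *\<^sub>R p + (r * cos t) *\<^sub>R p + (r * sin t) *\<^sub>R q) ` UNIV = circ v ((- 1 / (2 * r)) *\<^sub>R p)"
    using circ_round[OF pq r \<open>k \<noteq> 0\<close>] v q_def by simp
  finally show thesis by (rule that)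
qed

lemma orthogonal_representative:
  fixes v b :: "real^'n"
  obtains b' where "b' \<bullet> v = 0" "b - b' \<in> span {v}"
proof (cases "v = 0")
  case True
  then show ?thesis using that[of b] by (simp add: span_zero)
next
  case False
  then show ?thesis
    by (intro that[of "b - ((b \<bullet> v) / (v \<bullet> v)) *\<^sub>R v"])
      (auto simp: inner_diff_left span_singleton)
qed

lemma circ_is_circle:
  fixes v b :: "real^'n"
  assumes "v \<noteq> 0"
  shows "tangent0 (circ v b) v" "is_circle (circ v b)"
proof -
  obtain b' where b': "b' \<bullet> v = 0" "b - b' \<in> span {v}" by (rule orthogonal_representative)
  note eq = circ_cong[OF b'(2)]
  have "tangent0 (circ v b') v \<and> is_circle (circ v b')"
  proof (cases "b' = 0")
    case True
    have L: "circ v b' = range (\<lambda>t. 0 + t *\<^sub>R v)"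
      using circ_line[of v] True by simp
    have "tangent0 (circ v b') v"
      unfolding tangent0_def using assms L
      by (intro disjI1 exI[of _ 0] exI[of _ v] conjI exI[of _ 1]) auto
    then show ?thesis using L assms unfolding is_circle_def is_line_def by blast
  next
    case False
    \<comment> \<open>\<open>b'\<close> is the inversion of the point opposite to \<open>0\<close>,
      so the diameter is \<open>1 / norm b'\<close>; \<open>p\<close> points from the centre to
      \<open>0\<close>.\<close>
    define r p q where "r = 1 / (2 * norm b')" and "p = (- 1 / norm b') *\<^sub>R b'" and "q = (1 / norm v) *\<^sub>R v"
    have r: "r > 0" using False by (simp add: r_def)
    have pq: "norm p = 1" "norm q = 1" "p \<bullet> q = 0"
      using False assms b'(1) by (simp_all add: p_def q_def)
    have v: "v = norm v *\<^sub>R q" and b: "b' = (- 1 / (2 * r)) *\<^sub>R p"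
      using assms False by (simp_all add: q_def p_def r_def)
    have S: "circ v b' = range (\<lambda>t. (- r) *\<^sub>R p + (r * cos t) *\<^sub>R p + (r * sin t) *\<^sub>R q)"
      using circ_round[OF pq r, of "norm v"] v b assms by simp
    have "tangent0 (circ v b') v"
      unfolding tangent0_def
    proof (rule disjI2, intro exI conjI)
      show "(- r) *\<^sub>R p + (r * cos 0) *\<^sub>R p + (r * sin 0) *\<^sub>R q = 0" by simp
      show "v = norm v *\<^sub>R ((- sin 0) *\<^sub>R p + cos 0 *\<^sub>R q)" using v by simp
    qed (use r pq S assms in auto)
    then show ?thesis using S r pq unfolding is_circle_def is_round_circle_def by blast
  qed
  then show "tangent0 (circ v b) v" "is_circle (circ v b)" by (simp_all add: eq)
qed

lemma is_circle_imp_tangent0: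
  fixes S :: "(real^'n) set"
  assumes "is_circle S" "0 \<in> S"
  obtains v where "v \<noteq> 0" "tangent0 S v"
  using assms(1) unfolding is_circle_def is_line_def is_round_circle_def
proof (elim disjE exE conjE)
  fix a w :: "real^'n" assume *: "w \<noteq> 0" "S = range (\<lambda>t. a + t *\<^sub>R w)"
  then obtain t0 where "a + t0 *\<^sub>R w = 0" using assms(2) by auto
  then have "tangent0 S w"
    unfolding tangent0_def using *
    by (intro disjI1 exI[of _ a] exI[of _ w] exI[of _ t0] conjI exI[of _ 1]) auto
  then show thesis using that * by blast
next
  fix c r and u w :: "real^'n"
  assume *: "r > 0" "norm u = 1" "norm w = 1" "u \<bullet> w = 0"
    "S = range (\<lambda>t. c + (r * cos t) *\<^sub>R u + (r * sin t) *\<^sub>R w)"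
  then obtain t0 where t0: "c + (r * cos t0) *\<^sub>R u + (r * sin t0) *\<^sub>R w = 0" using assms(2) by auto
  define v where "v = (- sin t0) *\<^sub>R u + (cos t0) *\<^sub>R w"
  have "u \<bullet> u = 1" "w \<bullet> w = 1" "w \<bullet> u = 0"
    using * by (simp_all add: norm_eq_sqrt_inner inner_commute)
  then have "v \<bullet> v = 1"
    using *(4) sin_cos_squared_add[of t0]
    by (simp add: v_def inner_diff_left inner_diff_right power2_eq_square)
  then have "v \<noteq> 0" by auto
  moreover have "tangent0 S v"
    unfolding tangent0_def
  proof (rule disjI2, intro exI conjI)
    show "v = 1 *\<^sub>R ((- sin t0) *\<^sub>R u + (cos t0) *\<^sub>R w)" by (simp add: v_def)
  qed (use * t0 in auto)
  ultimately show thesis by (rule that)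
qed

text \<open>Inserting the curve into the equation of \<open>circ v b\<close> and dividing by
  \<open>t\<close>, then by \<open>t^2\<close>, keeps the expressions in the closed set
  \<open>span {v}\<close>, and so are their limits. The filter \<open>F\<close> is general because a
  rectifier will only provide parameters that accumulate at \<open>0\<close>.\<close>

lemma circ_osculate:
  fixes x v a b :: "real^'n"
  assumes F: "F \<le> at (0::real)" "F \<noteq> bot"
    and mem: "\<forall>\<^sub>F t in F. t *\<^sub>R x + t\<^sup>2 *\<^sub>R R t \<in> circ v b" and R: "(R \<longlongrightarrow> a) F"
  shows "x \<in> span {v}" "a - (x \<bullet> x) *\<^sub>R b \<in> span {v}"
proof -
  define M where "M t = (x + t *\<^sub>R R t) \<bullet> (x + t *\<^sub>R R t)" for t
  have t0: "((\<lambda>t. t) \<longlongrightarrow> 0) F" using F(1) tendsto_ident_at[of 0 UNIV] tendsto_mono by blast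
  have nz: "\<forall>\<^sub>F t in F. t \<noteq> 0"
    using F(1) by (rule filter_leD) (simp add: eventually_at_filter)
  have M: "(M \<longlongrightarrow> (x + 0 *\<^sub>R a) \<bullet> (x + 0 *\<^sub>R a)) F"
    unfolding M_def by (intro tendsto_intros t0 R)
  have cl: "closed (span {v})" by (simp add: closed_subspace)
  have mem': "\<forall>\<^sub>F t in F. t \<noteq> 0 \<and> t *\<^sub>R (x + t *\<^sub>R R t - (t * M t) *\<^sub>R b) \<in> span {v}"
    using mem nz
  proof eventually_elim
    case (elim t)
    have "t *\<^sub>R x + t\<^sup>2 *\<^sub>R R t = t *\<^sub>R (x + t *\<^sub>R R t)" by (simp add: algebra_simps power2_eq_square)
    moreover have "(t *\<^sub>R (x + t *\<^sub>R R t)) \<bullet> (t *\<^sub>R (x + t *\<^sub>R R t)) = t * (t * M t)"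
      by (simp add: M_def del: inner_add_left inner_add_right)
    ultimately show ?case using elim unfolding circ_def by (simp add: scaleR_diff_right)
  qed
  then have "\<forall>\<^sub>F t in F. x + t *\<^sub>R R t - (t * M t) *\<^sub>R b \<in> span {v}"
    by eventually_elim (blast intro: span_scaleD)
  moreover have "((\<lambda>t. x + t *\<^sub>R R t - (t * M t) *\<^sub>R b) \<longlongrightarrow> x + 0 *\<^sub>R a - (0 * ((x + 0 *\<^sub>R a) \<bullet> (x + 0 *\<^sub>R a))) *\<^sub>R b) F"
    by (intro tendsto_intros t0 R M)
  ultimately have "x + 0 *\<^sub>R a - (0 * ((x + 0 *\<^sub>R a) \<bullet> (x + 0 *\<^sub>R a))) *\<^sub>R b \<in> span {v}"
    by (rule Lim_in_closed_set[OF cl _ F(2)])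
  then show x: "x \<in> span {v}" by simp
  have "\<forall>\<^sub>F t in F. R t - M t *\<^sub>R b \<in> span {v}"
    using mem'
  proof eventually_elim
    case (elim t)
    have "(t * t) *\<^sub>R (R t - M t *\<^sub>R b) = t *\<^sub>R (x + t *\<^sub>R R t - (t * M t) *\<^sub>R b) - t *\<^sub>R x"
      by (simp add: algebra_simps)
    then have "(t * t) *\<^sub>R (R t - M t *\<^sub>R b) \<in> span {v}"
      using elim x by (simp only: span_diff span_scale)
    then show ?case by (rule span_scaleD) (use elim in simp)
  qed
  moreover have "((\<lambda>t. R t - M t *\<^sub>R b) \<longlongrightarrow> a - ((x + 0 *\<^sub>R a) \<bullet> (x + 0 *\<^sub>R a)) *\<^sub>R b) F"
    by (intro tendsto_intros R M)
  ultimately have "a - ((x + 0 *\<^sub>R a) \<bullet> (x + 0 *\<^sub>R a)) *\<^sub>R b \<in> span {v}"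
    by (rule Lim_in_closed_set[OF cl _ F(2)])
  then show "a - (x \<bullet> x) *\<^sub>R b \<in> span {v}" by simp
qed

lemma circ_parametrization:
  fixes v b :: "real^'n"
  obtains R a where "\<And>t::real. t *\<^sub>R v + t\<^sup>2 *\<^sub>R R t \<in> circ v b" "(R \<longlongrightarrow> a) (at 0)"
proof -
  obtain b' where b': "b' \<bullet> v = 0" "b - b' \<in> span {v}" by (rule orthogonal_representative)
  \<comment> \<open>For nonzero \<open>v\<close> and \<open>t\<close> the curve is the inversion of
    the point \<open>b' + v / (t n)\<close> of the line, with \<open>n = v \<bullet> v\<close>. This
    equals \<open>t (v + t n b') / D t\<close>, and splitting off \<open>t v\<close> leaves
    \<open>t^2 R t\<close>.\<close>
  define D where "D t = 1 + t\<^sup>2 * (v \<bullet> v) * (b' \<bullet> b')" for t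
  have D: "D t > 0" for t
    unfolding D_def by (intro add_pos_nonneg mult_nonneg_nonneg) auto
  define R where "R t = inverse (D t) *\<^sub>R ((v \<bullet> v) *\<^sub>R b' - (t * (v \<bullet> v) * (b' \<bullet> b')) *\<^sub>R v)" for t
  have "t *\<^sub>R v + t\<^sup>2 *\<^sub>R R t \<in> circ v b" for t
  proof -
    define y where "y = (t * inverse (D t)) *\<^sub>R (v + (t * (v \<bullet> v)) *\<^sub>R b')"
    have "D t *\<^sub>R (t *\<^sub>R v + t\<^sup>2 *\<^sub>R R t) = (t * D t) *\<^sub>R v + t\<^sup>2 *\<^sub>R (D t *\<^sub>R R t)"
      by (simp add: algebra_simps)
    also have "D t *\<^sub>R R t = (v \<bullet> v) *\<^sub>R b' - (t * (v \<bullet> v) * (b' \<bullet> b')) *\<^sub>R v"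
      using D[of t] by (simp add: R_def)
    also have "(t * D t) *\<^sub>R v + t\<^sup>2 *\<^sub>R \<dots> = t *\<^sub>R (v + (t * (v \<bullet> v)) *\<^sub>R b')"
      by (simp add: D_def algebra_simps power2_eq_square)
    also have "\<dots> = D t *\<^sub>R y"
      using D[of t] by (simp add: y_def)
    finally have eq: "t *\<^sub>R v + t\<^sup>2 *\<^sub>R R t = y"
      using D[of t] by (metis less_irrefl scaleR_cancel_left)
    have "(v + (t * (v \<bullet> v)) *\<^sub>R b') \<bullet> (v + (t * (v \<bullet> v)) *\<^sub>R b') = (v \<bullet> v) * D t"
      using b'(1) by (simp add: inner_add_left inner_add_right inner_commute[of v b'] D_def
          algebra_simps power2_eq_square)
    then have "y \<bullet> y = (t * inverse (D t))\<^sup>2 * ((v \<bullet> v) * D t)"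
      by (simp add: y_def power2_eq_square del: inner_add_left inner_add_right)
    also have "\<dots> = t * inverse (D t) * (t * (v \<bullet> v))"
      using D[of t] by (simp add: field_simps power2_eq_square)
    finally have "y - (y \<bullet> y) *\<^sub>R b' = (t * inverse (D t)) *\<^sub>R v"
      by (simp add: y_def algebra_simps)
    then show ?thesis
      unfolding eq circ_cong[OF b'(2)] by (auto simp: span_singleton circ_def)
  qed
  moreover have "(R \<longlongrightarrow> inverse (D 0) *\<^sub>R ((v \<bullet> v) *\<^sub>R b' - (0 * (v \<bullet> v) * (b' \<bullet> b')) *\<^sub>R v)) (at 0)"
    unfolding R_def D_def by (intro tendsto_intros) auto
  ultimately show ?thesis by (rule that)
qed

text \<open>A curve with velocity \<open>v\<close> on the first circle is also a curve on the
  second, where velocities at \<open>0\<close> lie in \<open>span {w}\<close>.\<close>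

lemma circ_eqD:
  fixes v w b b' :: "real^'n"
  assumes eq: "circ v b = circ w b'"
  shows "v \<in> span {w}"
proof -
  obtain R a where "\<And>t::real. t *\<^sub>R v + t\<^sup>2 *\<^sub>R R t \<in> circ v b" "(R \<longlongrightarrow> a) (at 0)"
    using circ_parametrization[of v b] by blast
  then show ?thesis using circ_osculate(1)[OF order_refl, of v R w b' a] eq by simp
qed

section \<open>Real polynomials and their complexification\<close>

text \<open>\<^term>\<open>polypair f F\<close> says that \<^term>\<open>f\<close> is a polynomial with real coefficients and
  \<^term>\<open>F\<close> its extension to complex arguments.\<close>

inductive polypair :: "(real^'n \<Rightarrow> real) \<Rightarrow> (complex^'n \<Rightarrow> complex) \<Rightarrow> bool" where
  const: "polypair (\<lambda>_. c) (\<lambda>_. complex_of_real c)"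
| coord: "polypair (\<lambda>x. x $ i) (\<lambda>z. z $ i)"
| add: "polypair f F \<Longrightarrow> polypair g G \<Longrightarrow> polypair (\<lambda>x. f x + g x) (\<lambda>z. F z + G z)"
| mult: "polypair f F \<Longrightarrow> polypair g G \<Longrightarrow> polypair (\<lambda>x. f x * g x) (\<lambda>z. F z * G z)"

lemma polypair_diff:
  assumes "polypair f F" "polypair g G"
  shows "polypair (\<lambda>x. f x - g x) (\<lambda>z. F z - G z)"
  using polypair.add[OF assms(1) polypair.mult[OF polypair.const[of "-1"] assms(2)]] by simp

lemma polypair_sum:
  assumes "\<And>i. i \<in> I \<Longrightarrow> polypair (f i) (F i)"
  shows "polypair (\<lambda>x. \<Sum>i\<in>I. f i x) (\<lambda>z. \<Sum>i\<in>I. F i z)"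
  using assms
proof (induction I rule: infinite_finite_induct)
  case (insert i I)
  then have "polypair (\<lambda>x. f i x + (\<Sum>i\<in>I. f i x)) (\<lambda>z. F i z + (\<Sum>i\<in>I. F i z))"
    by (intro polypair.add) auto
  then show ?case using insert.hyps by simp
qed (use polypair.const[of 0] in simp_all)

lemma polypair_inner:
  assumes "\<And>k. polypair (\<lambda>x. f x $ k) (\<lambda>z. F z $ k)" "\<And>k. polypair (\<lambda>x. g x $ k) (\<lambda>z. G z $ k)"
  shows "polypair (\<lambda>x. f x \<bullet> g x) (\<lambda>z. cdot (F z) (G z))"
  unfolding inner_vec_def cdot_def inner_real_def
  by (intro polypair_sum polypair.mult assms)

lemma polypair_quad: "polypair (\<lambda>x. quadR a x $ k) (\<lambda>z. quadC a z $ k)"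
  unfolding quadR_def quadC_def vec_lambda_beta
  by (intro polypair_sum polypair.mult polypair.coord polypair.const)

lemma polypair_ck: "polypair f F \<Longrightarrow> ck k UNIV f"
proof (induction rule: polypair.induct)
  case (coord i)
  show ?case by (rule ck_bounded_linear[OF open_UNIV bounded_linear_vec_nth])
qed (auto intro: ck_const ck_add ck_mult)

definition cvec :: "real^'n \<Rightarrow> complex^'n" where
  "cvec x = (\<chi> i. complex_of_real (x $ i))"

lemma cvec_nth [simp]: "cvec x $ i = complex_of_real (x $ i)"
  by (simp add: cvec_def)

lemma polypair_real: "polypair f F \<Longrightarrow> F (cvec x) = complex_of_real (f x)"
  by (induction rule: polypair.induct) auto

lemma polypair_line: "polypair f F \<Longrightarrow> \<exists>p. \<forall>t. F (u + t *s w) = poly p t"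
proof (induction rule: polypair.induct)
  case (const c)
  show ?case by (rule exI[of _ "[:of_real c:]"]) simp
next
  case (coord i)
  show ?case by (rule exI[of _ "[:u $ i, w $ i:]"]) simp
next
  case (add f F g G)
  then obtain p q where "\<forall>t. F (u + t *s w) = poly p t" "\<forall>t. G (u + t *s w) = poly q t" by blast
  then show ?case by (intro exI[of _ "p + q"]) simp
next
  case (mult f F g G)
  then obtain p q where "\<forall>t. F (u + t *s w) = poly p t" "\<forall>t. G (u + t *s w) = poly q t" by blast
  then show ?case by (intro exI[of _ "p * q"]) simp
qed

text \<open>With \<open>z = u + \<i> w\<close> for real \<open>u\<close> and \<open>w\<close>, the
  restriction to the complex line \<open>u + t w\<close> is a univariate polynomial that vanishes at
  every real \<open>t\<close>, hence also at \<open>t = \<i>\<close>.\<close>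

lemma polypair_zero:
  assumes "polypair f F" "\<And>x. f x = 0"
  shows "F z = 0"
proof -
  define u w where "u = (\<chi> i. Re (z $ i))" and "w = (\<chi> i. Im (z $ i))"
  obtain p where p: "\<And>t. F (cvec u + t *s cvec w) = poly p t"
    using polypair_line[OF assms(1)] by blast
  have "poly p (complex_of_real t) = 0" for t
  proof -
    have "cvec u + complex_of_real t *s cvec w = cvec (u + t *\<^sub>R w)"
      by (simp add: vec_eq_iff)
    then show ?thesis using p[of "complex_of_real t"] polypair_real[OF assms(1)] assms(2) by simp
  qed
  then have "range complex_of_real \<subseteq> {t. poly p t = 0}" by auto
  moreover have "infinite (range complex_of_real)"
    using finite_imageD[of complex_of_real UNIV] infinite_UNIV_char_0 inj_of_real by blast
  ultimately have "p = 0" using poly_roots_finite finite_subset by blast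
  moreover have "z = cvec u + \<i> *s cvec w"
    by (simp add: vec_eq_iff u_def w_def complex_eq)
  ultimately show ?thesis using p[of \<i>] by simp
qed

lemma polypair_eq:
  assumes "polypair f F" "polypair g G" "\<And>x. f x = g x"
  shows "F z = G z"
  using polypair_zero[OF polypair_diff[OF assms(1,2)]] assms(3) by simp

section \<open>Division by the quadratic form\<close>

definition coord_free :: "'n \<Rightarrow> ('a^'n \<Rightarrow> 'b) \<Rightarrow> bool" where
  "coord_free i A \<longleftrightarrow> (\<forall>z w. (\<forall>j. j \<noteq> i \<longrightarrow> z $ j = w $ j) \<longrightarrow> A z = A w)"

lemma coord_freeD: "coord_free i A \<Longrightarrow> (\<And>j. j \<noteq> i \<Longrightarrow> z $ j = w $ j) \<Longrightarrow> A z = A w"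
  unfolding coord_free_def by blast

lemma coord_free_op:
  "coord_free i A \<Longrightarrow> coord_free i B \<Longrightarrow> coord_free i (\<lambda>z. op (A z) (B z))"
  unfolding coord_free_def by metis

text \<open>Division with remainder by \<open>(z, z)\<close>, which is a monic quadratic polynomial in \<open>z\<^sub>i\<close>.\<close>
lemma polypair_division:
  fixes f :: "real^'n \<Rightarrow> real"
  assumes "polypair f F"
  shows "\<exists>g G a A b B. polypair g G \<and> polypair a A \<and> polypair b B \<and> coord_free i A \<and> coord_free i B \<and>
    (\<forall>z. F z = cdot z z * G z + z $ i * A z + B z)"
  using assms
proof (induction rule: polypair.induct)
  case (const c)
  show ?case
    using polypair.const[of 0] polypair.const[of c]
    by (intro exI[of _ "\<lambda>_. 0"] exI[of _ "\<lambda>_. c"] exI[of _ "\<lambda>_. complex_of_real c"])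
      (auto simp: coord_free_def)
next
  case (coord k)
  have 0: "polypair (\<lambda>_. 0) (\<lambda>_. 0)" using polypair.const[of 0] by simp
  show ?case
  proof (cases "k = i")
    case True
    have 1: "polypair (\<lambda>_. 1) (\<lambda>_. 1)" using polypair.const[of 1] by simp
    show ?thesis
      by (rule exI[of _ "\<lambda>_. 0"], rule exI[of _ "\<lambda>_. 0"], rule exI[of _ "\<lambda>_. 1"], rule exI[of _ "\<lambda>_. 1"],
          rule exI[of _ "\<lambda>_. 0"], rule exI[of _ "\<lambda>_. 0"]) (auto simp: coord_free_def True 0 1)
  next
    case False
    show ?thesis
      by (rule exI[of _ "\<lambda>_. 0"], rule exI[of _ "\<lambda>_. 0"], rule exI[of _ "\<lambda>_. 0"], rule exI[of _ "\<lambda>_. 0"],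
          rule exI[of _ "\<lambda>x. x $ k"], rule exI[of _ "\<lambda>z. z $ k"])
        (auto simp: coord_free_def False 0 polypair.coord)
  qed
next
  case (add f1 F1 f2 F2)
  obtain g1 G1 a1 A1 b1 B1 where 1: "polypair g1 G1" "polypair a1 A1" "polypair b1 B1"
    "coord_free i A1" "coord_free i B1" "\<And>z. F1 z = cdot z z * G1 z + z $ i * A1 z + B1 z"
    using add.IH(1) by auto
  obtain g2 G2 a2 A2 b2 B2 where 2: "polypair g2 G2" "polypair a2 A2" "polypair b2 B2"
    "coord_free i A2" "coord_free i B2" "\<And>z. F2 z = cdot z z * G2 z + z $ i * A2 z + B2 z"
    using add.IH(2) by auto
  show ?case
    using polypair.add[OF 1(1) 2(1)] polypair.add[OF 1(2) 2(2)] polypair.add[OF 1(3) 2(3)]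
      coord_free_op[OF 1(4) 2(4), of "(+)"] coord_free_op[OF 1(5) 2(5), of "(+)"]
    by (intro exI conjI) (assumption | simp add: 1(6) 2(6) algebra_simps)+
next
  case (mult f1 F1 f2 F2)
  obtain g1 G1 a1 A1 b1 B1 where 1: "polypair g1 G1" "polypair a1 A1" "polypair b1 B1"
    "coord_free i A1" "coord_free i B1" "\<And>z. F1 z = cdot z z * G1 z + z $ i * A1 z + B1 z"
    using mult.IH(1) by auto
  obtain g2 G2 a2 A2 b2 B2 where 2: "polypair g2 G2" "polypair a2 A2" "polypair b2 B2"
    "coord_free i A2" "coord_free i B2" "\<And>z. F2 z = cdot z z * G2 z + z $ i * A2 z + B2 z"
    using mult.IH(2) by auto
  define r R where "r x = (\<Sum>j\<in>-{i}. x $ j * x $ j)" and "R z = (\<Sum>j\<in>-{i}. z $ j * z $ j)"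
    for x :: "real^'n" and z :: "complex^'n"
  have rR: "polypair r R"
    unfolding r_def R_def by (intro polypair_sum polypair.mult polypair.coord)
  have Rf: "coord_free i R"
    unfolding coord_free_def R_def by (auto intro!: sum.cong)
  have q: "cdot z z = z $ i * z $ i + R z" for z
    unfolding cdot_def R_def by (subst sum.remove[of _ i]) (auto simp: Compl_eq_Diff_UNIV)
  have q2: "z $ i * z $ i = cdot z z - R z" for z using q[of z] by simp
  have qq: "polypair (\<lambda>x. x \<bullet> x) (\<lambda>z. cdot z z)"
    by (intro polypair_inner polypair.coord)
  \<comment> \<open>Multiplying the two remainders produces \<open>z_i^2 A1 A2\<close>; replacing
    \<open>z_i^2\<close> by \<open>(z,z) - R\<close> sends \<open>A1 A2\<close> to the quotient and
    \<open>- R A1 A2\<close> to the remainder.\<close>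
  define G where "G z = cdot z z * (G1 z * G2 z) + G1 z * (z $ i * A2 z + B2 z) + (z $ i * A1 z + B1 z) * G2 z
    + A1 z * A2 z" for z
  define g where "g x = (x \<bullet> x) * (g1 x * g2 x) + g1 x * (x $ i * a2 x + b2 x) + (x $ i * a1 x + b1 x) * g2 x
    + a1 x * a2 x" for x
  have gG: "polypair g G"
    unfolding g_def G_def by (intro polypair.add polypair.mult polypair.coord qq 1 2)
  have aA: "polypair (\<lambda>x. a1 x * b2 x + b1 x * a2 x) (\<lambda>z. A1 z * B2 z + B1 z * A2 z)"
    by (intro polypair.add polypair.mult 1 2)
  have bB: "polypair (\<lambda>x. b1 x * b2 x - r x * (a1 x * a2 x)) (\<lambda>z. B1 z * B2 z - R z * (A1 z * A2 z))"
    by (intro polypair_diff polypair.mult 1 2 rR)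
  have fA: "coord_free i (\<lambda>z. A1 z * B2 z + B1 z * A2 z)"
    by (intro coord_free_op[where op="(+)"] coord_free_op[where op="(*)"] 1 2)
  have fB: "coord_free i (\<lambda>z. B1 z * B2 z - R z * (A1 z * A2 z))"
    by (intro coord_free_op[where op="(-)"] coord_free_op[where op="(*)"] 1 2 Rf)
  have "F1 z * F2 z = cdot z z * G z + z $ i * (A1 z * B2 z + B1 z * A2 z) + (B1 z * B2 z - R z * (A1 z * A2 z))" for z
  proof -
    have "F1 z * F2 z = cdot z z * G z - cdot z z * (A1 z * A2 z) + (z $ i * z $ i) * (A1 z * A2 z)
       + z $ i * (A1 z * B2 z + B1 z * A2 z) + B1 z * B2 z"
      unfolding 1(6) 2(6) G_def by (simp add: algebra_simps)
    then show ?thesis unfolding q2 by (simp add: algebra_simps)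
  qed
  then show ?case using gG aA bB fA fB by blast
qed

text \<open>After division there remains \<open>z_i A + B\<close> with real polynomials
  \<open>A\<close> and \<open>B\<close> free of \<open>z_i\<close>. Real values of the other
  coordinates, of norm \<open>r\<close>, are completed by \<open>z_i = \<i> r\<close> to a point of
  the cone; there the real part \<open>b x\<close> and the imaginary part \<open>r a x\<close>
  vanish separately.\<close>

lemma polypair_cone_dvd:
  fixes f :: "real^'n \<Rightarrow> real"
  assumes pp: "polypair f F" and cone: "\<And>z. z \<in> asym_cone \<Longrightarrow> F z = 0"
    and hom: "\<And>t x. f (t *\<^sub>R x) = t ^ k * f x" and k: "k \<ge> 2"
  obtains g G where "polypair g G" "\<And>x. f x = (x \<bullet> x) * g x"
proof -
  fix i :: 'n
  obtain g G a A b B where *: "polypair g G" "polypair a A" "polypair b B"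
    "coord_free i A" "coord_free i B" and F: "\<And>z. F z = cdot z z * G z + z $ i * A z + B z"
    using polypair_division[OF pp, of i] by auto
  have cd: "cdot (cvec x) (cvec x) = complex_of_real (x \<bullet> x)" for x :: "real^'n"
    by (simp add: cdot_def inner_vec_def)
  have f: "f x = (x \<bullet> x) * g x + x $ i * a x + b x" for x
  proof -
    have "complex_of_real (f x) = complex_of_real ((x \<bullet> x) * g x + x $ i * a x + b x)"
      using F[of "cvec x"] polypair_real[OF pp] polypair_real[OF *(1)] polypair_real[OF *(2)]
        polypair_real[OF *(3)] cd by simp
    then show ?thesis using of_real_eq_iff by blast
  qed
  have key: "b x = 0 \<and> ((\<exists>j. j \<noteq> i \<and> x $ j \<noteq> 0) \<longrightarrow> a x = 0)" for x
  proof -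
    define s where "s = (\<Sum>j\<in>-{i}. x $ j * x $ j)"
    have s0: "s \<ge> 0" unfolding s_def by (intro sum_nonneg) auto
    define r where "r = sqrt s"
    have r: "r * r = s" using s0 by (simp add: r_def)
    define z where "z c = (\<chi> j. if j = i then c else complex_of_real (x $ j))" for c
    have zz: "cdot (z c) (z c) = c * c + complex_of_real s" for c
    proof -
      have "cdot (z c) (z c) = z c $ i * z c $ i + (\<Sum>j\<in>-{i}. z c $ j * z c $ j)"
        unfolding cdot_def by (subst sum.remove[of _ i]) (auto simp: Compl_eq_Diff_UNIV)
      also have "(\<Sum>j\<in>-{i}. z c $ j * z c $ j) = complex_of_real s"
        unfolding s_def of_real_sum by (intro sum.cong) (auto simp: z_def)
      finally show ?thesis by (simp add: z_def)
    qed
    have A: "A (z c) = complex_of_real (a x)" "B (z c) = complex_of_real (b x)" for c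
      using coord_freeD[OF *(4), of "z c" "cvec x"] coord_freeD[OF *(5), of "z c" "cvec x"]
        polypair_real[OF *(2)] polypair_real[OF *(3)] by (auto simp: z_def)
    have E: "c * complex_of_real (a x) + complex_of_real (b x) = 0" if "c * c = - complex_of_real s" for c
    proof -
      have "F (z c) = 0" using zz[of c] that by (intro cone) (simp add: asym_cone_def)
      then show ?thesis using F[of "z c"] zz[of c] that A by (simp add: z_def)
    qed
    have rr: "\<i> * complex_of_real r * (\<i> * complex_of_real r) = - complex_of_real s"
      by (simp add: complex_eq_iff r)
    have "\<i> * complex_of_real r * complex_of_real (a x) + complex_of_real (b x) = 0" 
      by (rule E[OF rr])
    then have "b x = 0 \<and> r * a x = 0"
      by (simp add: complex_eq_iff)
    moreover have "r \<noteq> 0" if "j \<noteq> i" "x $ j \<noteq> 0" for j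
    proof -
      have "0 < s" unfolding s_def
        using that by (intro sum_pos2[of _ j]) (auto simp: zero_less_mult_iff)
      then show ?thesis by (simp add: r_def)
    qed
    ultimately show ?thesis by auto
  qed
  \<comment> \<open>On the axis \<open>r = 0\<close>, and the cone gives no information on
    \<open>a x\<close>. There \<open>t^k f e = t^2 g (t e) + t (a x)\<close>; dividing by
    \<open>t\<close> and letting \<open>t\<close> tend to \<open>0\<close> forces
    \<open>a x = 0\<close> because \<open>k \<ge> 2\<close>.\<close>
  have ax: "a x = 0" if x: "\<And>j. j \<noteq> i \<Longrightarrow> x $ j = 0" for x
  proof -
    define e where "e = axis i (1::real)"
    have ee: "e \<bullet> e = 1" "e $ i = 1" by (auto simp: e_def inner_axis_axis)
    have "a (t *\<^sub>R e) = a x" for t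
    proof -
      have "A (cvec (t *\<^sub>R e)) = A (cvec x)"
        using x by (intro coord_freeD[OF *(4)]) (simp add: e_def axis_def)
      then show ?thesis using polypair_real[OF *(2)] by simp
    qed
    then have eq: "t ^ k * f e = t * t * g (t *\<^sub>R e) + t * a x" for t
      using f[of "t *\<^sub>R e"] key[of "t *\<^sub>R e"] hom[of t e] ee by simp
    have "a x = t ^ (k - 1) * f e - t * g (t *\<^sub>R e)" if "t \<noteq> 0" for t
    proof -
      have "t * (t ^ (k - 1) * f e) = t * (t * g (t *\<^sub>R e) + a x)"
        using eq[of t] k by (simp add: power_eq_if[of _ k] algebra_simps)
      then show ?thesis using that by simp
    qed
    then have "((\<lambda>t. t ^ (k - 1) * f e - t * g (t *\<^sub>R e)) \<longlongrightarrow> a x) (at 0)"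
      by (intro tendsto_eventually) (auto simp: eventually_at_filter)
    moreover have "((\<lambda>t. t ^ (k - 1) * f e - t * g (t *\<^sub>R e)) \<longlongrightarrow> 0 ^ (k - 1) * f e - 0 * g (0 *\<^sub>R e)) (at 0)"
    proof (intro tendsto_intros)
      have "continuous_on UNIV g" using polypair_ck[OF *(1)] by (rule ck_continuous_on)
      then have "continuous_on UNIV (\<lambda>t. g (t *\<^sub>R e))"
        by (rule continuous_on_compose2) (auto intro!: continuous_intros)
      then have "\<forall>s. ((\<lambda>t. g (t *\<^sub>R e)) \<longlongrightarrow> g (s *\<^sub>R e)) (at s)"
        by (simp add: continuous_on_def)
      then show "((\<lambda>t. g (t *\<^sub>R e)) \<longlongrightarrow> g (0 *\<^sub>R e)) (at 0)" by blast
    qed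
    ultimately have "a x = 0 ^ (k - 1) * f e - 0 * g (0 *\<^sub>R e)"
      using tendsto_unique trivial_limit_at by blast
    then show ?thesis using k by simp
  qed
  have "f x = (x \<bullet> x) * g x" for x
    using f[of x] key[of x] ax[of x] by fastforce
  with *(1) show ?thesis by (rule that)
qed

section \<open>Taylor expansion\<close>

text \<open>The \<open>k\<close>-fold derivative at \<open>0\<close> along \<open>v\<close>, divided
  by \<open>k!\<close>. The factorial builds up from the factors \<open>1 / Suc k\<close>, and the
  recursion through partial derivatives has the shape of \<open>ck\<close>.\<close>

fun tay :: "nat \<Rightarrow> (real^'n \<Rightarrow> real^'n) \<Rightarrow> real^'n \<Rightarrow> real^'n" where
  "tay 0 f v = f 0"
| "tay (Suc k) f v = (1 / real (Suc k)) *\<^sub>R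
     (\<Sum>i\<in>UNIV. (v $ i) *\<^sub>R tay k (\<lambda>x. frechet_derivative f (at x) (axis i 1)) v)"

lemma tay_homogeneous: "tay k f (t *\<^sub>R v) = t ^ k *\<^sub>R tay k f v"
proof (induction k arbitrary: f)
  case (Suc k)
  show ?case by (simp add: Suc scaleR_sum_right mult_ac)
qed simp

lemma tay_polypair: "\<exists>F. polypair (\<lambda>v. tay k f v $ j) F"
proof (induction k arbitrary: f)
  case 0
  show ?case unfolding tay.simps by (rule exI, rule polypair.const)
next
  case (Suc k)
  have "\<forall>i. \<exists>F. polypair (\<lambda>v. tay k (\<lambda>x. frechet_derivative f (at x) (axis i 1)) v $ j) F"
    using Suc by blast
  from choice[OF this] obtain F
    where F: "\<And>i. polypair (\<lambda>v. tay k (\<lambda>x. frechet_derivative f (at x) (axis i 1)) v $ j) (F i)"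
    by blast
  have "polypair (\<lambda>v. 1 / real (Suc k) * (\<Sum>i\<in>UNIV. v $ i * tay k (\<lambda>x. frechet_derivative f (at x) (axis i 1)) v $ j))
     (\<lambda>z. complex_of_real (1 / real (Suc k)) * (\<Sum>i\<in>UNIV. z $ i * F i z))"
    by (intro polypair.mult polypair.const polypair_sum polypair.coord F)
  moreover have "tay (Suc k) f v $ j =
      1 / real (Suc k) * (\<Sum>i\<in>UNIV. v $ i * tay k (\<lambda>x. frechet_derivative f (at x) (axis i 1)) v $ j)" for v
    by simp
  ultimately show ?case by (simp only:) blast
qed

text \<open>Peano remainder by induction on \<open>m\<close>: Euler's relation makes the derivative
  of the error along the segment from \<open>0\<close> to \<open>x\<close> a combination of the
  errors of the partial derivatives, one order lower, and the mean value inequality carries their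
  bounds over. Each of the \<open>n\<close> coordinates receives the share
  \<open>\<epsilon> / n\<close>.\<close>

lemma taylor_remainder:
  fixes f :: "real^'n \<Rightarrow> real^'n"
  assumes "open U" "0 \<in> U" "ck m U f" "\<epsilon> > 0"
  shows "\<exists>\<delta>>0. \<forall>x. norm x < \<delta> \<longrightarrow> norm (f x - (\<Sum>k\<le>m. tay k f x)) \<le> \<epsilon> * norm x ^ m"
  using assms(3,4)
proof (induction m arbitrary: f \<epsilon>)
  case 0
  then have "continuous_on U f" by simp
  then have "isCont f 0" using assms(1,2) continuous_on_eq_continuous_at by blast
  then obtain \<delta> where "\<delta> > 0" "\<And>x. dist x 0 < \<delta> \<Longrightarrow> dist (f x) (f 0) < \<epsilon>"
    using \<open>\<epsilon> > 0\<close> unfolding continuous_at_eps_delta by blast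
  then show ?case by (intro exI[of _ \<delta>]) (auto simp: dist_norm less_imp_le)
next
  case (Suc m)
  define f' where "f' i x = frechet_derivative f (at x) (axis i 1)" for i x
  define n where "n = real CARD('n)"
  have n: "n > 0" by (simp add: n_def)
  have "\<exists>\<delta>>0. \<forall>x. norm x < \<delta> \<longrightarrow> norm (f' i x - (\<Sum>k\<le>m. tay k (f' i) x)) \<le> \<epsilon> / n * norm x ^ m" for i
    unfolding f'_def using Suc.prems n
    by (intro Suc.IH ck_SucD(2)[OF Suc.prems(1)]) (auto simp: axis_in_Basis_iff)
  then obtain d where d: "\<And>i. d i > 0"
    "\<And>i x. norm x < d i \<Longrightarrow> norm (f' i x - (\<Sum>k\<le>m. tay k (f' i) x)) \<le> \<epsilon> / n * norm x ^ m"
    by metis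
  obtain d0 where d0: "d0 > 0" "ball 0 d0 \<subseteq> U"
    using assms(1,2) open_contains_ball by blast
  define \<delta> where "\<delta> = min d0 (Min (range d))"
  have "\<delta> > 0" unfolding \<delta>_def using d0 d(1) by (auto simp: Min_gr_iff)
  have \<delta>: "\<delta> \<le> d0" "\<And>i. \<delta> \<le> d i"
    unfolding \<delta>_def by (auto simp: min.coboundedI2)
  have "norm (f x - (\<Sum>k\<le>Suc m. tay k f x)) \<le> \<epsilon> * norm x ^ Suc m" if x: "norm x < \<delta>" for x
  proof -
    define g where "g s = f (s *\<^sub>R x) - (\<Sum>k\<le>Suc m. s ^ k *\<^sub>R tay k f x)" for s
    define g' where "g' s = (\<Sum>i\<in>UNIV. x $ i *\<^sub>R (f' i (s *\<^sub>R x) - (\<Sum>k\<le>m. tay k (f' i) (s *\<^sub>R x))))" for s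
    have sx: "norm (s *\<^sub>R x) \<le> norm x" if "s \<in> {0..1}" for s
      using that by (simp add: mult_left_le_one_le)
    have der: "(g has_derivative (\<lambda>h. h *\<^sub>R g' s)) (at s within {0..1})" if s: "s \<in> {0..1}" for s
    proof -
      have "s *\<^sub>R x \<in> U" using sx[OF s] x \<delta>(1) d0(2) by (force simp: subset_eq)
      then have fD: "(f has_derivative frechet_derivative f (at (s *\<^sub>R x))) (at (s *\<^sub>R x))"
        by (rule ck_SucD(1)[OF Suc.prems(1)])
      have lin: "linear (frechet_derivative f (at (s *\<^sub>R x)))"
        using fD by (rule has_derivative_linear)
      have xe: "frechet_derivative f (at (s *\<^sub>R x)) x = (\<Sum>i\<in>UNIV. x $ i *\<^sub>R f' i (s *\<^sub>R x))"
      proof -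
        have "frechet_derivative f (at (s *\<^sub>R x)) (\<Sum>i\<in>UNIV. x $ i *\<^sub>R axis i 1) = (\<Sum>i\<in>UNIV. x $ i *\<^sub>R f' i (s *\<^sub>R x))"
          using lin by (simp add: linear_sum linear_scale f'_def)
        moreover have "(\<Sum>i\<in>UNIV. x $ i *\<^sub>R axis i (1::real)) = x"
          using basis_expansion[of x] by (simp add: scalar_mult_eq_scaleR)
        ultimately show ?thesis by simp
      qed
      have "((\<lambda>s. f (s *\<^sub>R x)) has_derivative (\<lambda>h. frechet_derivative f (at (s *\<^sub>R x)) (h *\<^sub>R x))) (at s within {0..1})"
        by (rule has_derivative_compose[of "\<lambda>s. s *\<^sub>R x" "\<lambda>h. h *\<^sub>R x", OF _ fD])
          (intro has_derivative_scaleR_left has_derivative_ident)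
      then have D1: "((\<lambda>s. f (s *\<^sub>R x)) has_derivative (\<lambda>h. h *\<^sub>R (\<Sum>i\<in>UNIV. x $ i *\<^sub>R f' i (s *\<^sub>R x)))) (at s within {0..1})"
        using lin xe by (simp add: linear_scale)
      have D2: "((\<lambda>s. s ^ Suc k *\<^sub>R tay (Suc k) f x) has_derivative (\<lambda>h. h *\<^sub>R (\<Sum>i\<in>UNIV. x $ i *\<^sub>R tay k (f' i) (s *\<^sub>R x))))
          (at s within {0..1})" for k
      proof -
        have "real (Suc k) *\<^sub>R tay (Suc k) f x = (\<Sum>i\<in>UNIV. x $ i *\<^sub>R tay k (f' i) x)"
          by (simp add: f'_def[abs_def])
        then have e: "(\<Sum>i\<in>UNIV. x $ i *\<^sub>R tay k (f' i) (s *\<^sub>R x)) = (real (Suc k) * s ^ k) *\<^sub>R tay (Suc k) f x"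
          unfolding tay_homogeneous scaleR_left_commute[of "x $ _"] scaleR_sum_right[symmetric]
          by (metis mult.commute scaleR_scaleR)
        show ?thesis unfolding e
          by (rule has_derivative_eq_rhs, rule has_derivative_scaleR_left, rule has_derivative_power,
              rule has_derivative_ident) (auto simp: algebra_simps)
      qed
      have "((\<lambda>s. f (s *\<^sub>R x) - (tay 0 f x + (\<Sum>k\<le>m. s ^ Suc k *\<^sub>R tay (Suc k) f x))) has_derivative
          (\<lambda>h. h *\<^sub>R (\<Sum>i\<in>UNIV. x $ i *\<^sub>R f' i (s *\<^sub>R x)) - (0 + (\<Sum>k\<le>m. h *\<^sub>R (\<Sum>i\<in>UNIV. x $ i *\<^sub>R tay k (f' i) (s *\<^sub>R x))))))
          (at s within {0..1})"
        by (intro has_derivative_diff has_derivative_add has_derivative_const has_derivative_sum D1 D2)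
      moreover have "(\<lambda>s. f (s *\<^sub>R x) - (tay 0 f x + (\<Sum>k\<le>m. s ^ Suc k *\<^sub>R tay (Suc k) f x))) = g"
        unfolding g_def sum.atMost_Suc_shift by simp
      moreover have "h *\<^sub>R (\<Sum>i\<in>UNIV. x $ i *\<^sub>R f' i (s *\<^sub>R x)) - (0 + (\<Sum>k\<le>m. h *\<^sub>R (\<Sum>i\<in>UNIV. x $ i *\<^sub>R tay k (f' i) (s *\<^sub>R x))))
        = h *\<^sub>R g' s" for h
      proof -
        have "(\<Sum>k\<le>m. \<Sum>i\<in>UNIV. x $ i *\<^sub>R tay k (f' i) (s *\<^sub>R x)) = (\<Sum>i\<in>UNIV. x $ i *\<^sub>R (\<Sum>k\<le>m. tay k (f' i) (s *\<^sub>R x)))"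
          unfolding scaleR_sum_right by (rule sum.swap)
        then show ?thesis
          unfolding g'_def by (simp add: scaleR_diff_right sum_subtractf flip: scaleR_sum_right)
      qed
      ultimately show ?thesis by simp
    qed
    have bound: "norm (g' s) \<le> \<epsilon> * norm x ^ Suc m" if s: "s \<in> {0..1}" for s
    proof -
      have "norm (g' s) \<le> (\<Sum>i\<in>(UNIV::'n set). norm x * (\<epsilon> / n * norm x ^ m))"
        unfolding g'_def
      proof (rule sum_norm_le)
        fix i :: 'n
        have "norm (s *\<^sub>R x) < d i" using sx[OF s] x \<delta>(2)[of i] by simp
        then have "norm (f' i (s *\<^sub>R x) - (\<Sum>k\<le>m. tay k (f' i) (s *\<^sub>R x))) \<le> \<epsilon> / n * norm (s *\<^sub>R x) ^ m"
          by (rule d(2))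
        also have "\<dots> \<le> \<epsilon> / n * norm x ^ m"
          using sx[OF s] n Suc.prems(2) by (intro mult_left_mono power_mono) auto
        finally show "norm (x $ i *\<^sub>R (f' i (s *\<^sub>R x) - (\<Sum>k\<le>m. tay k (f' i) (s *\<^sub>R x)))) \<le> norm x * (\<epsilon> / n * norm x ^ m)"
          unfolding norm_scaleR by (intro mult_mono) (auto simp: component_le_norm_cart)
      qed
      also have "\<dots> = \<epsilon> * norm x ^ Suc m" using n by (simp add: n_def)
      finally show ?thesis .
    qed
    have "norm (g 1 - g 0) \<le> \<epsilon> * norm x ^ Suc m * norm (1 - 0 :: real)"
    proof (rule differentiable_bound[of "{0..1}", OF _ der])
      show "onorm (\<lambda>h. h *\<^sub>R g' s) \<le> \<epsilon> * norm x ^ Suc m" if "s \<in> {0..1}" for s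
      proof (rule onorm_le)
        show "norm (h *\<^sub>R g' s) \<le> \<epsilon> * norm x ^ Suc m * norm h" for h :: real
          using mult_left_mono[OF bound[OF that], of "\<bar>h\<bar>"] by (simp add: mult_ac)
      qed
    qed auto
    moreover have "g 0 = 0" by (simp add: g_def sum.atMost_Suc_shift del: sum.atMost_Suc)
    moreover have "g 1 = f x - (\<Sum>k\<le>Suc m. tay k f x)" by (simp add: g_def)
    ultimately show ?thesis by simp
  qed
  with \<open>\<delta> > 0\<close> show ?case by blast
qed

lemma norm_divideR:
  fixes y :: "'a::real_normed_vector"
  shows "norm (y /\<^sub>R c) = norm y / \<bar>c\<bar>"
  by (simp add: divide_inverse_commute)

lemma taylor_limit:
  fixes f :: "real^'n \<Rightarrow> real^'n"
  assumes "open U" "0 \<in> U" "ck m U f"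
  shows "((\<lambda>x. (f x - (\<Sum>k\<le>m. tay k f x)) /\<^sub>R norm x ^ m) \<longlongrightarrow> 0) (at 0)"
proof (rule tendstoI)
  fix e :: real assume "e > 0"
  then obtain \<delta> where \<delta>: "\<delta> > 0" "\<And>x. norm x < \<delta> \<Longrightarrow> norm (f x - (\<Sum>k\<le>m. tay k f x)) \<le> e / 2 * norm x ^ m"
    using taylor_remainder[OF assms, of "e / 2"] by auto
  have "dist ((f x - (\<Sum>k\<le>m. tay k f x)) /\<^sub>R norm x ^ m) 0 < e" if "x \<noteq> 0" "dist x 0 < \<delta>" for x
  proof -
    have "norm (f x - (\<Sum>k\<le>m. tay k f x)) / norm x ^ m \<le> e / 2"
      using \<delta>(2)[of x] that by (simp add: divide_le_eq)
    moreover have "e / 2 < e" using \<open>e > 0\<close> by simp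
    ultimately have "norm (f x - (\<Sum>k\<le>m. tay k f x)) / norm x ^ m < e" by (rule order.strict_trans1)
    then show ?thesis unfolding dist_norm diff_zero norm_divideR by simp
  qed
  then show "\<forall>\<^sub>F x in at 0. dist ((f x - (\<Sum>k\<le>m. tay k f x)) /\<^sub>R norm x ^ m) 0 < e"
    unfolding eventually_at using \<delta>(1) by blast
qed

text \<open>Dividing by a power of \<open>s\<close> rather than of \<open>norm (s v)\<close> keeps
  the Taylor terms at \<open>v\<close> as the coefficients of the expansion and covers
  \<open>v = 0\<close>.\<close>

lemma taylor_line:
  fixes f :: "real^'n \<Rightarrow> real^'n"
  assumes "open U" "0 \<in> U" "ck m U f"
  shows "((\<lambda>s. (f (s *\<^sub>R v) - (\<Sum>k\<le>m. s ^ k *\<^sub>R tay k f v)) /\<^sub>R s ^ m) \<longlongrightarrow> 0) (at 0)"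
proof (rule tendstoI)
  fix e :: real assume "e > 0"
  \<comment> \<open>The summand \<open>1\<close> keeps \<open>c\<close> positive when
    \<open>v = 0\<close>.\<close>
  define c where "c = norm v ^ m + 1"
  have c: "c > 0" by (simp add: c_def add_nonneg_pos)
  define e' where "e' = e / (2 * c)"
  have "e' > 0" using \<open>e > 0\<close> c by (simp add: e'_def)
  then obtain \<delta> where \<delta>: "\<delta> > 0" "\<And>x. norm x < \<delta> \<Longrightarrow> norm (f x - (\<Sum>k\<le>m. tay k f x)) \<le> e' * norm x ^ m"
    using taylor_remainder[OF assms, of e'] by auto
  have "dist ((f (s *\<^sub>R v) - (\<Sum>k\<le>m. s ^ k *\<^sub>R tay k f v)) /\<^sub>R s ^ m) 0 < e"
    if "s \<noteq> 0" "dist s 0 < \<delta> / (norm v + 1)" for s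
  proof -
    have "\<bar>s\<bar> * (norm v + 1) < \<delta>" using that by (simp add: pos_less_divide_eq add_nonneg_pos)
    then have "norm (s *\<^sub>R v) < \<delta>" by (simp add: distrib_left)
    then have "norm (f (s *\<^sub>R v) - (\<Sum>k\<le>m. s ^ k *\<^sub>R tay k f v)) \<le> e' * (\<bar>s\<bar> ^ m * norm v ^ m)"
      using \<delta>(2)[of "s *\<^sub>R v"] by (simp add: tay_homogeneous power_mult_distrib)
    then have "norm (f (s *\<^sub>R v) - (\<Sum>k\<le>m. s ^ k *\<^sub>R tay k f v)) / \<bar>s\<bar> ^ m \<le> e' * norm v ^ m"
      using that by (simp add: divide_le_eq mult_ac)
    also have "\<dots> \<le> e' * c" using \<open>e' > 0\<close> by (simp add: c_def)
    also have "\<dots> = e / 2" using c by (simp add: e'_def)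
    also have "\<dots> < e" using \<open>e > 0\<close> by simp
    finally show ?thesis unfolding dist_norm diff_zero norm_divideR power_abs .
  qed
  moreover have "\<delta> / (norm v + 1) > 0" using \<delta>(1) by (simp add: add_nonneg_pos)
  ultimately show "\<forall>\<^sub>F s in at 0. dist ((f (s *\<^sub>R v) - (\<Sum>k\<le>m. s ^ k *\<^sub>R tay k f v)) /\<^sub>R s ^ m) 0 < e"
    unfolding eventually_at by blast
qed

section \<open>Quadratic parts\<close>

lemma quadR_scale: "quadR a (t *\<^sub>R v) = t\<^sup>2 *\<^sub>R quadR a v"
  by (simp add: quadR_def vec_eq_iff sum_distrib_left power2_eq_square mult_ac)

lemma quadR_diff: "quadR (\<lambda>k i j. a k i j - b k i j) v = quadR a v - quadR b v"
  by (simp add: quadR_def vec_eq_iff sum_subtractf left_diff_distrib)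

lemma quadR_axis: "quadR a (axis i 1) $ k = a k i i"
proof -
  have "a k p q * axis i 1 $ p * axis i 1 $ q = (if q = i then (if p = i then a k p q else 0) else 0)" for p q
    by (simp add: axis_def)
  then show ?thesis by (simp add: quadR_def)
qed

lemma quadR_axis_add:
  "quadR a (axis i 1 + c *\<^sub>R axis j 1) $ k = a k i i + c * (a k i j + a k j i) + c\<^sup>2 * a k j j"
proof -
  have e: "a k p q * (axis i 1 + c *\<^sub>R axis j 1) $ p * (axis i 1 + c *\<^sub>R axis j 1) $ q =
    (if q = i then (if p = i then a k p q else 0) else 0) + (if q = j then (if p = i then c * a k p q else 0) else 0) +
    (if q = i then (if p = j then c * a k p q else 0) else 0) + (if q = j then (if p = j then c\<^sup>2 * a k p q else 0) else 0)"
    for p q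
    by (simp add: axis_def algebra_simps power2_eq_square)
  show ?thesis unfolding quadR_def vec_lambda_beta e
    by (simp add: sum.distrib distrib_left)
qed

text \<open>Polarization: the pure coefficients are read off at \<open>e_i\<close>, the mixed ones
  at \<open>e_i + e_j\<close>, where symmetry identifies the two that occur.\<close>

lemma quadR_eq_imp_eq:
  assumes "sym_coeffs a" "sym_coeffs b" "\<And>v. quadR a v = quadR b v"
  shows "a = b"
proof -
  have d: "a k i i = b k i i" for k i
    using quadR_axis[of a i k] quadR_axis[of b i k] assms(3) by simp
  have "a k i j = b k i j" for k i j
    using quadR_axis_add[of a i 1 j k] quadR_axis_add[of b i 1 j k] assms d[of k i] d[of k j]
    unfolding sym_coeffs_def by (metis add_left_cancel add_right_cancel mult_2 mult_1 mult_cancel_left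
        zero_neq_numeral)
  then show ?thesis by blast
qed

text \<open>The difference of the two quadratic maps, divided by the squared norm, tends to
  \<open>0\<close> but is constant along each ray by homogeneity. Uniqueness is what gives a value
  to the description operator in \<open>Phi2\<close>.\<close>

lemma quad_taylor_unique:
  assumes "quad_taylor f a" "quad_taylor f b"
  shows "a = b"
proof (rule quadR_eq_imp_eq)
  show "sym_coeffs a" "sym_coeffs b" using assms by (auto simp: quad_taylor_def)
  show "quadR a v = quadR b v" for v
  proof (cases "v = 0")
    case True
    then show ?thesis by (simp add: quadR_def)
  next
    case False
    have "((\<lambda>x. (f x - x - quadR b x) /\<^sub>R (norm x)\<^sup>2 - (f x - x - quadR a x) /\<^sub>R (norm x)\<^sup>2) \<longlongrightarrow> 0 - 0) (at 0)"
      using assms unfolding quad_taylor_def by (intro tendsto_diff) auto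
    then have "((\<lambda>x. (quadR a x - quadR b x) /\<^sub>R (norm x)\<^sup>2) \<longlongrightarrow> 0) (at 0)"
      by (simp add: scaleR_diff_right[symmetric])
    moreover have "filterlim (\<lambda>s. s *\<^sub>R v) (at 0) (at (0::real))"
      unfolding filterlim_at using False
      by (auto simp: eventually_at_filter intro!: tendsto_eq_intros)
    ultimately have "((\<lambda>s. (quadR a (s *\<^sub>R v) - quadR b (s *\<^sub>R v)) /\<^sub>R (norm (s *\<^sub>R v))\<^sup>2) \<longlongrightarrow> 0) (at (0::real))"
      by (rule filterlim_compose)
    moreover have "\<forall>\<^sub>F s in at (0::real). (quadR a (s *\<^sub>R v) - quadR b (s *\<^sub>R v)) /\<^sub>R (norm (s *\<^sub>R v))\<^sup>2
        = (quadR a v - quadR b v) /\<^sub>R (norm v)\<^sup>2"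
    proof -
      have "(quadR a (s *\<^sub>R v) - quadR b (s *\<^sub>R v)) /\<^sub>R (norm (s *\<^sub>R v))\<^sup>2 = (quadR a v - quadR b v) /\<^sub>R (norm v)\<^sup>2"
        if "s \<noteq> 0" for s
      proof -
        have "quadR a (s *\<^sub>R v) - quadR b (s *\<^sub>R v) = s\<^sup>2 *\<^sub>R (quadR a v - quadR b v)"
          by (simp add: quadR_scale scaleR_diff_right)
        moreover have "(norm (s *\<^sub>R v))\<^sup>2 = s\<^sup>2 * (norm v)\<^sup>2" by (simp add: power_mult_distrib)
        ultimately show ?thesis using that by simp
      qed
      then show ?thesis unfolding eventually_at_filter by simp
    qed
    ultimately have "((\<lambda>s. (quadR a v - quadR b v) /\<^sub>R (norm v)\<^sup>2) \<longlongrightarrow> 0) (at (0::real))"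
      by (rule Lim_transform_eventually)
    then have "(quadR a v - quadR b v) /\<^sub>R (norm v)\<^sup>2 = 0"
      using tendsto_const_iff trivial_limit_at by blast
    then show ?thesis using False by simp
  qed
qed

lemma Phi2_eq: "quad_taylor f a \<Longrightarrow> Phi2 f = quadC a"
  unfolding Phi2_def using quad_taylor_unique by (metis the_equality)

lemma tay_1:
  fixes f :: "real^'n \<Rightarrow> real^'n"
  assumes "(f has_derivative f') (at 0)"
  shows "tay (Suc 0) f v = f' v"
proof -
  have lin: "linear f'" using assms by (rule has_derivative_linear)
  have "f' (\<Sum>i\<in>UNIV. v $ i *\<^sub>R axis i 1) = (\<Sum>i\<in>UNIV. v $ i *\<^sub>R f' (axis i 1))"
    using lin by (simp add: linear_sum linear_scale)
  moreover have "(\<Sum>i\<in>UNIV. v $ i *\<^sub>R axis i (1::real)) = v"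
    using basis_expansion[of v] by (simp add: scalar_mult_eq_scaleR)
  ultimately show ?thesis using frechet_derivative_at[OF assms] by simp
qed

lemma tay_2:
  fixes f :: "real^'n \<Rightarrow> real^'n"
  obtains a where "sym_coeffs a" "\<And>v. tay (Suc (Suc 0)) f v = quadR a v"
proof -
  define H where "H i j = frechet_derivative (\<lambda>x. frechet_derivative f (at x) (axis i 1)) (at 0) (axis j 1)" for i j
  \<comment> \<open>One factor \<open>1/2\<close> is the Taylor coefficient of order two, the other
    averages the two orders of differentiation, so that \<open>a\<close> is symmetric by
    construction.\<close>
  define a where "a k i j = (H i j $ k + H j i $ k) / 4" for k i j
  have "sym_coeffs a" by (simp add: sym_coeffs_def a_def add.commute)
  moreover have "tay (Suc (Suc 0)) f v = quadR a v" for v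
  proof -
    have "tay (Suc (Suc 0)) f v $ k = quadR a v $ k" for k
    proof -
      define s where "s = (\<Sum>i\<in>UNIV. \<Sum>j\<in>UNIV. H i j $ k * v $ i * v $ j)"
      have "tay (Suc (Suc 0)) f v $ k = s / 2"
        by (simp add: s_def H_def[abs_def] sum_distrib_left mult_ac)
      moreover have "quadR a v $ k = (\<Sum>i\<in>UNIV. \<Sum>j\<in>UNIV. H i j $ k * v $ i * v $ j / 4 + H j i $ k * v $ j * v $ i / 4)"
        by (simp add: quadR_def a_def field_simps)
      moreover have "\<dots> = s / 4 + (\<Sum>i\<in>UNIV. \<Sum>j\<in>UNIV. H j i $ k * v $ j * v $ i) / 4"
        by (simp add: sum.distrib s_def sum_divide_distrib)
      moreover have "(\<Sum>i\<in>UNIV. \<Sum>j\<in>UNIV. H j i $ k * v $ j * v $ i) = s"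
        unfolding s_def by (rule sum.swap)
      ultimately show ?thesis by simp
    qed
    then show ?thesis unfolding vec_eq_iff by blast
  qed
  ultimately show ?thesis by (rule that)
qed

lemma quad_taylor_tay:
  fixes f :: "real^'n \<Rightarrow> real^'n"
  assumes "open U" "0 \<in> U" "ck (Suc (Suc 0)) U f" "f 0 = 0" "(f has_derivative id) (at 0)"
  obtains a where "quad_taylor f a" "\<And>v. tay (Suc (Suc 0)) f v = quadR a v"
proof -
  obtain a where a: "sym_coeffs a" "\<And>v. tay (Suc (Suc 0)) f v = quadR a v" using tay_2[of f] by blast
  have "(\<Sum>k\<le>Suc (Suc 0). tay k f x) = x + quadR a x" for x
    using a(2) tay_1[OF assms(5)] assms(4) by (simp add: sum.atMost_Suc del: tay.simps(2))
  then have "((\<lambda>x. (f x - (x + quadR a x)) /\<^sub>R norm x ^ Suc (Suc 0)) \<longlongrightarrow> 0) (at 0)"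
    using taylor_limit[OF assms(1-3)] by simp
  then have "quad_taylor f a"
    unfolding quad_taylor_def using a(1) by (simp add: diff_diff_eq power2_eq_square)
  then show ?thesis using a(2) by (rule that)
qed

text \<open>The coefficients of \<open>\<lambda>(x) x\<close> are read off from the values at \<open>e\<^sub>i\<close> and \<open>e\<^sub>i \<plusminus> e\<^sub>j\<close>.\<close>
lemma quadR_radial_imp_Wn:
  fixes c :: "'n::finite \<Rightarrow> 'n \<Rightarrow> 'n \<Rightarrow> real"
  assumes "sym_coeffs c" "\<And>v. quadR c v \<in> span {v}"
  shows "quadC c \<in> Wn"
proof -
  have sym: "c k i j = c k j i" for k i j using assms(1) by (simp add: sym_coeffs_def)
  have 1: "c k i i = 0" if "k \<noteq> i" for k i
  proof -
    obtain m where "quadR c (axis i 1) = m *\<^sub>R axis i 1" using assms(2)[of "axis i 1"] by (auto simp: span_singleton)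
    then have "quadR c (axis i 1) $ k = m * axis i 1 $ k" by simp
    then show ?thesis using that unfolding quadR_axis by (simp add: axis_def)
  qed
  have *: "\<exists>m. \<forall>k. c k i i + s * (2 * c k i j) + s\<^sup>2 * c k j j = m * ((if k = i then 1 else 0) + s * (if k = j then 1 else 0))"
    for i j s
  proof -
    obtain m where m: "quadR c (axis i 1 + s *\<^sub>R axis j 1) = m *\<^sub>R (axis i 1 + s *\<^sub>R axis j 1)"
      using assms(2)[of "axis i 1 + s *\<^sub>R axis j 1"] by (auto simp: span_singleton)
    have "c k i i + s * (2 * c k i j) + s\<^sup>2 * c k j j = m * ((if k = i then 1 else 0) + s * (if k = j then 1 else 0))" for k
    proof -
      have "quadR c (axis i 1 + s *\<^sub>R axis j 1) $ k = m * ((if k = i then 1 else 0) + s * (if k = j then 1 else 0))"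
        unfolding m by (simp add: axis_def)
      then show ?thesis unfolding quadR_axis_add using sym[of k j i] by simp
    qed
    then show ?thesis by blast
  qed
  define l where "l = (\<chi> i. c i i i)"
  have c: "c k i j = (if k = i then l $ j / 2 else 0) + (if k = j then l $ i / 2 else 0)" for k i j
  proof -
    have off: "c k i j = 0" if "k \<noteq> i" "k \<noteq> j" for k i j
    proof -
      obtain m where "\<forall>k. c k i i + 1 * (2 * c k i j) + 1\<^sup>2 * c k j j = m * ((if k = i then 1 else 0) + 1 * (if k = j then 1 else 0))"
        using *[of i 1 j] by blast
      then have "c k i i + 1 * (2 * c k i j) + 1\<^sup>2 * c k j j = 0" using that by simp
      then show ?thesis using 1[of k i] 1[of k j] that by simp
    qed
    \<comment> \<open>The components \<open>i\<close> and \<open>j\<close> at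
      \<open>e_i + e_j\<close> share the multiplier \<open>m\<close>, those at
      \<open>e_i - e_j\<close> carry \<open>m'\<close> with opposite signs. Adding the two resulting
      equations cancels \<open>c i i j\<close> and \<open>c j j j\<close>.\<close>
    have on: "c j i j = l $ i / 2" if "i \<noteq> j" for i j
    proof -
      obtain m where m: "\<forall>k. c k i i + 1 * (2 * c k i j) + 1\<^sup>2 * c k j j = m * ((if k = i then 1 else 0) + 1 * (if k = j then 1 else 0))"
        using *[of i 1 j] by blast
      obtain m' where m': "\<forall>k. c k i i + (-1) * (2 * c k i j) + (-1)\<^sup>2 * c k j j = m' * ((if k = i then 1 else 0) + (-1) * (if k = j then 1 else 0))"
        using *[of i "-1" j] by blast
      have "c i i i + 2 * c i i j = m" "2 * c j i j + c j j j = m"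
        using m[rule_format, of i] m[rule_format, of j] 1[of i j] 1[of j i] that by simp_all
      moreover have "c i i i - 2 * c i i j = m'" "c j j j - 2 * c j i j = - m'"
        using m'[rule_format, of i] m'[rule_format, of j] 1[of i j] 1[of j i] that by simp_all
      ultimately show ?thesis by (simp add: l_def)
    qed
    consider "k = i" "k = j" | "k = i" "k \<noteq> j" | "k \<noteq> i" "k = j" | "k \<noteq> i" "k \<noteq> j" by blast
    then show ?thesis
    proof cases
      case 2
      then show ?thesis using on[of j i] sym[of k i j] by simp
    qed (use off on[of i j] in \<open>simp_all add: l_def\<close>)
  qed
  have "quadC c z = (\<chi> k. (\<Sum>i\<in>UNIV. complex_of_real (l $ i) * z $ i) * z $ k)" for z
  proof -
    define S where "S = (\<Sum>i\<in>UNIV. complex_of_real (l $ i) * z $ i)"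
    have "quadC c z $ k = S * z $ k" for k
    proof -
      have e: "complex_of_real (c k i j) * z $ i * z $ j =
        (if i = k then z $ k * (complex_of_real (l $ j) * z $ j) / 2 else 0) +
        (if j = k then complex_of_real (l $ i) * z $ i * z $ k / 2 else 0)" for i j
        unfolding c by (auto simp: field_simps)
      have "quadC c z $ k = (\<Sum>i\<in>UNIV. \<Sum>j\<in>UNIV. (if i = k then z $ k * (complex_of_real (l $ j) * z $ j) / 2 else 0))
        + (\<Sum>i\<in>UNIV. \<Sum>j\<in>UNIV. (if j = k then complex_of_real (l $ i) * z $ i * z $ k / 2 else 0))"
        unfolding quadC_def vec_lambda_beta e sum.distrib ..
      also have "(\<Sum>i\<in>UNIV. \<Sum>j\<in>UNIV. (if i = k then z $ k * (complex_of_real (l $ j) * z $ j) / 2 else 0)) =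
         (\<Sum>j\<in>UNIV. z $ k * (complex_of_real (l $ j) * z $ j) / 2)"
        by (subst sum.swap) simp
      also have "\<dots> = z $ k * S / 2" by (simp add: S_def sum_distrib_left sum_divide_distrib)
      also have "(\<Sum>i\<in>UNIV. \<Sum>j\<in>UNIV. (if j = k then complex_of_real (l $ i) * z $ i * z $ k / 2 else 0)) = S * z $ k / 2"
        by (simp add: S_def sum_distrib_right sum_divide_distrib)
      finally show ?thesis by simp
    qed
    then show ?thesis by (simp add: vec_eq_iff S_def)
  qed
  then show ?thesis unfolding Wn_def by blast
qed

lemma Wn_imp_quadR_radial:
  assumes "quadC a - quadC b \<in> Wn"
  shows "quadR a v - quadR b v \<in> span {v}"
proof -
  obtain l where l: "quadC a - quadC b = (\<lambda>x. \<chi> k. (\<Sum>i\<in>UNIV. complex_of_real (l $ i) * x $ i) * x $ k)"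
    using assms unfolding Wn_def by blast
  have "(quadR a v - quadR b v) $ k = ((l \<bullet> v) *\<^sub>R v) $ k" for k
  proof -
    have "complex_of_real (quadR a v $ k - quadR b v $ k) = (quadC a - quadC b) (cvec v) $ k"
      by (simp add: polypair_real[OF polypair_quad])
    also have "\<dots> = complex_of_real ((l \<bullet> v) * v $ k)"
      unfolding l by (simp add: inner_vec_def)
    finally show ?thesis unfolding of_real_eq_iff by simp
  qed
  then have "quadR a v - quadR b v = (l \<bullet> v) *\<^sub>R v" unfolding vec_eq_iff by blast
  then show ?thesis by (auto simp: span_singleton)
qed

lemma quadC_diff: "quadC (\<lambda>k i j. a k i j - b k i j) = quadC a - quadC b"
  by (simp add: quadC_def vec_eq_iff sum_subtractf left_diff_distrib fun_eq_iff)

lemma quadR_radial_iff_Wn: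
  assumes "sym_coeffs a" "sym_coeffs b"
  shows "quadC a - quadC b \<in> Wn \<longleftrightarrow> (\<forall>v. quadR a v - quadR b v \<in> span {v})"
proof
  assume "\<forall>v. quadR a v - quadR b v \<in> span {v}"
  then have "quadC (\<lambda>k i j. a k i j - b k i j) \<in> Wn"
    using assms by (intro quadR_radial_imp_Wn) (auto simp: quadR_diff sym_coeffs_def)
  then show "quadC a - quadC b \<in> Wn" unfolding quadC_diff .
qed (blast intro: Wn_imp_quadR_radial)

section \<open>Expansion of a rectifier\<close>

lemma has_derivative_0_iff_quotient:
  fixes f :: "real \<Rightarrow> 'a::real_normed_vector"
  assumes "f 0 = 0"
  shows "(f has_derivative (\<lambda>h. h *\<^sub>R v)) (at 0) \<longleftrightarrow> ((\<lambda>t. f t /\<^sub>R t) \<longlongrightarrow> v) (at 0)"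
proof -
  have "norm (f (0 + h) - f 0 - h *\<^sub>R v) / norm h = norm (f h /\<^sub>R h - v)" if "h \<noteq> 0" for h
  proof -
    have "f h /\<^sub>R h - v = (f h - h *\<^sub>R v) /\<^sub>R h" using that by (simp add: scaleR_diff_right)
    then show ?thesis using assms by (simp only: norm_divideR) simp
  qed
  then have "\<forall>\<^sub>F h in at 0. norm (f (0 + h) - f 0 - h *\<^sub>R v) / norm h = norm (f h /\<^sub>R h - v)"
    unfolding eventually_at_filter by simp
  from tendsto_cong[OF this] have "((\<lambda>h. norm (f (0 + h) - f 0 - h *\<^sub>R v) / norm h) \<longlongrightarrow> 0) (at 0)
    \<longleftrightarrow> ((\<lambda>t. f t /\<^sub>R t - v) \<longlongrightarrow> 0) (at 0)" by (simp only: tendsto_norm_zero_iff)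
  then show ?thesis
    unfolding has_derivative_at LIM_zero_iff by (simp only: bounded_linear_scaleR_left simp_thms)
qed

lemma diffeo_germD:
  assumes "diffeo_germ f g U V"
  shows "open U" "open V" "0 \<in> U" "0 \<in> V" "f 0 = 0" "g 0 = 0" "\<And>k. ck k U f" "\<And>k. ck k V g"
    "\<And>x. x \<in> U \<Longrightarrow> f x \<in> V" "\<And>y. y \<in> V \<Longrightarrow> g y \<in> U"
    "\<And>x. x \<in> U \<Longrightarrow> g (f x) = x" "\<And>y. y \<in> V \<Longrightarrow> f (g y) = y"
proof -
  note d = assms[unfolded diffeo_germ_def smooth_on_def Ck_on_eq_ck]
  show "open U" "open V" "0 \<in> U" "f 0 = 0" "\<And>k. ck k U f" "\<And>k. ck k V g"
    "\<And>x. x \<in> U \<Longrightarrow> g (f x) = x" "\<And>y. y \<in> V \<Longrightarrow> f (g y) = y"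
    using d by blast+
  show "\<And>x. x \<in> U \<Longrightarrow> f x \<in> V" "\<And>y. y \<in> V \<Longrightarrow> g y \<in> U" using d by blast+
  show "0 \<in> V" using d by (metis imageI)
  show "g 0 = 0" using d by metis
qed

lemma ck_all_has_derivative:
  assumes "\<And>k. ck k U f" "x \<in> U"
  obtains f' where "(f has_derivative f') (at x)"
  using ck_SucD(1)[OF assms(1)[of "Suc 0"] assms(2)] by blast

lemma diffeo_germ_derivative_inverse:
  fixes f g :: "real^'n \<Rightarrow> real^'n"
  assumes d: "diffeo_germ f g U V" and f': "(f has_derivative f') (at 0)" and g': "(g has_derivative g') (at 0)"
  shows "g' (f' x) = x" "f' (g' x) = x"
proof -
  note D = diffeo_germD[OF d]
  have "((\<lambda>x. g (f x)) has_derivative (\<lambda>x. g' (f' x))) (at 0)"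
    using has_derivative_compose[of f f' 0 UNIV g g'] f' g' D(5) by simp
  then have "((\<lambda>x. x) has_derivative (\<lambda>x. g' (f' x))) (at 0)"
    by (rule has_derivative_transform_within_open[OF _ D(1,3)]) (simp add: D)
  from has_derivative_unique[OF this has_derivative_ident] show "g' (f' x) = x" by (simp add: fun_eq_iff)
  have "((\<lambda>x. f (g x)) has_derivative (\<lambda>x. f' (g' x))) (at 0)"
    using has_derivative_compose[of g g' 0 UNIV f f'] f' g' D(6) by simp
  then have "((\<lambda>x. x) has_derivative (\<lambda>x. f' (g' x))) (at 0)"
    by (rule has_derivative_transform_within_open[OF _ D(2,4)]) (simp add: D)
  from has_derivative_unique[OF this has_derivative_ident] show "f' (g' x) = x" by (simp add: fun_eq_iff)
qed

lemma line_through_0: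
  fixes L :: "(real^'n) set"
  assumes "is_line L" "0 \<in> L"
  obtains w where "w \<noteq> 0" "L = span {w}"
proof -
  obtain a w where w: "w \<noteq> 0" "L = range (\<lambda>t. a + t *\<^sub>R w)" using assms(1) unfolding is_line_def by blast
  then obtain t0 where "a + t0 *\<^sub>R w = 0" using assms(2) by auto
  then have a: "a = - t0 *\<^sub>R w" by (simp add: add_eq_0_iff2)
  have "L = span {w}"
  proof (intro equalityI subsetI)
    fix x assume "x \<in> L"
    then obtain t where "x = a + t *\<^sub>R w" unfolding w by blast
    then have "x = (t - t0) *\<^sub>R w" unfolding a by (simp add: algebra_simps)
    then show "x \<in> span {w}" unfolding span_singleton by blast
  next
    fix x assume "x \<in> span {w}"
    then obtain t where "x = t *\<^sub>R w" by (auto simp: span_singleton)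
    then have "x = a + (t + t0) *\<^sub>R w" by (simp add: a algebra_simps)
    then show "x \<in> L" unfolding w by blast
  qed
  then show ?thesis using w(1) by (rule that[rotated])
qed

text \<open>A rectifier need not map a whole neighbourhood of \<open>0\<close> in the line \<open>\<real>v\<close> into the circle at
  once; it is enough that the parameters \<open>s\<close> with \<open>\<Phi>(s v)\<close> on the circle accumulate at \<open>0\<close>, which
  the filter \<open>F\<close> expresses.\<close>
lemma rectifier_circ_filter:
  fixes v b :: "real^'n"
  assumes d: "diffeo_germ \<Phi> \<Psi> U V" and D\<Phi>: "(\<Phi> has_derivative id) (at 0)"
    and W: "open W" "0 \<in> W" and L: "is_line L" "\<Psi> ` (circ v b \<inter> W \<inter> V) \<subseteq> L" and "v \<noteq> 0"
  obtains F where "F \<le> at (0::real)" "F \<noteq> bot" "\<forall>\<^sub>F s in F. \<Phi> (s *\<^sub>R v) \<in> circ v b"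
proof -
  note D = diffeo_germD[OF d]
  obtain \<Psi>' where \<Psi>': "(\<Psi> has_derivative \<Psi>') (at 0)" using ck_all_has_derivative[OF D(8) D(4)] by blast
  have "\<Psi>' = id" using diffeo_germ_derivative_inverse(1)[OF d D\<Phi> \<Psi>'] by auto
  with \<Psi>' have D\<Psi>: "(\<Psi> has_derivative id) (at 0)" by simp
  obtain R a where R: "\<And>t::real. t *\<^sub>R v + t\<^sup>2 *\<^sub>R R t \<in> circ v b" "(R \<longlongrightarrow> a) (at 0)"
    using circ_parametrization[of v b] by blast
  define y where "y t = t *\<^sub>R v + t\<^sup>2 *\<^sub>R R t" for t
  have y0: "y 0 = 0" by (simp add: y_def)
  have "((\<lambda>t. v + t *\<^sub>R R t) \<longlongrightarrow> v + 0 *\<^sub>R a) (at 0)" by (intro tendsto_intros R(2))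
  then have quot: "((\<lambda>t. y t /\<^sub>R t) \<longlongrightarrow> v) (at 0)"
    using Lim_transform_eventually[of "\<lambda>t. v + t *\<^sub>R R t" v "at 0" "\<lambda>t. y t /\<^sub>R t"]
    by (simp add: eventually_at_filter y_def scaleR_add_right power2_eq_square)
  have "((\<lambda>t. t *\<^sub>R (v + t *\<^sub>R R t)) \<longlongrightarrow> 0 *\<^sub>R (v + 0 *\<^sub>R a)) (at 0)" by (intro tendsto_intros R(2))
  then have ylim: "(y \<longlongrightarrow> 0) (at 0)"
    by (simp add: y_def[abs_def] scaleR_add_right power2_eq_square)
  have yd: "(y has_derivative (\<lambda>h. h *\<^sub>R v)) (at 0)"
    using quot has_derivative_0_iff_quotient[of y v] y0 by simp
  have "((\<lambda>t. \<Psi> (y t)) has_derivative (\<lambda>h. id (h *\<^sub>R v))) (at 0)"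
    using has_derivative_compose[of y _ 0 UNIV \<Psi> id] yd D\<Psi> y0 by simp
  then have quot\<Psi>: "((\<lambda>t. \<Psi> (y t) /\<^sub>R t) \<longlongrightarrow> v) (at 0)"
    using has_derivative_0_iff_quotient[of "\<lambda>t. \<Psi> (y t)" v] y0 D(6) by simp
  have evU: "\<forall>\<^sub>F t in at 0. y t \<in> W \<inter> V"
    using topological_tendstoD[OF ylim, of "W \<inter> V"] W D(2,4) by blast
  have "0 \<in> L" using L(2) zero_in_circ[of v b] W(2) D(4,6) by (metis IntI image_subset_iff)
  then obtain w where w: "w \<noteq> 0" "L = span {w}" using line_through_0[OF L(1)] by blast
  have evL: "\<forall>\<^sub>F t in at 0. \<Psi> (y t) \<in> span {w}"
    using evU by eventually_elim (use L(2) w(2) R(1) in \<open>auto simp: y_def\<close>)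
  then have "\<forall>\<^sub>F t in at 0. \<Psi> (y t) /\<^sub>R t \<in> span {w}" by eventually_elim (rule span_scale)
  then have "v \<in> span {w}"
    by (rule Lim_in_closed_set[rotated, OF _ _ quot\<Psi>]) (auto simp: closed_subspace)
  then have vw: "span {w} = span {v}" using span_singleton_eq \<open>v \<noteq> 0\<close> by blast
  \<comment> \<open>\<Psi> also has the identity as derivative, so it carries the curve into the
    line spanned by \<open>v\<close>, and \<open>\<sigma>\<close> is the coordinate there. Since
    \<open>\<sigma>\<close> tends to \<open>0\<close> without vanishing, pushing \<open>at 0\<close>
    forward along it yields parameters with \<open>\<Phi> (\<sigma> t v) = y t\<close>.\<close>
  define \<sigma> where "\<sigma> t = (\<Psi> (y t) \<bullet> v) / (v \<bullet> v)" for t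
  have \<sigma>: "\<forall>\<^sub>F t in at 0. \<Psi> (y t) = \<sigma> t *\<^sub>R v"
    using evL unfolding vw by eventually_elim (auto simp: span_singleton \<sigma>_def \<open>v \<noteq> 0\<close>)
  have "((\<lambda>t. \<Psi> (y t)) \<longlongrightarrow> \<Psi> 0) (at 0)"
    using has_derivative_continuous[OF D\<Psi>] ylim by (rule isCont_tendsto_compose)
  then have "(\<sigma> \<longlongrightarrow> (\<Psi> 0 \<bullet> v) / (v \<bullet> v)) (at 0)"
    unfolding \<sigma>_def using \<open>v \<noteq> 0\<close> by (intro tendsto_intros) auto
  then have \<sigma>lim: "(\<sigma> \<longlongrightarrow> 0) (at 0)" using D(6) by simp
  have "\<forall>\<^sub>F t in at 0. \<Psi> (y t) /\<^sub>R t \<noteq> 0"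
    using quot\<Psi> \<open>v \<noteq> 0\<close> by (rule tendsto_imp_eventually_ne)
  with \<sigma> have "\<forall>\<^sub>F t in at 0. \<sigma> t \<noteq> 0" by eventually_elim auto
  with \<sigma>lim have fl: "filterlim \<sigma> (at 0) (at 0)" by (simp add: filterlim_at)
  show ?thesis
  proof (rule that)
    show "filtermap \<sigma> (at 0) \<le> at 0" using fl by (simp add: filterlim_def)
    show "filtermap \<sigma> (at 0) \<noteq> bot" by (simp add: filtermap_bot_iff)
    have "\<forall>\<^sub>F t in at 0. \<Phi> (\<sigma> t *\<^sub>R v) \<in> circ v b"
      using \<sigma> evU by eventually_elim (metis D(12) IntD2 R(1) y_def)
    then show "\<forall>\<^sub>F s in filtermap \<sigma> (at 0). \<Phi> (s *\<^sub>R v) \<in> circ v b" by (simp add: eventually_filtermap)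
  qed
qed

text \<open>Each coefficient that vanishes in the limit allows a division by \<open>s\<close>, which
  exposes the next one; a filter that clusters at \<open>0\<close> is enough for this.\<close>

lemma coeffs_vanish:
  fixes p0 p1 p2 :: real
  assumes F: "F \<le> at (0::real)" "F \<noteq> bot" and P: "(P \<longlongrightarrow> p2) F"
    and ev: "\<forall>\<^sub>F s in F. p0 + s * p1 + s\<^sup>2 * P s = 0"
  shows "p0 = 0" "p1 = 0" "p2 = 0"
proof -
  have s0: "((\<lambda>s. s) \<longlongrightarrow> 0) F" using F(1) tendsto_ident_at[of 0 UNIV] tendsto_mono by blast
  have nz: "\<forall>\<^sub>F s in F. s \<noteq> 0" using F(1) by (rule filter_leD) (simp add: eventually_at_filter)
  have "((\<lambda>s. p0 + s * p1 + s\<^sup>2 * P s) \<longlongrightarrow> p0 + 0 * p1 + 0\<^sup>2 * p2) F" by (intro tendsto_intros s0 P)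
  moreover have "((\<lambda>s. p0 + s * p1 + s\<^sup>2 * P s) \<longlongrightarrow> 0) F" using ev by (rule tendsto_eventually)
  ultimately have "p0 + 0 * p1 + 0\<^sup>2 * p2 = 0" by (rule tendsto_unique[OF F(2)])
  then show p0: "p0 = 0" by simp
  have "\<forall>\<^sub>F s in F. p1 + s * P s = 0"
    using ev nz
  proof eventually_elim
    case (elim s)
    then have "s * (p1 + s * P s) = 0" using p0 by (simp add: algebra_simps power2_eq_square)
    then show ?case using elim by simp
  qed
  note ev1 = this
  have "((\<lambda>s. p1 + s * P s) \<longlongrightarrow> p1 + 0 * p2) F" by (intro tendsto_intros s0 P)
  moreover have "((\<lambda>s. p1 + s * P s) \<longlongrightarrow> 0) F" using ev1 by (rule tendsto_eventually)
  ultimately have "p1 + 0 * p2 = 0" by (rule tendsto_unique[OF F(2)])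
  then show p1: "p1 = 0" by simp
  have "\<forall>\<^sub>F s in F. P s = 0" using ev1 nz by eventually_elim (simp add: p1)
  then have "(P \<longlongrightarrow> 0) F" by (rule tendsto_eventually)
  with P show "p2 = 0" by (rule tendsto_unique[OF F(2)])
qed

abbreviation "T2 \<equiv> tay (Suc (Suc 0))"
abbreviation "T3 \<equiv> tay (Suc (Suc (Suc 0)))"
abbreviation "T4 \<equiv> tay (Suc (Suc (Suc (Suc 0))))"

text \<open>Wedging with \<open>v\<close> kills the multiple of \<open>v\<close> left open by
  membership in \<open>circ v b\<close>. With \<open>\<Phi> (s v) = s X\<close> the condition
  becomes the scalar equation \<open>\<omega> X = s (X \<bullet> X) \<omega> b\<close>; its three
  lowest coefficients vanish, and the first of them eliminates \<open>\<omega> b\<close> from the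
  other two.\<close>

lemma rectifier_expansion:
  fixes v b :: "real^'n"
  assumes U: "open U" "0 \<in> U" "\<And>k. ck k U \<Phi>" and \<Phi>0: "\<Phi> 0 = 0" "(\<Phi> has_derivative id) (at 0)"
    and F: "F \<le> at (0::real)" "F \<noteq> bot" and mem: "\<forall>\<^sub>F s in F. \<Phi> (s *\<^sub>R v) \<in> circ v b"
  shows "T2 \<Phi> v - (v \<bullet> v) *\<^sub>R b \<in> span {v}" (is ?A)
    and "(v \<bullet> v) * (v $ i * T3 \<Phi> v $ j - v $ j * T3 \<Phi> v $ i)
      = 2 * (v \<bullet> T2 \<Phi> v) * (v $ i * T2 \<Phi> v $ j - v $ j * T2 \<Phi> v $ i)" (is ?B)
    and "(v \<bullet> v) * (v $ i * T4 \<Phi> v $ j - v $ j * T4 \<Phi> v $ i)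
      = (2 * (v \<bullet> T3 \<Phi> v) + T2 \<Phi> v \<bullet> T2 \<Phi> v) * (v $ i * T2 \<Phi> v $ j - v $ j * T2 \<Phi> v $ i)" (is ?C)
proof -
  \<comment> \<open>The remainder after order three in units of \<open>s^4\<close>: it tends to
    \<open>T4 \<Phi> v\<close>, so the fourth coefficient enters as a limit.\<close>
  define R where "R s = (\<Phi> (s *\<^sub>R v) - s *\<^sub>R v - s\<^sup>2 *\<^sub>R T2 \<Phi> v - s ^ 3 *\<^sub>R T3 \<Phi> v) /\<^sub>R s ^ 4" for s
  have s0: "((\<lambda>s. s) \<longlongrightarrow> 0) F" using F(1) tendsto_ident_at[of 0 UNIV] tendsto_mono by blast
  have nz: "\<forall>\<^sub>F s in F. s \<noteq> 0" using F(1) by (rule filter_leD) (simp add: eventually_at_filter)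
  have t01: "tay 0 \<Phi> v = 0" "tay (Suc 0) \<Phi> v = v" using \<Phi>0 tay_1[OF \<Phi>0(2)] by simp_all
  have "((\<lambda>s. (\<Phi> (s *\<^sub>R v) - (\<Sum>k\<le>Suc (Suc (Suc (Suc 0))). s ^ k *\<^sub>R tay k \<Phi> v)) /\<^sub>R s ^ Suc (Suc (Suc (Suc 0)))) \<longlongrightarrow> 0) F"
    using taylor_line[OF U(1,2) U(3)] F(1) tendsto_mono by blast
  then have "((\<lambda>s. T4 \<Phi> v + (\<Phi> (s *\<^sub>R v) - (\<Sum>k\<le>Suc (Suc (Suc (Suc 0))). s ^ k *\<^sub>R tay k \<Phi> v)) /\<^sub>R s ^ Suc (Suc (Suc (Suc 0)))) \<longlongrightarrow> T4 \<Phi> v + 0) F"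
    by (intro tendsto_add tendsto_const)
  moreover have "\<forall>\<^sub>F s in F. T4 \<Phi> v + (\<Phi> (s *\<^sub>R v) - (\<Sum>k\<le>Suc (Suc (Suc (Suc 0))). s ^ k *\<^sub>R tay k \<Phi> v)) /\<^sub>R s ^ Suc (Suc (Suc (Suc 0))) = R s"
    using nz
  proof eventually_elim
    case (elim s)
    have "(\<Sum>k\<le>Suc (Suc (Suc (Suc 0))). s ^ k *\<^sub>R tay k \<Phi> v) = s *\<^sub>R v + s\<^sup>2 *\<^sub>R T2 \<Phi> v + s ^ 3 *\<^sub>R T3 \<Phi> v + s ^ 4 *\<^sub>R T4 \<Phi> v"
      unfolding sum.atMost_Suc by (simp add: t01 eval_nat_numeral del: tay.simps)
    then have "\<Phi> (s *\<^sub>R v) - (\<Sum>k\<le>Suc (Suc (Suc (Suc 0))). s ^ k *\<^sub>R tay k \<Phi> v) = s ^ 4 *\<^sub>R R s - s ^ 4 *\<^sub>R T4 \<Phi> v"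
      using elim by (simp add: R_def del: tay.simps)
    moreover have "s ^ Suc (Suc (Suc (Suc 0))) = s ^ 4" by (simp add: eval_nat_numeral)
    ultimately show ?case using elim by (simp only: scaleR_diff_right[symmetric]) simp
  qed
  ultimately have R: "(R \<longlongrightarrow> T4 \<Phi> v) F" using Lim_transform_eventually by force
  have \<Phi>: "\<forall>\<^sub>F s in F. s \<noteq> 0 \<and> \<Phi> (s *\<^sub>R v) = s *\<^sub>R v + s\<^sup>2 *\<^sub>R (T2 \<Phi> v + s *\<^sub>R T3 \<Phi> v + s\<^sup>2 *\<^sub>R R s)"
    using nz
  proof eventually_elim
    case (elim s)
    have "s ^ 4 *\<^sub>R R s = \<Phi> (s *\<^sub>R v) - s *\<^sub>R v - s\<^sup>2 *\<^sub>R T2 \<Phi> v - s ^ 3 *\<^sub>R T3 \<Phi> v"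
      using elim by (simp add: R_def del: tay.simps)
    then have "\<Phi> (s *\<^sub>R v) = s *\<^sub>R v + s\<^sup>2 *\<^sub>R T2 \<Phi> v + s ^ 3 *\<^sub>R T3 \<Phi> v + s ^ 4 *\<^sub>R R s"
      by (simp del: tay.simps)
    also have "s ^ 3 = s\<^sup>2 * s" by (simp add: eval_nat_numeral)
    also have "s ^ 4 = s\<^sup>2 * s\<^sup>2" by (simp add: eval_nat_numeral)
    finally show ?case using elim by (simp only: scaleR_add_right scaleR_scaleR add.assoc simp_thms)
  qed
  show ?A
  proof (rule circ_osculate(2)[OF F])
    show "\<forall>\<^sub>F s in F. s *\<^sub>R v + s\<^sup>2 *\<^sub>R (T2 \<Phi> v + s *\<^sub>R T3 \<Phi> v + s\<^sup>2 *\<^sub>R R s) \<in> circ v b"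
      using \<Phi> mem by eventually_elim metis
    have "((\<lambda>s. T2 \<Phi> v + s *\<^sub>R T3 \<Phi> v + s\<^sup>2 *\<^sub>R R s) \<longlongrightarrow> T2 \<Phi> v + 0 *\<^sub>R T3 \<Phi> v + 0\<^sup>2 *\<^sub>R T4 \<Phi> v) F"
      by (intro tendsto_intros s0 R)
    then show "((\<lambda>s. T2 \<Phi> v + s *\<^sub>R T3 \<Phi> v + s\<^sup>2 *\<^sub>R R s) \<longlongrightarrow> T2 \<Phi> v) F" by simp
  qed
  define \<omega> where "\<omega> y = v $ i * y $ j - v $ j * y $ i" for y :: "real^'n"
  define A B where "A = T2 \<Phi> v" and "B = T3 \<Phi> v"
  have lin: "\<omega> (x + y) = \<omega> x + \<omega> y" "\<omega> (c *\<^sub>R x) = c * \<omega> x" "\<omega> (x - y) = \<omega> x - \<omega> y" for x y c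
    by (simp_all add: \<omega>_def algebra_simps)
  have \<omega>v: "\<omega> v = 0" by (simp add: \<omega>_def)
  have \<omega>s: "\<omega> x = 0" if "x \<in> span {v}" for x
    using that by (auto simp: span_singleton \<omega>_def)
  \<comment> \<open>\<open>s^3 E s\<close> is the part of \<open>X \<bullet> X\<close> beyond order
    two, for \<open>X = v + s A + s^2 B + s^3 R s\<close>.\<close>
  define E where "E s = 2 * (v \<bullet> R s) + 2 * (A \<bullet> B) + s * (B \<bullet> B + 2 * (A \<bullet> R s)) + 2 * s\<^sup>2 * (B \<bullet> R s)
    + s ^ 3 * (R s \<bullet> R s)" for s
  define P where "P s = \<omega> (R s) - (2 * (v \<bullet> B) + A \<bullet> A + s * E s) * \<omega> b" for s
  have "((\<lambda>s. (2 * (v \<bullet> B) + A \<bullet> A + s * E s)) \<longlongrightarrow> 2 * (v \<bullet> B) + A \<bullet> A +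
     0 * (2 * (v \<bullet> T4 \<Phi> v) + 2 * (A \<bullet> B) + 0 * (B \<bullet> B + 2 * (A \<bullet> T4 \<Phi> v)) + 2 * 0\<^sup>2 * (B \<bullet> T4 \<Phi> v)
    + 0 ^ 3 * (T4 \<Phi> v \<bullet> T4 \<Phi> v))) F"
    unfolding E_def by (intro tendsto_intros s0 R)
  then have lim1: "((\<lambda>s. (2 * (v \<bullet> B) + A \<bullet> A + s * E s)) \<longlongrightarrow> 2 * (v \<bullet> B) + A \<bullet> A) F" by simp
  have "((\<lambda>s. \<omega> (R s)) \<longlongrightarrow> \<omega> (T4 \<Phi> v)) F"
    unfolding \<omega>_def by (intro tendsto_intros R)
  then have P: "(P \<longlongrightarrow> \<omega> (T4 \<Phi> v) - (2 * (v \<bullet> B) + A \<bullet> A) * \<omega> b) F"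
    unfolding P_def by (intro tendsto_intros lim1)
  have "\<forall>\<^sub>F s in F. (\<omega> A - (v \<bullet> v) * \<omega> b) + s * (\<omega> B - 2 * (v \<bullet> A) * \<omega> b) + s\<^sup>2 * P s = 0"
    using \<Phi> mem
  proof eventually_elim
    case (elim s)
    define X where "X = v + s *\<^sub>R A + s\<^sup>2 *\<^sub>R B + s ^ 3 *\<^sub>R R s"
    have X: "\<Phi> (s *\<^sub>R v) = s *\<^sub>R X"
      using elim by (simp add: X_def A_def B_def scaleR_add_right eval_nat_numeral mult_ac del: tay.simps)
    have "\<omega> (s *\<^sub>R X - ((s *\<^sub>R X) \<bullet> (s *\<^sub>R X)) *\<^sub>R b) = 0"
      using elim unfolding X circ_def by (blast intro: \<omega>s)
    then have "s * (\<omega> X - s * (X \<bullet> X) * \<omega> b) = 0"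
      by (simp add: lin algebra_simps)
    then have 1: "\<omega> X = s * (X \<bullet> X) * \<omega> b" using elim by simp
    have 2: "\<omega> X = s * (\<omega> A + s * \<omega> B + s\<^sup>2 * \<omega> (R s))"
      by (simp add: X_def lin \<omega>v algebra_simps eval_nat_numeral)
    have 3: "X \<bullet> X = v \<bullet> v + s * (2 * (v \<bullet> A)) + s\<^sup>2 * (2 * (v \<bullet> B) + A \<bullet> A + s * E s)"
      unfolding X_def E_def
      by (simp add: inner_add_left inner_add_right inner_commute[of A v] inner_commute[of B v] inner_commute[of B A]
          inner_commute[of "R s" v] inner_commute[of "R s" A] inner_commute[of "R s" B])
        algebra
    have "\<omega> A + s * \<omega> B + s\<^sup>2 * \<omega> (R s) = (X \<bullet> X) * \<omega> b"
      using 1 2 elim by simp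
    then show ?case unfolding 3 P_def by (simp add: algebra_simps)
  qed
  note cv = coeffs_vanish[OF F P this]
  have b: "(v \<bullet> v) * \<omega> b = \<omega> A" and wB: "\<omega> B = 2 * (v \<bullet> A) * \<omega> b"
    and wC: "\<omega> (T4 \<Phi> v) = (2 * (v \<bullet> B) + A \<bullet> A) * \<omega> b"
    using cv by simp_all
  have "(v \<bullet> v) * \<omega> B = 2 * (v \<bullet> A) * \<omega> A" unfolding wB b[symmetric] by simp
  then show ?B unfolding A_def B_def \<omega>_def .
  have "(v \<bullet> v) * \<omega> (T4 \<Phi> v) = (2 * (v \<bullet> B) + A \<bullet> A) * \<omega> A" unfolding wC b[symmetric] by simp
  then show ?C unfolding A_def B_def \<omega>_def .
qed

section \<open>Necessity of the cone conditions\<close>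

lemma cdot_algebra:
  "cdot x y = cdot y x" "cdot (x + y) z = cdot x z + cdot y z" "cdot z (x + y) = cdot z x + cdot z y"
  "cdot (c *s x) y = c * cdot x y" "cdot x (c *s y) = c * cdot x y" "cdot x (y - z) = cdot x y - cdot x z"
  by (simp_all add: cdot_def sum.distrib distrib_left distrib_right sum_distrib_left mult_ac
      right_diff_distrib sum_subtractf)

lemma cdot_cnj_neq_0:
  assumes "x \<noteq> 0"
  shows "cdot x (\<chi> k. cnj (x $ k)) \<noteq> 0"
proof -
  obtain j where "x $ j \<noteq> 0" using assms by (auto simp: vec_eq_iff)
  then have "0 < (\<Sum>k\<in>UNIV. (cmod (x $ k))\<^sup>2)"
    by (intro sum_pos2[of _ j]) auto
  moreover have "cdot x (\<chi> k. cnj (x $ k)) = complex_of_real (\<Sum>k\<in>UNIV. (cmod (x $ k))\<^sup>2)"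
    unfolding cdot_def of_real_sum by (simp add: complex_norm_square[symmetric] del: of_real_power)
  ultimately show ?thesis by (metis less_irrefl of_real_eq_0_iff)
qed

lemma wedge_zero_imp_multiple:
  fixes x y :: "complex^'n"
  assumes "x \<noteq> 0" "\<And>i j. x $ i * y $ j - x $ j * y $ i = 0"
  obtains c where "y = c *s x"
proof -
  obtain i where i: "x $ i \<noteq> 0" using assms by (auto simp: vec_eq_iff)
  have "y = (y $ i / x $ i) *s x"
    using assms(2)[of i] i by (simp add: vec_eq_iff field_simps)
  then show ?thesis by (rule that)
qed

text \<open>Both identities are first extended to complex arguments. The second one may only be evaluated
  on the cone once \<open>(x, H x) = 0\<close> is known there, and this is the content of the first identity to first
  order along the line \<open>x + t x\<^sup>*\<close> (with \<open>x\<^sup>*\<close> the conjugate of \<open>x\<close>), which leaves the cone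
  transversally at \<open>x\<close>.\<close>
lemma cone_conditions_from_identities:
  fixes g h k :: "real^'n \<Rightarrow> real^'n"
  assumes G: "\<And>i. polypair (\<lambda>v. g v $ i) (\<lambda>z. G z $ i)"
    and H: "\<And>i. polypair (\<lambda>v. h v $ i) (\<lambda>z. H z $ i)"
    and K: "\<And>i. polypair (\<lambda>v. k v $ i) (\<lambda>z. K z $ i)"
    and I1: "\<And>v i j. (v \<bullet> v) * (v $ i * h v $ j - v $ j * h v $ i)
      = 2 * (v \<bullet> g v) * (v $ i * g v $ j - v $ j * g v $ i)"
    and I2: "\<And>v i j. (v \<bullet> v) * (v $ i * k v $ j - v $ j * k v $ i)
      = (2 * (v \<bullet> h v) + g v \<bullet> g v) * (v $ i * g v $ j - v $ j * g v $ i)"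
    and x: "x \<in> asym_cone" and nz: "x \<noteq> 0"
  shows "cdot x (G x) = 0 \<and> cdot (G x) (G x) = 0"
proof -
  have two: "polypair (\<lambda>_. 2) (\<lambda>_. 2)" using polypair.const[of 2] by simp
  have I1': "cdot z z * (z $ i * H z $ j - z $ j * H z $ i)
      = 2 * cdot z (G z) * (z $ i * G z $ j - z $ j * G z $ i)" for z i j
  proof -
    have 1: "polypair (\<lambda>v. (v \<bullet> v) * (v $ i * h v $ j - v $ j * h v $ i))
        (\<lambda>z. cdot z z * (z $ i * H z $ j - z $ j * H z $ i))"
      by (intro polypair.mult polypair_diff polypair_inner polypair.coord H)
    have 2: "polypair (\<lambda>v. 2 * (v \<bullet> g v) * (v $ i * g v $ j - v $ j * g v $ i))
        (\<lambda>z. 2 * cdot z (G z) * (z $ i * G z $ j - z $ j * G z $ i))"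
      by (intro polypair.mult polypair_diff polypair_inner polypair.coord G two)
    show ?thesis by (rule polypair_eq[OF 1 2 I1])
  qed
  have I2': "cdot z z * (z $ i * K z $ j - z $ j * K z $ i)
      = (2 * cdot z (H z) + cdot (G z) (G z)) * (z $ i * G z $ j - z $ j * G z $ i)" for z i j
  proof -
    have 1: "polypair (\<lambda>v. (v \<bullet> v) * (v $ i * k v $ j - v $ j * k v $ i))
        (\<lambda>z. cdot z z * (z $ i * K z $ j - z $ j * K z $ i))"
      by (intro polypair.mult polypair_diff polypair_inner polypair.coord K)
    have 2: "polypair (\<lambda>v. (2 * (v \<bullet> h v) + g v \<bullet> g v) * (v $ i * g v $ j - v $ j * g v $ i))
        (\<lambda>z. (2 * cdot z (H z) + cdot (G z) (G z)) * (z $ i * G z $ j - z $ j * G z $ i))"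
      by (intro polypair.mult polypair.add polypair_diff polypair_inner polypair.coord G H two)
    show ?thesis by (rule polypair_eq[OF 1 2 I2])
  qed
  have xx: "cdot x x = 0" using x by (simp add: asym_cone_def)
  \<comment> \<open>If the wedge vanishes, \<open>G x\<close> is a multiple of \<open>x\<close> and
    both products are multiples of \<open>(x,x) = 0\<close>. Otherwise the factor in front of the
    wedge must vanish, which is how each identity is evaluated at \<open>x\<close>.\<close>
  have step: "cdot x (G x) = 0 \<and> cdot (G x) (G x) = 0"
    if w: "\<And>i j. x $ i * G x $ j - x $ j * G x $ i = 0"
  proof -
    obtain c where "G x = c *s x" using wedge_zero_imp_multiple[OF nz w] by blast
    then show ?thesis by (simp add: cdot_algebra(4,5) xx)
  qed
  have p: "cdot x (G x) = 0"
  proof (rule ccontr)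
    assume np: "cdot x (G x) \<noteq> 0"
    have "x $ i * G x $ j - x $ j * G x $ i = 0" for i j
      using I1'[of x i j] np by (simp add: xx)
    with np show False using step by blast
  qed
  \<comment> \<open>The conjugate of an isotropic vector is isotropic, so
    \<open>(x + t y, x + t y)\<close> is exactly \<open>2 t N\<close> with \<open>N\<close>
    nonzero.\<close>
  define y where "y = (\<chi> k. cnj (x $ k))"
  define N where "N = cdot x y"
  have N: "N \<noteq> 0" unfolding N_def y_def by (rule cdot_cnj_neq_0[OF nz])
  have "cdot y y = cnj (cdot x x)" by (simp add: y_def cdot_def)
  then have yy: "cdot y y = 0" using xx by simp
  have zz: "cdot (x + t *s y) (x + t *s y) = 2 * t * N" for t
    by (simp add: cdot_algebra(2-5) xx yy cdot_algebra(1)[of y x] flip: N_def)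
  have "polypair (\<lambda>v. v \<bullet> g v) (\<lambda>z. cdot z (G z))"
    by (intro polypair_inner polypair.coord G)
  then obtain P where P: "\<And>t. cdot (x + t *s y) (G (x + t *s y)) = poly P t"
    using polypair_line by blast
  have "poly P 0 = 0" using P[of 0] p by simp
  then obtain Q where Q: "P = [:0, 1:] * Q"
    using poly_eq_0_iff_dvd[of P 0] by (auto simp: dvd_def)
  have PQ: "poly P t = t * poly Q t" for t by (simp add: Q)
  \<comment> \<open>At \<open>x\<close> itself the first identity reads \<open>0 = 0\<close>. Along
    the line both sides carry the factor \<open>2 t\<close>; cancelling it between polynomials in
    \<open>t\<close> makes the evaluation at \<open>t = 0\<close> informative.\<close>
  have 1: "N * (x $ i * H x $ j - x $ j * H x $ i) = poly Q 0 * (x $ i * G x $ j - x $ j * G x $ i)" for i j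
  proof -
    have pp: "polypair (\<lambda>v. v $ i * h v $ j - v $ j * h v $ i) (\<lambda>z. z $ i * H z $ j - z $ j * H z $ i)"
      "polypair (\<lambda>v. v $ i * g v $ j - v $ j * g v $ i) (\<lambda>z. z $ i * G z $ j - z $ j * G z $ i)"
      by (intro polypair_diff polypair.mult polypair.coord G H)+
    obtain A where
      A: "\<And>t. (x + t *s y) $ i * H (x + t *s y) $ j - (x + t *s y) $ j * H (x + t *s y) $ i = poly A t"
      using polypair_line[OF pp(1), of x y] by blast
    obtain B where
      B: "\<And>t. (x + t *s y) $ i * G (x + t *s y) $ j - (x + t *s y) $ j * G (x + t *s y) $ i = poly B t"
      using polypair_line[OF pp(2), of x y] by blast
    have "poly ([:0, 2:] * (smult N A - Q * B)) t = 0" for t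
      using I1'[of "x + t *s y" i j] unfolding A B P zz PQ by (simp add: algebra_simps)
    then have "[:0, 2:] * (smult N A - Q * B) = 0" using poly_all_0_iff_0 by blast
    then have "smult N A - Q * B = 0" by (simp only: mult_eq_0_iff) simp
    then have "poly (smult N A - Q * B) 0 = 0" by simp
    then show ?thesis using A[of 0] B[of 0] by simp
  qed
  \<comment> \<open>\<open>N H x\<close> is thus a combination of \<open>G x\<close> and
    \<open>x\<close>, both orthogonal to \<open>x\<close>, whence
    \<open>(x, H x) = 0\<close>.\<close>
  have "x $ i * (N *s H x - poly Q 0 *s G x) $ j - x $ j * (N *s H x - poly Q 0 *s G x) $ i = 0" for i j
    using 1[of i j] by (simp add: algebra_simps)
  then obtain c where "N *s H x - poly Q 0 *s G x = c *s x"
    using wedge_zero_imp_multiple[OF nz, of "N *s H x - poly Q 0 *s G x"] by blast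
  then have "cdot x (N *s H x - poly Q 0 *s G x) = cdot x (c *s x)" by simp
  then have "cdot x (H x) = 0" using N p xx by (simp add: cdot_algebra(5,6))
  then have "cdot (G x) (G x) * (x $ i * G x $ j - x $ j * G x $ i) = 0" for i j
    using I2'[of x i j] by (simp add: xx)
  then have "cdot (G x) (G x) = 0" using step by (metis mult_eq_0_iff)
  with p show ?thesis by simp
qed

lemma complete_bundle_circ:
  assumes "complete_bundle \<S>" "v \<noteq> 0"
  obtains b where "circ v b \<in> \<S>"
  using assms tangent0_imp_circ unfolding complete_bundle_def by metis

text \<open>Completeness puts some \<open>circ v b\<close> into the bundle for every nonzero
  \<open>v\<close>, so the identities hold for all real \<open>v\<close>, as complexification
  requires. The last conclusion is what lets \<open>a\<close> and the bundle determine each other up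
  to radial terms.\<close>

lemma normalized_rectifier_expansion:
  fixes \<S> :: "(real^'n) set set"
  assumes complete: "complete_bundle \<S>" and rect: "normalized_rectifier \<S> \<Phi>"
  obtains a where "quad_taylor \<Phi> a" "quadC a \<in> Vn"
    "\<And>v b. v \<noteq> 0 \<Longrightarrow> circ v b \<in> \<S> \<Longrightarrow> quadR a v - (v \<bullet> v) *\<^sub>R b \<in> span {v}"
proof -
  obtain \<Psi> U V where d: "diffeo_germ \<Phi> \<Psi> U V" and D\<Phi>: "(\<Phi> has_derivative id) (at 0)"
    and lines: "\<And>S. S \<in> \<S> \<Longrightarrow> \<exists>W L. open W \<and> 0 \<in> W \<and> is_line L \<and> \<Psi> ` (S \<inter> W \<inter> V) \<subseteq> L"
    using rect unfolding normalized_rectifier_def by blast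
  note D = diffeo_germD[OF d]
  have filt: "\<exists>F. F \<le> at (0::real) \<and> F \<noteq> bot \<and> (\<forall>\<^sub>F s in F. \<Phi> (s *\<^sub>R v) \<in> circ v b)"
    if "v \<noteq> 0" "circ v b \<in> \<S>" for v b
  proof -
    obtain W L where "open W" "0 \<in> W" "is_line L" "\<Psi> ` (circ v b \<inter> W \<inter> V) \<subseteq> L"
      using lines[OF \<open>circ v b \<in> \<S>\<close>] by blast
    then show ?thesis using rectifier_circ_filter[OF d D\<Phi> _ _ _ _ \<open>v \<noteq> 0\<close>] by metis
  qed
  obtain a where a: "quad_taylor \<Phi> a" "\<And>v. T2 \<Phi> v = quadR a v"
    using quad_taylor_tay[OF D(1,3,7,5) D\<Phi>] by blast
  note expand = rectifier_expansion[OF D(1,3,7,5) D\<Phi>]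
  have osc: "quadR a v - (v \<bullet> v) *\<^sub>R b \<in> span {v}" if "v \<noteq> 0" "circ v b \<in> \<S>" for v b
    using filt[OF that] expand(1) a(2) by metis
  have I1: "(v \<bullet> v) * (v $ i * T3 \<Phi> v $ j - v $ j * T3 \<Phi> v $ i)
      = 2 * (v \<bullet> quadR a v) * (v $ i * quadR a v $ j - v $ j * quadR a v $ i)" for v i j
  proof (cases "v = 0")
    case False
    then show ?thesis using complete_bundle_circ[OF complete False] filt expand(2) a(2) by metis
  qed (simp add: quadR_def)
  have I2: "(v \<bullet> v) * (v $ i * T4 \<Phi> v $ j - v $ j * T4 \<Phi> v $ i)
      = (2 * (v \<bullet> T3 \<Phi> v) + quadR a v \<bullet> quadR a v) * (v $ i * quadR a v $ j - v $ j * quadR a v $ i)" for v i j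
  proof (cases "v = 0")
    case False
    then show ?thesis using complete_bundle_circ[OF complete False] filt expand(3) a(2) by metis
  qed (simp add: quadR_def)
  have "\<forall>i. \<exists>F. polypair (\<lambda>v. T3 \<Phi> v $ i) F" using tay_polypair by blast
  from choice[OF this] obtain H where H: "\<And>i. polypair (\<lambda>v. T3 \<Phi> v $ i) (H i)" by blast
  have "\<forall>i. \<exists>F. polypair (\<lambda>v. T4 \<Phi> v $ i) F" using tay_polypair by blast
  from choice[OF this] obtain K where K: "\<And>i. polypair (\<lambda>v. T4 \<Phi> v $ i) (K i)" by blast
  have "cdot x (quadC a x) = 0 \<and> cdot (quadC a x) (quadC a x) = 0" if x: "x \<in> asym_cone" for x
  proof (cases "x = 0")
    case True
    then show ?thesis by (simp add: quadC_def cdot_def)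
  next
    case False
    show ?thesis
      by (rule cone_conditions_from_identities[OF polypair_quad _ _ I1 I2 x False,
            of "\<lambda>z. \<chi> i. H i z" "\<lambda>z. \<chi> i. K i z"]) (simp_all add: H K del: tay.simps)
  qed
  then have "quadC a \<in> Vn" using a(1) unfolding Vn_def quad_taylor_def by blast
  with a(1) show ?thesis using osc by (rule that)
qed

section \<open>Normalization of a rectifier\<close>

lemma ck_imp_smooth_on: "(\<And>k. ck k U f) \<Longrightarrow> smooth_on U f"
  by (simp add: smooth_on_def Ck_on_eq_ck)

lemma is_line_linear_image:
  fixes h :: "real^'n \<Rightarrow> real^'n"
  assumes "is_line L" "linear h" "inj h"
  shows "is_line (h ` L)"
proof -
  obtain a w where w: "w \<noteq> 0" "L = range (\<lambda>t. a + t *\<^sub>R w)" using assms(1) unfolding is_line_def by blast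
  have "h ` L = range (\<lambda>t. h a + t *\<^sub>R h w)"
    unfolding w image_image using assms(2) by (simp add: linear_add linear_scale)
  moreover have "h w \<noteq> 0" using w(1) assms(2,3) linear_0 by (metis injD)
  ultimately show ?thesis unfolding is_line_def by blast
qed

text \<open>Precomposing the inverse of \<open>f\<close> with the derivative of \<open>f\<close> at
  \<open>0\<close> makes the derivative the identity. On the inverse side this appends a linear
  isomorphism, which preserves lines.\<close>

lemma rectifiable_imp_normalized_rectifier:
  fixes \<S> :: "(real^'n) set set"
  assumes "rectifiable \<S>"
  shows "\<exists>\<Phi>. normalized_rectifier \<S> \<Phi>"
proof -
  obtain f g U V where d: "diffeo_germ f g U V"
    and lines: "\<And>S. S \<in> \<S> \<Longrightarrow> \<exists>W L. open W \<and> 0 \<in> W \<and> is_line L \<and> f ` (S \<inter> W \<inter> U) \<subseteq> L"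
    using assms unfolding rectifiable_def by blast
  note D = diffeo_germD[OF d]
  obtain f' where f': "(f has_derivative f') (at 0)" using ck_all_has_derivative[OF D(7,3)] by blast
  obtain g' where g': "(g has_derivative g') (at 0)" using ck_all_has_derivative[OF D(8,4)] by blast
  note inv = diffeo_germ_derivative_inverse[OF d f' g']
  have lin: "linear f'" "linear g'" "bounded_linear f'" "bounded_linear g'"
    using f' g' has_derivative_linear has_derivative_bounded_linear by blast+
  define \<Phi> \<Psi> where "\<Phi> x = g (f' x)" and "\<Psi> y = g' (f y)" for x y
  define U1 where "U1 = f' -` V"
  have "open U1" unfolding U1_def
    using D(2) lin(3) by (intro open_vimage linear_continuous_on) auto
  have "diffeo_germ \<Phi> \<Psi> U1 U"
    unfolding diffeo_germ_def
  proof (intro conjI)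
    show "open U1" "open U" by fact+
    show "0 \<in> U1" "\<Phi> 0 = 0" using D(4,6) lin(1) by (simp_all add: U1_def \<Phi>_def linear_0)
    show "\<forall>x\<in>U1. \<Psi> (\<Phi> x) = x" by (simp add: \<Phi>_def \<Psi>_def U1_def D inv)
    show "\<forall>y\<in>U. \<Phi> (\<Psi> y) = y" by (simp add: \<Phi>_def \<Psi>_def D inv)
    have 1: "\<Phi> x \<in> U" if "x \<in> U1" for x using that by (simp add: \<Phi>_def U1_def D)
    have 2: "\<Psi> y \<in> U1" if "y \<in> U" for y using that by (simp add: \<Psi>_def U1_def D inv)
    show "\<Phi> ` U1 = U" using 1 2 \<open>\<forall>y\<in>U. \<Phi> (\<Psi> y) = y\<close> by (metis image_eqI image_subsetI subsetI subset_antisym)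
    show "\<Psi> ` U = U1" using 1 2 \<open>\<forall>x\<in>U1. \<Psi> (\<Phi> x) = x\<close> by (metis image_eqI image_subsetI subsetI subset_antisym)
    show "smooth_on U1 \<Phi>"
      unfolding \<Phi>_def[abs_def]
      by (intro ck_imp_smooth_on ck_compose[OF \<open>open U1\<close> D(2) _ ck_bounded_linear[OF \<open>open U1\<close> lin(3)] D(8)])
        (auto simp: U1_def)
    show "smooth_on U \<Psi>"
      unfolding \<Psi>_def[abs_def] by (rule ck_imp_smooth_on, rule ck_linear_compose[OF D(1) lin(4) D(7)])
  qed
  moreover have "(\<Phi> has_derivative id) (at 0)"
  proof -
    have "((\<lambda>x. g (f' x)) has_derivative (\<lambda>x. g' (f' x))) (at 0)"
      using has_derivative_compose[of f' f' 0 UNIV g g'] lin g' by (simp add: bounded_linear_imp_has_derivative linear_0)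
    then show ?thesis by (simp add: \<Phi>_def[abs_def] inv id_def)
  qed
  moreover have "\<exists>W L. open W \<and> 0 \<in> W \<and> is_line L \<and> \<Psi> ` (S \<inter> W \<inter> U) \<subseteq> L" if S: "S \<in> \<S>" for S
  proof -
    obtain W L where W: "open W" "0 \<in> W" "is_line L" "f ` (S \<inter> W \<inter> U) \<subseteq> L" using lines[OF S] by blast
    have "inj g'" using inv(2) by (metis injI)
    then have "is_line (g' ` L)" using W(3) lin(2) is_line_linear_image by blast
    moreover have "\<Psi> ` (S \<inter> W \<inter> U) \<subseteq> g' ` L" using W(4) by (auto simp: \<Psi>_def)
    ultimately show ?thesis using W(1,2) by blast
  qed
  ultimately show ?thesis unfolding normalized_rectifier_def by blast
qed

section \<open>Construction of bundles\<close>

text \<open>The inverse function theorem supplies a differentiable inverse on smaller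
  neighbourhoods; \<open>ck_inverse_function\<close> raises its regularity to all orders.\<close>

lemma smooth_local_inverse:
  fixes f :: "real^'n \<Rightarrow> real^'n"
  assumes "open U" "0 \<in> U" and f: "\<And>k. ck k U f" "f 0 = 0" "(f has_derivative id) (at 0)"
  obtains g U' V where "diffeo_germ f g U' V" "U' \<subseteq> U"
proof -
  define f' where "f' x = Blinfun (frechet_derivative f (at x))" for x
  have fD: "(f has_derivative frechet_derivative f (at x)) (at x)" if "x \<in> U" for x
    using that by (rule ck_SucD(1)[OF f(1)])
  have f': "blinfun_apply (f' x) = frechet_derivative f (at x)" if "x \<in> U" for x
    unfolding f'_def by (rule bounded_linear_Blinfun_apply) (use fD[OF that] has_derivative_bounded_linear in blast)
  have "f' 0 = id_blinfun"
    using f'[OF assms(2)] frechet_derivative_at[OF f(3)] by (intro blinfun_eqI) (simp flip: id_def)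
  then have inv: "id_blinfun o\<^sub>L f' 0 = id_blinfun" by (intro blinfun_eqI) simp
  have cont: "continuous_on U f'"
  proof (rule continuous_on_blinfun_componentwise)
    fix i :: "real^'n" assume i: "i \<in> Basis"
    have "continuous_on U (\<lambda>x. frechet_derivative f (at x) i)"
      using ck_SucD(2)[OF f(1) i, of 0] by simp
    then show "continuous_on U (\<lambda>x. blinfun_apply (f' x) i)"
      by (rule continuous_on_eq) (simp add: f')
  qed
  have der: "(f has_derivative blinfun_apply (f' x)) (at x)" if "x \<in> U" for x
    using fD[OF that] f'[OF that] by simp
  obtain U' V g g' where g: "open U'" "U' \<subseteq> U" "0 \<in> U'" "open V" "f 0 \<in> V" "homeomorphism U' V f g"
    "\<And>y. y \<in> V \<Longrightarrow> (g has_derivative (g' y)) (at y)"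
    "\<And>y. y \<in> V \<Longrightarrow> g' y = Hilbert_Choice.inv (blinfun_apply (f' (g y)))"
    "\<And>y. y \<in> V \<Longrightarrow> bij (blinfun_apply (f' (g y)))"
    by (rule inverse_function_theorem[OF assms(1) der cont assms(2) inv], assumption, rule that)
  have h: "f ` U' = V" "g ` V = U'" "\<And>x. x \<in> U' \<Longrightarrow> g (f x) = x" "\<And>y. y \<in> V \<Longrightarrow> f (g y) = y"
    using g(6) by (auto simp: homeomorphism_def)
  have "ck k V g" for k
  proof (rule ck_inverse_function[OF assms(1) g(4) _ f(1), where f'="\<lambda>x. blinfun_apply (f' x)" and g'=g'])
    show "g ` V \<subseteq> U" using h g by blast
    show "f' (g y) (g' y z) = z" if "y \<in> V" for y z
      using g(8,9)[OF that] by (simp add: bij_is_surj surj_f_inv_f)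
    show "inj (f' (g y))" if "y \<in> V" for y using g(9)[OF that] by (rule bij_is_inj)
  qed (use der g(7) in auto)
  moreover have "ck k U' f" for k using f(1) g(2) by (rule ck_subset)
  ultimately have "diffeo_germ f g U' V"
    unfolding diffeo_germ_def using g h f(2) by (auto intro: ck_imp_smooth_on)
  then show ?thesis using g(2) by (rule that)
qed

lemma diffeo_germ_sym: "diffeo_germ f g U V \<Longrightarrow> diffeo_germ g f V U"
  using diffeo_germD(4,6)[of f g U V] unfolding diffeo_germ_def by blast

text \<open>On an axis, away from \<open>0\<close>, \<open>g\<close> is a constant times
  \<open>t^(k-2)\<close> with positive exponent, and continuity decides the value at
  \<open>0\<close>. This normalizes the denominator of the rectifier to \<open>1\<close> at
  \<open>0\<close>.\<close>

lemma quotient_vanishes_at_0: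
  fixes f g :: "real^'n \<Rightarrow> real"
  assumes "polypair g G" "\<And>x. f x = (x \<bullet> x) * g x" "\<And>t x. f (t *\<^sub>R x) = t ^ k * f x" "k \<ge> 3"
  shows "g 0 = 0"
proof -
  fix i :: 'n
  define e where "e = axis i (1::real)"
  have ee: "e \<bullet> e = 1" by (simp add: e_def inner_axis_axis)
  have "continuous_on UNIV g" using polypair_ck[OF assms(1)] by (rule ck_continuous_on)
  then have "continuous_on UNIV (\<lambda>t. g (t *\<^sub>R e))"
    by (rule continuous_on_compose2) (auto intro!: continuous_intros)
  then have "\<forall>s. ((\<lambda>t. g (t *\<^sub>R e)) \<longlongrightarrow> g (s *\<^sub>R e)) (at s)" by (simp add: continuous_on_def)
  then have "((\<lambda>t. g (t *\<^sub>R e)) \<longlongrightarrow> g (0 *\<^sub>R e)) (at 0)" by blast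
  moreover have "g (t *\<^sub>R e) = t ^ (k - 2) * f e" if "t \<noteq> 0" for t
  proof -
    have "t\<^sup>2 * g (t *\<^sub>R e) = t ^ k * f e"
      using assms(2)[of "t *\<^sub>R e"] assms(3)[of t e] ee by (simp add: power2_eq_square)
    also have "t ^ k = t\<^sup>2 * t ^ (k - 2)" 
    proof -
      have "k = 2 + (k - 2)" using assms(4) by simp
      then show ?thesis by (metis power_add)
    qed
    finally show ?thesis using that by simp
  qed
  then have "\<forall>\<^sub>F t in at 0. g (t *\<^sub>R e) = t ^ (k - 2) * f e" by (simp add: eventually_at_filter)
  ultimately have "((\<lambda>t. t ^ (k - 2) * f e) \<longlongrightarrow> g (0 *\<^sub>R e)) (at 0)"
    by (rule Lim_transform_eventually)
  moreover have "((\<lambda>t. t ^ (k - 2) * f e) \<longlongrightarrow> 0 ^ (k - 2) * f e) (at 0)" by (intro tendsto_intros)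
  ultimately have "g (0 *\<^sub>R e) = 0 ^ (k - 2) * f e" using tendsto_unique trivial_limit_at by blast
  then show ?thesis using assms(4) by simp
qed

text \<open>The square of \<open>|x + \<Gamma>(x)|\<close> is \<open>|x|\<^sup>2 D(x)\<close> with a polynomial \<open>D\<close>; this makes the rectifier
  \<open>(x + \<Gamma>(x)) / D(x)\<close>, the inversion of \<open>(x + \<Gamma>(x)) / |x|\<^sup>2\<close>, smooth at \<open>0\<close>.\<close>
lemma Vn_denominator:
  fixes a :: "'n::finite \<Rightarrow> 'n \<Rightarrow> 'n \<Rightarrow> real"
  assumes "quadC a \<in> Vn"
  obtains D where "\<And>k. ck k UNIV D" "D 0 = (1::real)"
    "\<And>x. (x + quadR a x) \<bullet> (x + quadR a x) = (x \<bullet> x) * D x"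
proof -
  have cone: "cdot z (quadC a z) = 0" "cdot (quadC a z) (quadC a z) = 0" if "z \<in> asym_cone" for z
    using assms that unfolding Vn_def by blast+
  have p1: "polypair (\<lambda>x. x \<bullet> quadR a x) (\<lambda>z. cdot z (quadC a z))"
    by (intro polypair_inner polypair.coord polypair_quad)
  have p2: "polypair (\<lambda>x. quadR a x \<bullet> quadR a x) (\<lambda>z. cdot (quadC a z) (quadC a z))"
    by (intro polypair_inner polypair_quad)
  have h1: "(t *\<^sub>R x) \<bullet> quadR a (t *\<^sub>R x) = t ^ 3 * (x \<bullet> quadR a x)" for t x
    by (simp add: quadR_scale eval_nat_numeral)
  have h2: "quadR a (t *\<^sub>R x) \<bullet> quadR a (t *\<^sub>R x) = t ^ 4 * (quadR a x \<bullet> quadR a x)" for t x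
    by (simp add: quadR_scale eval_nat_numeral)
  obtain l L where l: "polypair l L" "\<And>x. x \<bullet> quadR a x = (x \<bullet> x) * l x"
    using polypair_cone_dvd[OF p1 cone(1) h1] by auto
  obtain q Q where q: "polypair q Q" "\<And>x. quadR a x \<bullet> quadR a x = (x \<bullet> x) * q x"
    using polypair_cone_dvd[OF p2 cone(2) h2] by auto
  have "polypair (\<lambda>x. 1 + 2 * l x + q x) (\<lambda>z. complex_of_real 1 + complex_of_real 2 * L z + Q z)"
    by (intro polypair.add polypair.mult polypair.const l q)
  then have "ck k UNIV (\<lambda>x. 1 + 2 * l x + q x)" for k by (rule polypair_ck)
  moreover have "1 + 2 * l 0 + q 0 = 1"
    using quotient_vanishes_at_0[OF l h1] quotient_vanishes_at_0[OF q h2] by simp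
  moreover have "(x + quadR a x) \<bullet> (x + quadR a x) = (x \<bullet> x) * (1 + 2 * l x + q x)" for x
  proof -
    have "(x + quadR a x) \<bullet> (x + quadR a x) = x \<bullet> x + 2 * (x \<bullet> quadR a x) + quadR a x \<bullet> quadR a x"
      by (simp add: inner_add_left inner_add_right inner_commute)
    then show ?thesis unfolding l(2) q(2) by (simp add: algebra_simps)
  qed
  ultimately show ?thesis by (rule that)
qed

section \<open>Osculating bundles and their rectifiers\<close>

lemma quadR_0: "quadR a 0 = 0"
  by (simp add: quadR_def vec_eq_iff)

lemma ck_quadR: "ck k UNIV (quadR a)"
  by (rule ck_componentwise[OF open_UNIV polypair_ck[OF polypair_quad]])

text \<open>A quadratic map is even, so its derivative at \<open>0\<close> is even as well as
  linear.\<close>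

lemma quadR_has_derivative_0: "(quadR a has_derivative (\<lambda>_. 0)) (at 0)"
proof -
  obtain G where G: "(quadR a has_derivative G) (at 0)"
    using ck_all_has_derivative[OF ck_quadR UNIV_I] by blast
  have "((\<lambda>x. quadR a (- x)) has_derivative (\<lambda>h. G (- h))) (at 0)"
    using has_derivative_compose[of uminus uminus 0 UNIV "quadR a" G] G by (simp add: has_derivative_minus)
  moreover have "quadR a (- x) = quadR a x" for x using quadR_scale[of a "-1" x] by simp
  ultimately have "(\<lambda>h. G (- h)) = G" using has_derivative_unique G by (metis (no_types, lifting) ext)
  then have "G (- h) = G h" for h by metis
  moreover have "G (- h) = - G h" for h using has_derivative_linear[OF G] by (rule linear_neg)
  ultimately have "2 *\<^sub>R G h = 0" for h by (metis add.right_inverse scaleR_2)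
  then have "G h = 0" for h by simp
  then show ?thesis using G by (metis (no_types, lifting) ext)
qed

text \<open>The circle in second order contact with the curve \<open>t v + t^2 quadR a v\<close>.
  Dividing by \<open>v \<bullet> v\<close> makes the offset homogeneous of degree zero, so that only
  the line of \<open>v\<close> matters.\<close>

definition osculating_circle :: "('n \<Rightarrow> 'n \<Rightarrow> 'n \<Rightarrow> real) \<Rightarrow> real^'n::finite \<Rightarrow> (real^'n) set" where
  "osculating_circle a v = circ v ((1 / (v \<bullet> v)) *\<^sub>R quadR a v)"

lemma osculating_circle_eqI:
  assumes "v \<noteq> 0" "quadR a v - (v \<bullet> v) *\<^sub>R b \<in> span {v}"
  shows "circ v b = osculating_circle a v"
  unfolding osculating_circle_def
proof (rule circ_cong[symmetric])
  have "(1 / (v \<bullet> v)) *\<^sub>R quadR a v - b = (1 / (v \<bullet> v)) *\<^sub>R (quadR a v - (v \<bullet> v) *\<^sub>R b)"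
    using assms(1) by (simp add: scaleR_diff_right)
  then show "(1 / (v \<bullet> v)) *\<^sub>R quadR a v - b \<in> span {v}" using assms(2) span_scale by metis
qed

lemma osculating_circle_scale:
  assumes "k \<noteq> 0" shows "osculating_circle a (k *\<^sub>R v) = osculating_circle a v"
  unfolding osculating_circle_def circ_scale[OF assms] quadR_scale
  using assms by (simp add: power2_eq_square)

definition osculating_bundle :: "('n \<Rightarrow> 'n \<Rightarrow> 'n \<Rightarrow> real) \<Rightarrow> (real^'n::finite) set set" where
  "osculating_bundle a = osculating_circle a ` {v. v \<noteq> 0}"

lemma osculating_bundle_tangent:
  assumes "S \<in> osculating_bundle a" "tangent0 S v"
  shows "S = osculating_circle a v"
proof -
  obtain w where w: "w \<noteq> 0" "S = osculating_circle a w" using assms(1) unfolding osculating_bundle_def by blast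
  obtain b where "S = circ v b" using assms(2) by (rule tangent0_imp_circ)
  then have "w \<in> span {v}" using w(2) circ_eqD unfolding osculating_circle_def by blast
  then obtain k where "w = k *\<^sub>R v" by (auto simp: span_singleton)
  with w show ?thesis by (metis osculating_circle_scale scaleR_zero_left)
qed

lemma osculating_bundle_simple_complete:
  fixes a :: "'n::finite \<Rightarrow> 'n \<Rightarrow> 'n \<Rightarrow> real"
  shows "simple_bundle (osculating_bundle a)" "complete_bundle (osculating_bundle a)"
proof -
  show "simple_bundle (osculating_bundle a)"
    unfolding simple_bundle_def
  proof (intro conjI ballI impI)
    fix S assume "S \<in> osculating_bundle a"
    then show "is_circle S" "0 \<in> S"
      unfolding osculating_bundle_def osculating_circle_def using circ_is_circle(2) zero_in_circ by blast+
  next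
    fix S T assume "S \<in> osculating_bundle a" "T \<in> osculating_bundle a" "S \<noteq> T"
    then show "\<nexists>v. v \<noteq> 0 \<and> tangent0 S v \<and> tangent0 T v"
      using osculating_bundle_tangent by metis
  qed
  show "complete_bundle (osculating_bundle a)"
    unfolding complete_bundle_def
  proof (intro allI impI)
    fix v :: "real^'n" assume v: "v \<noteq> 0"
    show "\<exists>!S. S \<in> osculating_bundle a \<and> tangent0 S v"
    proof (rule ex1I)
      show "osculating_circle a v \<in> osculating_bundle a \<and> tangent0 (osculating_circle a v) v"
        using v circ_is_circle(1) unfolding osculating_bundle_def osculating_circle_def by blast
    qed (use osculating_bundle_tangent in blast)
  qed
qed

lemma osculating_bundle_rectifiable:
  fixes a :: "'n::finite \<Rightarrow> 'n \<Rightarrow> 'n \<Rightarrow> real"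
  assumes "quadC a \<in> Vn"
  shows "rectifiable (osculating_bundle a)"
proof -
  obtain D where D: "\<And>k. ck k UNIV D" "D 0 = (1::real)"
    "\<And>x. (x + quadR a x) \<bullet> (x + quadR a x) = (x \<bullet> x) * D x"
    using Vn_denominator[OF assms] by blast
  define U where "U = {x. D x \<noteq> 0}"
  define \<Phi> where "\<Phi> x = inverse (D x) *\<^sub>R (x + quadR a x)" for x
  have "continuous_on UNIV D" using D(1) by (rule ck_continuous_on)
  then have U: "open U" unfolding U_def by (intro open_Collect_neq continuous_on_const)
  have U0: "0 \<in> U" by (simp add: U_def D(2))
  have DU: "ck k U D" and qU: "ck k U (quadR a)" for k
    using ck_subset[OF D(1)] ck_subset[OF ck_quadR] by blast+
  have idU: "ck k U (\<lambda>x. x)" for k by (rule ck_bounded_linear[OF U bounded_linear_ident])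
  have Dinv: "ck k U (\<lambda>x. inverse (D x))" for k
    by (rule ck_inverse[OF U _ DU]) (simp add: U_def)
  have \<Phi>ck: "ck k U \<Phi>" for k
    unfolding \<Phi>_def[abs_def] by (rule ck_scaleR[OF U Dinv ck_add[OF U idU qU]])
  obtain E where E: "((\<lambda>x. inverse (D x)) has_derivative E) (at 0)"
    using ck_all_has_derivative[OF Dinv U0] by blast
  have "((\<lambda>x. x + quadR a x) has_derivative (\<lambda>h. h + 0)) (at 0)"
    by (intro has_derivative_add has_derivative_ident quadR_has_derivative_0)
  from has_derivative_scaleR[OF E this]
  have \<Phi>': "(\<Phi> has_derivative id) (at 0)"
    by (simp add: \<Phi>_def[abs_def] D(2) quadR_0 id_def)
  obtain \<Psi> U' V where \<Psi>: "diffeo_germ \<Phi> \<Psi> U' V" "U' \<subseteq> U"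
    using smooth_local_inverse[OF U U0 \<Phi>ck _ \<Phi>'] by (auto simp: \<Phi>_def quadR_0)
  note G = diffeo_germD[OF \<Psi>(1)]
  obtain \<delta> where \<delta>: "\<delta> > 0" "ball 0 \<delta> \<subseteq> U'" using G(1,3) open_contains_ball by blast
  have "\<exists>W L. open W \<and> 0 \<in> W \<and> is_line L \<and> \<Psi> ` (S \<inter> W \<inter> V) \<subseteq> L" if S: "S \<in> osculating_bundle a" for S
  proof -
    obtain v where v: "v \<noteq> 0" "S = osculating_circle a v" using S unfolding osculating_bundle_def by blast
    define n b where "n = v \<bullet> v" and "b = (1 / n) *\<^sub>R quadR a v"
    have n: "n > 0" using v(1) by (simp add: n_def)
    have Sb: "S = circ v b" unfolding v(2) osculating_circle_def b_def n_def ..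
    \<comment> \<open>The second bound keeps \<open>N b\<close> within half the length of
      \<open>y\<close>, so \<open>\<sigma> v\<close> has at least the other half and the preimage
      \<open>x\<close> found below has norm at most \<open>2 norm y\<close>. The first bound then
      places \<open>x\<close> in \<open>U'\<close>, where \<open>\<Psi>\<close> inverts
      \<open>\<Phi>\<close>.\<close>
    define \<epsilon> where "\<epsilon> = min (\<delta> / 2) (1 / (2 * (norm b + 1)))"
    have \<epsilon>: "\<epsilon> > 0" using \<delta>(1) by (simp add: \<epsilon>_def add_nonneg_pos)
    have "\<Psi> y \<in> span {v}" if y: "y \<in> S" "norm y < \<epsilon>" for y
    proof (cases "y = 0")
      case True
      then show ?thesis using G(6) by (simp add: span_zero)
    next
      case False
      define N where "N = y \<bullet> y"
      have N: "N > 0" "N = norm y * norm y" using False by (simp_all add: N_def dot_square_norm power2_eq_square)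
      obtain \<sigma> where \<sigma>: "y - N *\<^sub>R b = \<sigma> *\<^sub>R v"
        using y(1) unfolding Sb circ_def N_def by (auto simp: span_singleton)
      have "norm y * norm b \<le> 1 / (2 * (norm b + 1)) * (norm b + 1)"
        using y(2) by (intro mult_mono) (auto simp: \<epsilon>_def)
      also have "\<dots> = 1 / 2" using add_nonneg_pos[of "norm b" 1] by simp
      finally have "norm y * (norm y * norm b) \<le> norm y * (1 / 2)" by (intro mult_left_mono) auto
      moreover have "norm y \<le> norm (\<sigma> *\<^sub>R v) + norm (N *\<^sub>R b)"
        using norm_triangle_ineq[of "\<sigma> *\<^sub>R v" "N *\<^sub>R b"] \<sigma> by (metis diff_add_cancel)
      ultimately have s: "norm y / 2 \<le> \<bar>\<sigma>\<bar> * norm v" using N by simp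
      then have "\<sigma> \<noteq> 0" using False by auto
      \<comment> \<open>Chosen so that \<open>t v + t^2 n b\<close> is proportional to
        \<open>y = \<sigma> v + N b\<close>, that is
        \<open>t : t^2 n = \<sigma> : N\<close>.\<close>
      define t where "t = N / (\<sigma> * n)"
      have t: "t \<noteq> 0" "t * \<sigma> * n = N" using N(1) n \<open>\<sigma> \<noteq> 0\<close> by (simp_all add: t_def)
      define x where "x = t *\<^sub>R v"
      have "norm x * (norm y / 2) \<le> norm x * (\<bar>\<sigma>\<bar> * norm v)" using s by (intro mult_left_mono) auto
      also have "\<dots> = \<bar>t * \<sigma> * n\<bar>"
        by (simp add: x_def abs_mult n_def dot_square_norm power2_eq_square)
      also have "\<dots> = norm y * norm y" using t(2) N by simp
      finally have "norm x \<le> 2 * norm y" using False by simp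
      then have "norm x < \<delta>" using y(2) by (simp add: \<epsilon>_def)
      then have x: "x \<in> U'" using \<delta>(2) by (auto simp: subset_eq)
      have xx: "x \<bullet> x = t\<^sup>2 * n" by (simp add: x_def n_def power2_eq_square)
      have "x + quadR a x = t *\<^sub>R v + (t\<^sup>2 * n) *\<^sub>R b"
        using n by (simp add: x_def quadR_scale b_def)
      also have "\<dots> = (t\<^sup>2 * n / N) *\<^sub>R (\<sigma> *\<^sub>R v + N *\<^sub>R b)"
      proof -
        have "t\<^sup>2 * n / N * \<sigma> = t" using t N(1) by (simp add: power2_eq_square field_simps)
        then show ?thesis using N(1) by (simp add: scaleR_add_right)
      qed
      also have "\<sigma> *\<^sub>R v + N *\<^sub>R b = y" using \<sigma> by (metis diff_add_cancel)
      finally have eq: "x + quadR a x = (t\<^sup>2 * n / N) *\<^sub>R y" .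
      \<comment> \<open>Comparing squared lengths identifies the factor in \<open>eq\<close> with
        \<open>D x\<close>, which the denominator of \<open>\<Phi>\<close> removes.\<close>
      have "(c *\<^sub>R y) \<bullet> (c *\<^sub>R y) = c * c * N" for c by (simp add: N_def)
      then have "t\<^sup>2 * n * D x = (t\<^sup>2 * n / N) * (t\<^sup>2 * n / N) * N"
        using D(3)[of x] unfolding eq xx by metis
      also have "\<dots> = t\<^sup>2 * n * (t\<^sup>2 * n / N)" using N(1) by simp
      finally have "t\<^sup>2 * n * D x = t\<^sup>2 * n * (t\<^sup>2 * n / N)" .
      moreover have "t\<^sup>2 * n \<noteq> 0" using t(1) n by simp
      ultimately have "D x = t\<^sup>2 * n / N" by (metis mult_left_cancel)
      then have "\<Phi> x = y" unfolding \<Phi>_def eq using t(1) n N(1) by simp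
      then have "\<Psi> y = x" using G(11)[OF x] by simp
      then show ?thesis by (auto simp: x_def span_singleton)
    qed
    then have "\<Psi> ` (S \<inter> ball 0 \<epsilon> \<inter> V) \<subseteq> span {v}" by (auto simp: dist_norm)
    moreover have "is_line (span {v})"
      unfolding is_line_def span_singleton using v(1) by (intro exI[of _ 0] exI[of _ v]) simp
    ultimately show ?thesis using \<epsilon> by (intro exI[of _ "ball 0 \<epsilon>"] exI[of _ "span {v}"]) auto
  qed
  then show ?thesis unfolding rectifiable_def using diffeo_germ_sym[OF \<Psi>(1)] by blast
qed

section \<open>The correspondence with classes modulo W_n\<close>

lemma equiv_Vrel: "equiv Vn (Vrel :: ((complex^'n::finite \<Rightarrow> complex^'n) \<times> _) set)"
proof -
  have zero: "(\<lambda>_. 0 :: complex^'n) \<in> Wn"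
    unfolding Wn_def by (intro CollectI exI[of _ 0]) (simp add: fun_eq_iff vec_eq_iff)
  have diff: "\<Gamma> - \<Delta> \<in> Wn" if W: "\<Gamma> \<in> Wn" "\<Delta> \<in> Wn" for \<Gamma> \<Delta> :: "complex^'n \<Rightarrow> complex^'n"
  proof -
    obtain l where l: "\<Gamma> = (\<lambda>x. \<chi> k. (\<Sum>i\<in>UNIV. complex_of_real (l $ i) * x $ i) * x $ k)"
      using W(1) unfolding Wn_def by blast
    obtain m where m: "\<Delta> = (\<lambda>x. \<chi> k. (\<Sum>i\<in>UNIV. complex_of_real (m $ i) * x $ i) * x $ k)"
      using W(2) unfolding Wn_def by blast
    show ?thesis unfolding Wn_def l m
      by (intro CollectI exI[of _ "l - m"])
        (simp add: fun_eq_iff vec_eq_iff left_diff_distrib sum_subtractf)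
  qed
  have neg: "\<Delta> - \<Gamma> \<in> Wn" if "\<Gamma> - \<Delta> \<in> Wn" for \<Gamma> \<Delta> :: "complex^'n \<Rightarrow> complex^'n"
    using diff[OF zero that] by (simp add: fun_diff_def)
  have add: "\<Gamma> - \<Theta> \<in> Wn" if "\<Gamma> - \<Delta> \<in> Wn" "\<Delta> - \<Theta> \<in> Wn" for \<Gamma> \<Delta> \<Theta> :: "complex^'n \<Rightarrow> complex^'n"
    using diff[OF that(1) neg[OF that(2)]] by (simp add: fun_diff_def)
  show ?thesis
  proof (rule equivI)
    show "Vrel \<subseteq> Vn \<times> (Vn :: (complex^'n \<Rightarrow> complex^'n) set)" unfolding Vrel_def by blast
    show "refl_on Vn (Vrel :: ((complex^'n \<Rightarrow> complex^'n) \<times> _) set)"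
      unfolding refl_on_def Vrel_def using zero by (simp add: fun_diff_def)
    show "sym (Vrel :: ((complex^'n \<Rightarrow> complex^'n) \<times> _) set)" unfolding sym_def Vrel_def using neg by blast
    show "trans (Vrel :: ((complex^'n \<Rightarrow> complex^'n) \<times> _) set)" unfolding trans_def Vrel_def using add by blast
  qed
qed

text \<open>The quadratic part of the chosen rectifier both represents the class and reconstructs
  the bundle, so bijectivity becomes a question about coefficients.\<close>

lemma bundle_class_coefficients:
  fixes \<S> :: "(real^'n::finite) set set"
  assumes "\<S> \<in> complete_rectifiable_bundles"
  obtains a where "sym_coeffs a" "quadC a \<in> Vn" "bundle_class \<S> = Vrel `` {quadC a}"
    "\<S> = osculating_bundle a"
proof -
  have S: "simple_bundle \<S>" "complete_bundle \<S>" "rectifiable \<S>"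
    using assms by (auto simp: complete_rectifiable_bundles_def)
  define \<Phi> where "\<Phi> = (SOME \<Phi>. normalized_rectifier \<S> \<Phi>)"
  have "normalized_rectifier \<S> \<Phi>"
    unfolding \<Phi>_def using rectifiable_imp_normalized_rectifier[OF S(3)] by (rule someI_ex)
  then obtain a where a: "quad_taylor \<Phi> a" "quadC a \<in> Vn"
    "\<And>v b. v \<noteq> 0 \<Longrightarrow> circ v b \<in> \<S> \<Longrightarrow> quadR a v - (v \<bullet> v) *\<^sub>R b \<in> span {v}"
    using normalized_rectifier_expansion[OF S(2)] by blast
  have "\<S> = osculating_bundle a"
  proof (intro equalityI subsetI)
    fix T assume T: "T \<in> \<S>"
    then obtain v where v: "v \<noteq> 0" "tangent0 T v"
      using S(1) is_circle_imp_tangent0 unfolding simple_bundle_def by metis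
    obtain b where "T = circ v b" using v(2) by (rule tangent0_imp_circ)
    then have "T = osculating_circle a v" using osculating_circle_eqI[OF v(1) a(3)] T v(1) by blast
    then show "T \<in> osculating_bundle a" using v(1) unfolding osculating_bundle_def by blast
  next
    fix T assume "T \<in> osculating_bundle a"
    then obtain v where v: "v \<noteq> 0" "T = osculating_circle a v" unfolding osculating_bundle_def by blast
    obtain b where b: "circ v b \<in> \<S>" using complete_bundle_circ[OF S(2) v(1)] by blast
    then have "circ v b = T" using osculating_circle_eqI[OF v(1) a(3)[OF v(1) b]] v(2) by simp
    then show "T \<in> \<S>" using b by simp
  qed
  moreover have "bundle_class \<S> = Vrel `` {quadC a}"
    unfolding bundle_class_def \<Phi>_def[symmetric] Phi2_eq[OF a(1)] ..
  ultimately show ?thesis using a(1,2) that unfolding quad_taylor_def by blast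
qed

text \<open>A single curve on the common circle has a second order coefficient that agrees modulo
  \<open>v\<close> with both quadratic values.\<close>

lemma osculating_circle_eqD:
  assumes "v \<noteq> 0" "osculating_circle a v = osculating_circle c v"
  shows "quadR a v - quadR c v \<in> span {v}"
proof -
  obtain R r where R: "\<And>t::real. t *\<^sub>R v + t\<^sup>2 *\<^sub>R R t \<in> osculating_circle a v" "(R \<longlongrightarrow> r) (at 0)"
    using circ_parametrization[of v "(1 / (v \<bullet> v)) *\<^sub>R quadR a v"] unfolding osculating_circle_def by blast
  have *: "r - quadR e v \<in> span {v}" if e: "osculating_circle e v = osculating_circle a v" for e
  proof -
    have "r - (v \<bullet> v) *\<^sub>R ((1 / (v \<bullet> v)) *\<^sub>R quadR e v) \<in> span {v}"
    proof (rule circ_osculate(2)[OF order_refl _ _ R(2)])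
      show "\<forall>\<^sub>F t in at 0. t *\<^sub>R v + t\<^sup>2 *\<^sub>R R t \<in> circ v ((1 / (v \<bullet> v)) *\<^sub>R quadR e v)"
        using R(1) unfolding e[unfolded osculating_circle_def] osculating_circle_def by simp
    qed simp
    then show ?thesis using assms(1) by simp
  qed
  have "(r - quadR c v) - (r - quadR a v) \<in> span {v}"
    by (rule span_diff[OF *[OF assms(2)[symmetric]] *[OF refl]])
  then show ?thesis by simp
qed

theorem theorem2:
  fixes dummy :: "'n::finite"
  shows "(\<forall>\<S>\<in>(complete_rectifiable_bundles :: (real^'n) set set set).
            \<exists>\<Phi>. normalized_rectifier \<S> \<Phi>)
       \<and> (\<forall>\<S>\<in>(complete_rectifiable_bundles :: (real^'n) set set set). \<forall>\<Phi> \<Psi>.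
            normalized_rectifier \<S> \<Phi> \<longrightarrow> normalized_rectifier \<S> \<Psi> \<longrightarrow>
            Phi2 \<Phi> \<in> Vn \<and> Phi2 \<Phi> - Phi2 \<Psi> \<in> Wn)
       \<and> bij_betw bundle_class (complete_rectifiable_bundles :: (real^'n) set set set) VmodW"
proof (intro conjI ballI allI impI)
  fix \<S> :: "(real^'n) set set" assume "\<S> \<in> complete_rectifiable_bundles"
  then show "\<exists>\<Phi>. normalized_rectifier \<S> \<Phi>"
    by (simp add: complete_rectifiable_bundles_def rectifiable_imp_normalized_rectifier)
next
  fix \<S> :: "(real^'n) set set" and \<Phi> \<Psi>
  assume S: "\<S> \<in> complete_rectifiable_bundles" and r: "normalized_rectifier \<S> \<Phi>" "normalized_rectifier \<S> \<Psi>"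
  have complete: "complete_bundle \<S>" using S by (simp add: complete_rectifiable_bundles_def)
  obtain a where a: "quad_taylor \<Phi> a" "quadC a \<in> Vn"
    "\<And>v b. v \<noteq> 0 \<Longrightarrow> circ v b \<in> \<S> \<Longrightarrow> quadR a v - (v \<bullet> v) *\<^sub>R b \<in> span {v}"
    using normalized_rectifier_expansion[OF complete r(1)] by blast
  obtain c where c: "quad_taylor \<Psi> c" "quadC c \<in> Vn"
    "\<And>v b. v \<noteq> 0 \<Longrightarrow> circ v b \<in> \<S> \<Longrightarrow> quadR c v - (v \<bullet> v) *\<^sub>R b \<in> span {v}"
    using normalized_rectifier_expansion[OF complete r(2)] by blast
  show "Phi2 \<Phi> \<in> Vn" using a(2) Phi2_eq[OF a(1)] by simp
  \<comment> \<open>Both values are congruent modulo \<open>v\<close> to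
    \<open>(v \<bullet> v) b\<close>, for the same circle of the bundle.\<close>
  have "quadR a v - quadR c v \<in> span {v}" for v
  proof (cases "v = 0")
    case False
    obtain b where b: "circ v b \<in> \<S>" using complete_bundle_circ[OF complete False] by blast
    show ?thesis using span_diff[OF a(3)[OF False b] c(3)[OF False b]] by simp
  qed (simp add: quadR_0 span_zero)
  then show "Phi2 \<Phi> - Phi2 \<Psi> \<in> Wn"
    unfolding Phi2_eq[OF a(1)] Phi2_eq[OF c(1)]
    using a(1) c(1) by (simp add: quadR_radial_iff_Wn quad_taylor_def)
next
  show "bij_betw bundle_class (complete_rectifiable_bundles :: (real^'n) set set set) VmodW"
  proof (rule bij_betw_imageI; (rule inj_onI | rule equalityI[OF subsetI subsetI]))
    fix \<S> \<T> :: "(real^'n) set set"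
    assume S: "\<S> \<in> complete_rectifiable_bundles" and T: "\<T> \<in> complete_rectifiable_bundles"
      and eq: "bundle_class \<S> = bundle_class \<T>"
    obtain a where a: "sym_coeffs a" "quadC a \<in> Vn" "bundle_class \<S> = Vrel `` {quadC a}" "\<S> = osculating_bundle a"
      using bundle_class_coefficients[OF S] by blast
    obtain c where c: "sym_coeffs c" "quadC c \<in> Vn" "bundle_class \<T> = Vrel `` {quadC c}" "\<T> = osculating_bundle c"
      using bundle_class_coefficients[OF T] by blast
    have "(quadC a, quadC c) \<in> Vrel"
      using eq_equiv_class[OF _ equiv_Vrel c(2)] eq a(3) c(3) by metis
    then have "quadR a v - quadR c v \<in> span {v}" for v
      unfolding Vrel_def using Wn_imp_quadR_radial by blast
    then have "osculating_circle a v = osculating_circle c v" if "v \<noteq> 0" for v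
      using osculating_circle_eqI[OF that, of a "(1 / (v \<bullet> v)) *\<^sub>R quadR c v"] that
      by (simp add: osculating_circle_def)
    then show "\<S> = \<T>" unfolding a(4) c(4) osculating_bundle_def by (intro image_cong) auto
  next
    fix X :: "(complex^'n \<Rightarrow> complex^'n) set"
    assume "X \<in> bundle_class ` complete_rectifiable_bundles"
    then obtain \<S> :: "(real^'n) set set" where S: "\<S> \<in> complete_rectifiable_bundles" "X = bundle_class \<S>" by blast
    obtain a where "quadC a \<in> Vn" "bundle_class \<S> = Vrel `` {quadC a}"
      using bundle_class_coefficients[OF S(1)] by blast
    then show "X \<in> VmodW" unfolding VmodW_def S(2) by (auto intro: quotientI)
  next
    fix X :: "(complex^'n \<Rightarrow> complex^'n) set"
    assume "X \<in> VmodW"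
    then obtain \<Gamma> where \<Gamma>: "\<Gamma> \<in> Vn" "X = Vrel `` {\<Gamma>}" unfolding VmodW_def by (rule quotientE)
    then obtain c where c: "sym_coeffs c" "\<Gamma> = quadC c" unfolding Vn_def by blast
    have S: "osculating_bundle c \<in> complete_rectifiable_bundles"
      using osculating_bundle_simple_complete osculating_bundle_rectifiable \<Gamma>(1) c(2)
      unfolding complete_rectifiable_bundles_def by blast
    \<comment> \<open>The rectifier selected by \<open>bundle_class\<close> may differ from the one
      constructed out of \<open>c\<close>, hence the new coefficients \<open>a\<close>; equality of
      the bundles makes the difference radial.\<close>
    obtain a where a: "sym_coeffs a" "quadC a \<in> Vn" "bundle_class (osculating_bundle c) = Vrel `` {quadC a}"
      "osculating_bundle c = osculating_bundle a"
      using bundle_class_coefficients[OF S] by blast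
    have "quadR a v - quadR c v \<in> span {v}" for v
    proof (cases "v = 0")
      case False
      have "osculating_circle a v \<in> osculating_bundle c" using False a(4) unfolding osculating_bundle_def by blast
      moreover have "tangent0 (osculating_circle a v) v"
        unfolding osculating_circle_def using False by (rule circ_is_circle)
      ultimately have "osculating_circle a v = osculating_circle c v" by (rule osculating_bundle_tangent)
      with False show ?thesis by (rule osculating_circle_eqD)
    qed (simp add: quadR_0 span_zero)
    then have "(quadC a, quadC c) \<in> Vrel"
      unfolding Vrel_def using a(1,2) c \<Gamma>(1) by (simp add: quadR_radial_iff_Wn)
    then have "X = bundle_class (osculating_bundle c)"
      unfolding \<Gamma>(2) a(3) c(2) using equiv_class_eq[OF equiv_Vrel] by metis
    then show "X \<in> bundle_class ` complete_rectifiable_bundles" using S by blast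
  qed
qed

end
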